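(* Let $n\ge2$, $l\ge1$, and let $\psi:\mathrm{BS}(1,n^l)\to G_n$ be a lattice embedding. Then there are $s\in\mathbb{R}\setminus\{0\}$ and a positive integer $m$ satisfying $(\ast)$ every prime factor of $m$ divides $n$, and $n\nmid m$, such that $\psi$ is conjugate to $\phi_{s,m}$ (i.e. there is $g\in G_n$ with $g\,\psi(x)\,g^{-1}=\phi_{s,m}(x)$ for all $x\in \mathrm{BS}(1,n^l)$). The pair $(s,m)$ is a complete conjugacy invariant of lattice embeddings $\mathrm{BS}(1,n^l)\to G_n$; in particular, if $m,m'$ both satisfy $(\ast)$ and $(s,m)\ne(s',m')$, then $\phi_{s,m}$ and $\phi_{s',m'}$ are not conjugate.
   Context: Fix an integer $n\ge 2$. Let $T=T_{1,n}$ be the oriented tree (edges of length 1) in which every vertex has exactly $1$ incoming and $n$ outgoing edges. Fix a base vertex $v_0\in T$. For $w\in T$ let $h(w)$ be the signed length of the geodesic from $v_0$ to $w$ (traversing edges along the orientation counts positively, against it negatively). Let $\mathbb{H}^2=\{(x,y)\in\mathbb{R}^2: y>0\}$ with the metric $y^{-2}(dx^2+dy^2)$ and put $h(x,y)=\log_n(y)$. The space $X_n=\{(z,w)\in\mathbb{H}^2\times T: h(z)=h(w)\}$, with projection $p:X_n\to\mathbb{H}^2$, carries the path metric in which a path $\gamma$ is smooth if $p\circ\gamma$ is smooth and its length is the hyperbolic length of $p\circ\gamma$; distance is the infimum of lengths of piecewise smooth paths. $\mathrm{Isom}(X_n)$ (with the compact-open topology) is identified with the group of pairs $(f,g)$,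 where $f\in\mathrm{Isom}(\mathbb{H}^2)$ fixes the boundary point $\infty$, $g$ is an orientation-preserving automorphism of $T$ (preserving the orientation of edges), and $f,g$ have the same height change ($h(f(z))-h(z)=h(g(w))-h(w)$ for all $z,w$); the pair acts by $(z,w)\mapsto(f(z),g(w))$. $G_n=\mathrm{Isom}^+(X_n)$ is the subgroup of pairs with $f$ orientation-preserving. Standard elements. For a vertex $v$, $\mathrm{up}(v)$ is the subtree of vertices $w$ such that the geodesic from $v$ to $w$ is coherently oriented (upward), and $\mathrm{up}_k(v)=\{w\in\mathrm{up}(v):d(v,w)=k\}$. Label $\mathrm{up}_k(v_0)$ bijectively by $\mathbb{Z}/n^k$ for each $k$ so that the label of $w\in\mathrm{up}_k(v_0)$ reduces mod $n^{k-1}$ to the label of its downward neighbour. On $\mathrm{up}(v_0)$, let $a$ act by $x\mapsto x+1$ on labels of each $\mathrm{up}_k(v_0)$; let $b:\mathrm{up}(v_0)\to\mathrm{up}(v_0)$ be the injection $\mathrm{up}_k(v_0)\to\mathrm{up}_{k+1}(v_0)$, $[x]\mapsto[nx]$, and extend $b$ (arbitrarily, once and for all) to an orientation-preserving automorphism of $T$. For every $x\in T$ some $b^k x$ with $k\ge 0$ lies in $\mathrm{up}(v_0)$; extend $a$ to $T$ by $a\cdot x=b^{-k}(a|_{\mathrm{up}(v_0)})^{n^k}b^k\cdot x$ (independent of $k$). Then $bab^{-1}=a^n$ in the automorphism group of $T$. For $s\in\mathbb{R}\setminus\{0\}$, $a_s\in G_n$ is the isometry acting on $T$ by $a$ and on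 $\mathbb{H}^2$ by $(x,y)\mapsto(x+s,y)$; $b\in G_n$ acts on $T$ by $b$ and on $\mathbb{H}^2$ by $(x,y)\mapsto(nx,ny)$. $\mathrm{BS}(1,n)=\langle a,b\mid bab^{-1}=a^n\rangle$, and $\mathrm{BS}(1,n^l)$ is identified with $\langle a,b^l\rangle\subset\mathrm{BS}(1,n)$. For $s\in\mathbb{R}\setminus\{0\}$ and a positive integer $m$, $\phi_{s,m}:\mathrm{BS}(1,n^l)\to G_n$ is the homomorphism with $\phi_{s,m}(a)=(a_s)^m$ and $\phi_{s,m}(b^l)=b^l$. A lattice is a discrete subgroup of finite covolume; a lattice embedding is an injective homomorphism whose image is a lattice. *)

theory Defs
  imports "HOL-Analysis.Analysis" "HOL-Algebra.Bij" "HOL-Algebra.Coset"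
    "HOL-Computational_Algebra.Primes"
begin

section \<open>Groups given by generators and relators\<close>

text \<open>A letter \<open>(x, True)\<close> stands for the generator \<open>x\<close>, and \<open>(x, False)\<close> for its inverse.\<close>

type_synonym 'x word = "('x \<times> bool) list"

inductive pres_eq :: "'x word set \<Rightarrow> 'x word \<Rightarrow> 'x word \<Rightarrow> bool" for R where
  pres_refl: "pres_eq R u u"
| pres_sym: "pres_eq R u v \<Longrightarrow> pres_eq R v u"
| pres_trans: "pres_eq R u v \<Longrightarrow> pres_eq R v w \<Longrightarrow> pres_eq R u w"
| pres_cong: "pres_eq R u v \<Longrightarrow> pres_eq R (p @ u @ q) (p @ v @ q)"
| pres_cancel: "pres_eq R [(x, e), (x, \<not> e)] []"
| pres_relator: "r \<in> R \<Longrightarrow> pres_eq R r []"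

definition pres_class :: "'x word set \<Rightarrow> 'x word \<Rightarrow> 'x word set" where
  "pres_class R u = {v. pres_eq R u v}"

definition presented_group :: "'x word set \<Rightarrow> 'x word set monoid" where
  "presented_group R =
    \<lparr>carrier = range (pres_class R),
     mult = (\<lambda>X Y. \<Union>u\<in>X. \<Union>v\<in>Y. pres_class R (u @ v)),
     one = pres_class R []\<rparr>"

definition word_eval :: "('g, 'm) monoid_scheme \<Rightarrow> ('x \<Rightarrow> 'g) \<Rightarrow> 'x word \<Rightarrow> 'g" where
  "word_eval G c w =
    foldr (\<lambda>(x, e) y. (if e then c x else inv\<^bsub>G\<^esub> (c x)) \<otimes>\<^bsub>G\<^esub> y) w \<one>\<^bsub>G\<^esub>"

text \<open>The homomorphism out of a presented group that sends the generator \<open>x\<close> to \<open>c x\<close>.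
  If \<open>c\<close> satisfies the relators then all representatives of a class \<open>X\<close> have
  the same value; see \<open>presentation_lift_hom\<close> below.\<close>

definition presentation_lift ::
  "('g, 'm) monoid_scheme \<Rightarrow> ('x \<Rightarrow> 'g) \<Rightarrow> 'x word set \<Rightarrow> 'g" where
  "presentation_lift G c X = the_elem (word_eval G c ` X)"

lemma pres_class_eq_iff: "pres_class R u = pres_class R v \<longleftrightarrow> pres_eq R u v"
  proof
  assume "pres_class R u = pres_class R v"
  then have "v \<in> pres_class R u" by (simp add: pres_class_def pres_refl)
  then show "pres_eq R u v" by (simp add: pres_class_def)
next
  assume "pres_eq R u v"
  then show "pres_class R u = pres_class R v"
    unfolding pres_class_def by (blast intro: pres_sym pres_trans)
qed

lemma pres_eq_append: "pres_eq R u u' \<Longrightarrow> pres_eq R v v' \<Longrightarrow> pres_eq R (u @ v) (u' @ v')"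
  using pres_cong[of R u u' "[]" v] pres_cong[of R v v' u' "[]"] pres_trans[of R "u @ v" "u' @ v" "u' @ v'"]
  by simp

lemma presented_mult:
  "pres_class R u \<otimes>\<^bsub>presented_group R\<^esub> pres_class R v = pres_class R (u @ v)"
proof -
  have "pres_class R (u' @ v') = pres_class R (u @ v)"
    if "u' \<in> pres_class R u" "v' \<in> pres_class R v" for u' v'
    using that unfolding pres_class_eq_iff
    by (intro pres_sym[OF pres_eq_append]) (simp_all add: pres_class_def)
  moreover have "u \<in> pres_class R u" "v \<in> pres_class R v"
    by (simp_all add: pres_class_def pres_refl)
  ultimately have "(\<Union>u'\<in>pres_class R u. \<Union>v'\<in>pres_class R v. pres_class R (u' @ v'))
      = pres_class R (u @ v)"
    by blast
  then show ?thesis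
    by (simp add: presented_group_def)
qed

lemma pres_left_inverse: "\<exists>v. pres_eq R (v @ u) []"
proof (induction u)
  case Nil
  show ?case by (rule exI[of _ "[]"]) (simp add: pres_refl)
next
  case (Cons a u)
  obtain x e where a: "a = (x, e)" by (cases a)
  obtain v where v: "pres_eq R (v @ u) []" using Cons by blast
  have "pres_eq R (v @ [(x, \<not> e), (x, \<not> \<not> e)] @ u) (v @ [] @ u)"
    by (intro pres_cong pres_cancel)
  then have "pres_eq R ((v @ [(x, \<not> e)]) @ a # u) []"
    using pres_trans[OF _ v] a by simp
  then show ?case by blast
qed

lemma group_presented_group: "group (presented_group R)"
proof (rule groupI)
  show "\<one>\<^bsub>presented_group R\<^esub> \<in> carrier (presented_group R)"
    by (simp add: presented_group_def)
next
  fix X Y assume "X \<in> carrier (presented_group R)" "Y \<in> carrier (presented_group R)"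
  then obtain u v where "X = pres_class R u" "Y = pres_class R v"
    by (auto simp: presented_group_def)
  then have "X \<otimes>\<^bsub>presented_group R\<^esub> Y = pres_class R (u @ v)"
    by (simp add: presented_mult)
  then show "X \<otimes>\<^bsub>presented_group R\<^esub> Y \<in> carrier (presented_group R)"
    by (simp add: presented_group_def)
next
  fix X Y Z
  assume "X \<in> carrier (presented_group R)" "Y \<in> carrier (presented_group R)"
    "Z \<in> carrier (presented_group R)"
  then obtain u v w where "X = pres_class R u" "Y = pres_class R v" "Z = pres_class R w"
    by (auto simp: presented_group_def)
  then show "X \<otimes>\<^bsub>presented_group R\<^esub> Y \<otimes>\<^bsub>presented_group R\<^esub> Z
      = X \<otimes>\<^bsub>presented_group R\<^esub> (Y \<otimes>\<^bsub>presented_group R\<^esub> Z)"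
    by (simp add: presented_mult)
next
  fix X assume "X \<in> carrier (presented_group R)"
  then obtain u where u: "X = pres_class R u" by (auto simp: presented_group_def)
  have one: "\<one>\<^bsub>presented_group R\<^esub> = pres_class R []" by (simp add: presented_group_def)
  show "\<one>\<^bsub>presented_group R\<^esub> \<otimes>\<^bsub>presented_group R\<^esub> X = X"
    by (simp add: one u presented_mult)
  obtain v where "pres_eq R (v @ u) []" using pres_left_inverse by blast
  then have "pres_class R v \<otimes>\<^bsub>presented_group R\<^esub> X = \<one>\<^bsub>presented_group R\<^esub>"
    by (simp add: one u presented_mult pres_class_eq_iff)
  then show "\<exists>Y\<in>carrier (presented_group R).
      Y \<otimes>\<^bsub>presented_group R\<^esub> X = \<one>\<^bsub>presented_group R\<^esub>"
    by (auto simp: presented_group_def)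
qed

context group
begin

lemma word_eval_closed:
  assumes "\<And>x. c x \<in> carrier G"
  shows "word_eval G c w \<in> carrier G"
  using assms by (induction w) (auto simp: word_eval_def)

lemma word_eval_append:
  assumes "\<And>x. c x \<in> carrier G"
  shows "word_eval G c (u @ v) = word_eval G c u \<otimes> word_eval G c v"
proof (induction u)
  case Nil
  have "word_eval G c [] = \<one>" by (simp add: word_eval_def)
  then show ?case using word_eval_closed[where c = c, OF assms] by simp
next
  case (Cons a u)
  have rec: "word_eval G c (a # w) = (if snd a then c (fst a) else inv (c (fst a))) \<otimes> word_eval G c w"
    for w by (cases a) (simp add: word_eval_def)
  show ?case
    unfolding append_Cons rec Cons
    by (simp add: assms m_assoc word_eval_closed[where c = c, OF assms])
qed

lemma word_eval_pres_eq:
  assumes "\<And>x. c x \<in> carrier G" and "\<And>r. r \<in> R \<Longrightarrow> word_eval G c r = \<one>"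
    and "pres_eq R u v"
  shows "word_eval G c u = word_eval G c v"
  using assms(3)
proof induction
  case (pres_cancel x e)
  then show ?case using assms(1) by (simp add: word_eval_def)
next
  case (pres_relator r)
  then show ?case using assms(2) by (simp add: word_eval_def)
qed (simp_all add: word_eval_append assms(1))

lemma presentation_lift_class:
  assumes "\<And>x. c x \<in> carrier G" and "\<And>r. r \<in> R \<Longrightarrow> word_eval G c r = \<one>"
  shows "presentation_lift G c (pres_class R w) = word_eval G c w"
proof -
  have "word_eval G c ` pres_class R w = {word_eval G c w}"
  proof (intro equalityI subsetI)
    fix y assume "y \<in> word_eval G c ` pres_class R w"
    then obtain v where "pres_eq R w v" and y: "y = word_eval G c v"
      by (auto simp: pres_class_def)
    then have "word_eval G c w = word_eval G c v"
      by (intro word_eval_pres_eq[where c = c and R = R] assms)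
    then show "y \<in> {word_eval G c w}" by (simp add: y)
  next
    fix y assume "y \<in> {word_eval G c w}"
    moreover have "w \<in> pres_class R w" by (simp add: pres_class_def pres_refl)
    ultimately show "y \<in> word_eval G c ` pres_class R w" by blast
  qed
  then show ?thesis by (simp add: presentation_lift_def)
qed

lemma presentation_lift_hom:
  assumes "\<And>x. c x \<in> carrier G" and "\<And>r. r \<in> R \<Longrightarrow> word_eval G c r = \<one>"
  shows "presentation_lift G c \<in> hom (presented_group R) G"
    and "presentation_lift G c (pres_class R [(x, True)]) = c x"
proof -
  have carr: "carrier (presented_group R) = range (pres_class R)"
    by (simp add: presented_group_def)
  show "presentation_lift G c \<in> hom (presented_group R) G"
    unfolding hom_def carr
    by (auto simp: presented_mult presentation_lift_class[where c = c and R = R, OF assms]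
        word_eval_append[where c = c, OF assms(1)] word_eval_closed[where c = c, OF assms(1)])
  show "presentation_lift G c (pres_class R [(x, True)]) = c x"
    by (simp add: presentation_lift_class[where c = c and R = R, OF assms] word_eval_def assms(1))
qed

end

text \<open>\<open>BS q\<close> is the group with presentation \<open>\<langle>a, b | b a b\<inverse> = a\<^sup>q\<rangle>\<close>. When \<open>BS (n ^ l)\<close> is
  regarded as the subgroup of \<open>BS n\<close> generated by \<open>a\<close> and \<open>b\<^sup>l\<close>, the generator \<open>GenB\<close> is \<open>b\<^sup>l\<close>.\<close>

datatype bs_gen = GenA | GenB

definition BS :: "nat \<Rightarrow> bs_gen word set monoid" where
  "BS q = presented_group
    {[(GenB, True), (GenA, True), (GenB, False)] @ replicate q (GenA, False)}"


section \<open>The oriented tree\<close>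

text \<open>The type \<^typ>\<open>'v\<close> is the vertex set; \<open>(u, v) \<in> E\<close> is an edge oriented from \<open>u\<close> to \<open>v\<close>.\<close>

definition adj :: "('v \<times> 'v) set \<Rightarrow> 'v \<Rightarrow> 'v \<Rightarrow> bool" where
  "adj E u v \<longleftrightarrow> (u, v) \<in> E \<or> (v, u) \<in> E"

definition simple_path :: "('v \<times> 'v) set \<Rightarrow> 'v \<Rightarrow> 'v \<Rightarrow> 'v list \<Rightarrow> bool" where
  "simple_path E u v p \<longleftrightarrow>
    p \<noteq> [] \<and> hd p = u \<and> last p = v \<and> distinct p \<and> successively (adj E) p"

definition oriented_tree :: "('v \<times> 'v) set \<Rightarrow> bool" where
  "oriented_tree E \<longleftrightarrow> asym E \<and> (\<forall>u v. \<exists>!p. simple_path E u v p)"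

definition tree_1n :: "nat \<Rightarrow> ('v \<times> 'v) set \<Rightarrow> bool" where
  "tree_1n n E \<longleftrightarrow> oriented_tree E \<and>
    (\<forall>v. card {u. (u, v) \<in> E} = 1) \<and> (\<forall>u. card {v. (u, v) \<in> E} = n)"

definition geodesic :: "('v \<times> 'v) set \<Rightarrow> 'v \<Rightarrow> 'v \<Rightarrow> 'v list" where
  "geodesic E u v = (THE p. simple_path E u v p)"

definition signed_length :: "('v \<times> 'v) set \<Rightarrow> 'v list \<Rightarrow> int" where
  "signed_length E p = (\<Sum>i<length p - 1. if (p ! i, p ! Suc i) \<in> E then 1 else - 1)"

definition vheight :: "('v \<times> 'v) set \<Rightarrow> 'v \<Rightarrow> 'v \<Rightarrow> int" where
  "vheight E v0 w = signed_length E (geodesic E v0 w)"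

definition up :: "('v \<times> 'v) set \<Rightarrow> 'v \<Rightarrow> 'v set" where
  "up E v = {w. successively (\<lambda>x y. (x, y) \<in> E) (geodesic E v w)}"

definition up_level :: "('v \<times> 'v) set \<Rightarrow> nat \<Rightarrow> 'v \<Rightarrow> 'v set" where
  "up_level E k v = {w \<in> up E v. length (geodesic E v w) = Suc k}"

text \<open>Orientation-preserving automorphisms, as maps of the vertex set.\<close>

definition tree_aut :: "('v \<times> 'v) set \<Rightarrow> ('v \<Rightarrow> 'v) set" where
  "tree_aut E = {g. bij g \<and> (\<forall>u v. (g u, g v) \<in> E \<longleftrightarrow> (u, v) \<in> E)}"

text \<open>The points of the tree, including those in the interior of edges, are given by their
  barycentric coordinates: \<open>\<alpha>\<close> with \<open>\<alpha> u = 1 - t\<close> and \<open>\<alpha> v = t\<close> is the point at distance \<open>t\<close> from \<open>u\<close>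
  on the edge \<open>(u, v)\<close>. The topology is that of pointwise convergence of the coordinates, which for
  a locally finite tree is the one induced by the length metric with edges of length 1.\<close>

definition tree_points :: "('v \<times> 'v) set \<Rightarrow> ('v \<Rightarrow> real) set" where
  "tree_points E = {\<alpha>. (\<forall>v. 0 \<le> \<alpha> v) \<and>
     ((\<exists>v. {x. \<alpha> x \<noteq> 0} = {v}) \<or> (\<exists>(u, v)\<in>E. {x. \<alpha> x \<noteq> 0} = {u, v})) \<and>
     (\<Sum>x | \<alpha> x \<noteq> 0. \<alpha> x) = 1}"

text \<open>The signed length of the geodesic from \<open>v0\<close> is affine on edges.\<close>

definition theight :: "('v \<times> 'v) set \<Rightarrow> 'v \<Rightarrow> ('v \<Rightarrow> real) \<Rightarrow> real" where
  "theight E v0 \<alpha> = (\<Sum>x | \<alpha> x \<noteq> 0. \<alpha> x * of_int (vheight E v0 x))"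

definition act_tree :: "('v \<Rightarrow> 'v) \<Rightarrow> ('v \<Rightarrow> real) \<Rightarrow> ('v \<Rightarrow> real)" where
  "act_tree g \<alpha> = (\<lambda>v. \<alpha> (inv_into UNIV g v))"


section \<open>The hyperbolic plane\<close>

definition upper_half :: "complex set" where
  "upper_half = {z. Im z > 0}"

text \<open>The length is a Lebesgue integral in \<^typ>\<open>ennreal\<close>, because \<^const>\<open>valid_path\<close> allows the
  derivative to be unbounded near the finitely many exceptional parameters, and a
  non-rectifiable path must get length \<open>\<infinity>\<close>.\<close>

definition hyp_length :: "(real \<Rightarrow> complex) \<Rightarrow> ennreal" where
  "hyp_length \<gamma> =
    (\<integral>\<^sup>+t\<in>{0..1}. ennreal (norm (vector_derivative \<gamma> (at t)) / Im (\<gamma> t)) \<partial>lborel)"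

definition hyp_dist :: "complex \<Rightarrow> complex \<Rightarrow> real" where
  "hyp_dist z w = enn2real (INF \<gamma>\<in>{\<gamma>. valid_path \<gamma> \<and> path_image \<gamma> \<subseteq> upper_half \<and>
      pathstart \<gamma> = z \<and> pathfinish \<gamma> = w}. hyp_length \<gamma>)"

definition hyp_isom :: "(complex \<Rightarrow> complex) set" where
  "hyp_isom = {f \<in> Bij upper_half.
    \<forall>z\<in>upper_half. \<forall>w\<in>upper_half. hyp_dist (f z) (f w) = hyp_dist z w}"

text \<open>The continuous extension of \<open>f\<close> to the boundary maps \<open>\<infinity>\<close> to \<open>\<infinity>\<close>.\<close>

definition fixes_infinity :: "(complex \<Rightarrow> complex) \<Rightarrow> bool" where
  "fixes_infinity f \<longleftrightarrow> filterlim f at_infinity (inf at_infinity (principal upper_half))"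

text \<open>The displayed expression is the determinant of the real-linear map \<open>L\<close> with respect to the
  basis \<open>1, \<i>\<close>.\<close>

definition orientation_preserving :: "(complex \<Rightarrow> complex) \<Rightarrow> bool" where
  "orientation_preserving f \<longleftrightarrow> (\<forall>z\<in>upper_half. \<exists>L. (f has_derivative L) (at z) \<and>
     Re (L 1) * Im (L \<i>) - Im (L 1) * Re (L \<i>) > 0)"

definition hheight :: "nat \<Rightarrow> complex \<Rightarrow> real" where
  "hheight n z = log (real n) (Im z)"


section \<open>The space \<open>X_n\<close> and its isometry group\<close>

definition X_space :: "nat \<Rightarrow> ('v \<times> 'v) set \<Rightarrow> 'v \<Rightarrow> (complex \<times> ('v \<Rightarrow> real)) set" where
  "X_space n E v0 = {(z, \<alpha>). z \<in> upper_half \<and> \<alpha> \<in> tree_points E \<and> hheight n z = theight E v0 \<alpha>}"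

text \<open>Piecewise smooth is read as continuous and piecewise \<open>C\<^sup>1\<close>; the infimum of the lengths is the
  same for piecewise \<open>C\<^sup>\<infinity>\<close> paths.\<close>

definition X_dist ::
  "nat \<Rightarrow> ('v \<times> 'v) set \<Rightarrow> 'v \<Rightarrow> complex \<times> ('v \<Rightarrow> real) \<Rightarrow> complex \<times> ('v \<Rightarrow> real) \<Rightarrow> real" where
  "X_dist n E v0 x y = enn2real (INF \<gamma>\<in>{\<gamma>. path \<gamma> \<and> path_image \<gamma> \<subseteq> X_space n E v0 \<and>
      valid_path (fst \<circ> \<gamma>) \<and> pathstart \<gamma> = x \<and> pathfinish \<gamma> = y}. hyp_length (fst \<circ> \<gamma>))"

definition X_topology ::
  "nat \<Rightarrow> ('v \<times> 'v) set \<Rightarrow> 'v \<Rightarrow> (complex \<times> ('v \<Rightarrow> real)) topology" where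
  "X_topology n E v0 = Metric_space.mtopology (X_space n E v0) (X_dist n E v0)"

type_synonym 'v isom = "(complex \<Rightarrow> complex) \<times> ('v \<Rightarrow> 'v)"

definition act_X :: "'v isom \<Rightarrow> complex \<times> ('v \<Rightarrow> real) \<Rightarrow> complex \<times> ('v \<Rightarrow> real)" where
  "act_X p x = (fst p (fst x), act_tree (snd p) (snd x))"

definition Isom_X :: "nat \<Rightarrow> ('v \<times> 'v) set \<Rightarrow> 'v \<Rightarrow> 'v isom set" where
  "Isom_X n E v0 = {(f, g). f \<in> hyp_isom \<and> fixes_infinity f \<and> g \<in> tree_aut E \<and>
     (\<forall>z\<in>upper_half. \<forall>\<alpha>\<in>tree_points E.
        hheight n (f z) - hheight n z = theight E v0 (act_tree g \<alpha>) - theight E v0 \<alpha>)}"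

definition G_group :: "nat \<Rightarrow> ('v \<times> 'v) set \<Rightarrow> 'v \<Rightarrow> 'v isom monoid" where
  "G_group n E v0 = (BijGroup upper_half \<times>\<times> BijGroup UNIV)
     \<lparr>carrier := {(f, g) \<in> Isom_X n E v0. orientation_preserving f}\<rparr>"

text \<open>The compact-open topology on \<open>G_n\<close>.\<close>

definition G_topology :: "nat \<Rightarrow> ('v \<times> 'v) set \<Rightarrow> 'v \<Rightarrow> 'v isom topology" where
  "G_topology n E v0 = topology_generated_by
     {{p \<in> carrier (G_group n E v0). act_X p ` K \<subseteq> U} | K U.
        compactin (X_topology n E v0) K \<and> openin (X_topology n E v0) U}"


section \<open>Lattices\<close>

text \<open>Finite covolume: the space of right cosets \<open>\<Gamma> g\<close> carries a nonzero finite Borel measure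
  that is invariant under right translation. A set of cosets is open iff its preimage in \<open>G\<close>, that
  is, its union, is open.\<close>

definition finite_covolume :: "('g, 'm) monoid_scheme \<Rightarrow> 'g topology \<Rightarrow> 'g set \<Rightarrow> bool" where
  "finite_covolume G \<tau> \<Gamma> \<longleftrightarrow> (\<exists>\<mu> :: 'g set measure.
     space \<mu> = rcosets\<^bsub>G\<^esub> \<Gamma> \<and>
     sets \<mu> = sigma_sets (rcosets\<^bsub>G\<^esub> \<Gamma>) {\<U>. \<U> \<subseteq> rcosets\<^bsub>G\<^esub> \<Gamma> \<and> openin \<tau> (\<Union>\<U>)} \<and>
     emeasure \<mu> (space \<mu>) \<noteq> 0 \<and> emeasure \<mu> (space \<mu>) \<noteq> \<infinity> \<and>
     (\<forall>g\<in>carrier G. \<forall>A\<in>sets \<mu>. emeasure \<mu> ((\<lambda>C. C #>\<^bsub>G\<^esub> g) ` A) = emeasure \<mu> A))"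

definition lattice_subgroup :: "('g, 'm) monoid_scheme \<Rightarrow> 'g topology \<Rightarrow> 'g set \<Rightarrow> bool" where
  "lattice_subgroup G \<tau> \<Gamma> \<longleftrightarrow>
     subgroup \<Gamma> G \<and> subtopology \<tau> \<Gamma> = discrete_topology \<Gamma> \<and> finite_covolume G \<tau> \<Gamma>"

definition lattice_embedding ::
  "('b, 'k) monoid_scheme \<Rightarrow> ('g, 'm) monoid_scheme \<Rightarrow> 'g topology \<Rightarrow> ('b \<Rightarrow> 'g) \<Rightarrow> bool" where
  "lattice_embedding B G \<tau> \<psi> \<longleftrightarrow>
     \<psi> \<in> hom B G \<and> inj_on \<psi> (carrier B) \<and> lattice_subgroup G \<tau> (\<psi> ` carrier B)"

definition conjugate_homs ::
  "('b, 'k) monoid_scheme \<Rightarrow> ('g, 'm) monoid_scheme \<Rightarrow> ('b \<Rightarrow> 'g) \<Rightarrow> ('b \<Rightarrow> 'g) \<Rightarrow> bool" where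
  "conjugate_homs B G \<psi> \<phi> \<longleftrightarrow>
     (\<exists>g\<in>carrier G. \<forall>x\<in>carrier B. g \<otimes>\<^bsub>G\<^esub> \<psi> x \<otimes>\<^bsub>G\<^esub> inv\<^bsub>G\<^esub> g = \<phi> x)"


section \<open>The standard elements and homomorphisms\<close>

text \<open>Elements of \<open>\<int>/n\<^sup>k\<close> are represented by their least nonnegative residues. For
  \<open>w \<in> up_level E (Suc k) v0\<close> the unique \<open>u\<close> with \<open>(u, w) \<in> E\<close> is the downward neighbour of \<open>w\<close>.\<close>

definition compatible_labels ::
  "nat \<Rightarrow> ('v \<times> 'v) set \<Rightarrow> 'v \<Rightarrow> ('v \<Rightarrow> nat) \<Rightarrow> bool" where
  "compatible_labels n E v0 lab \<longleftrightarrow>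
     (\<forall>k. bij_betw lab (up_level E k v0) {..<n ^ k}) \<and>
     (\<forall>k. \<forall>w\<in>up_level E (Suc k) v0. \<forall>u. (u, w) \<in> E \<longrightarrow> lab u = lab w mod n ^ k)"

text \<open>\<open>b\<close> is an automorphism of the tree extending the injection \<open>[x] \<mapsto> [n x]\<close> of \<open>up E v0\<close>.\<close>

definition b_extension ::
  "nat \<Rightarrow> ('v \<times> 'v) set \<Rightarrow> 'v \<Rightarrow> ('v \<Rightarrow> nat) \<Rightarrow> ('v \<Rightarrow> 'v) \<Rightarrow> bool" where
  "b_extension n E v0 lab b \<longleftrightarrow> b \<in> tree_aut E \<and>
     (\<forall>k. \<forall>w\<in>up_level E k v0. b w \<in> up_level E (Suc k) v0 \<and> lab (b w) = n * lab w)"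

definition a_up :: "nat \<Rightarrow> ('v \<times> 'v) set \<Rightarrow> 'v \<Rightarrow> ('v \<Rightarrow> nat) \<Rightarrow> 'v \<Rightarrow> 'v" where
  "a_up n E v0 lab w =
     (THE w'. \<exists>k. w \<in> up_level E k v0 \<and> w' \<in> up_level E k v0 \<and> lab w' = (lab w + 1) mod n ^ k)"

text \<open>The choice of \<open>k\<close> with \<open>b\<^sup>k x \<in> up E v0\<close> is immaterial; the least one is taken.\<close>

definition a_tree ::
  "nat \<Rightarrow> ('v \<times> 'v) set \<Rightarrow> 'v \<Rightarrow> ('v \<Rightarrow> nat) \<Rightarrow> ('v \<Rightarrow> 'v) \<Rightarrow> 'v \<Rightarrow> 'v" where
  "a_tree n E v0 lab b x =
     (let k = (LEAST k. (b ^^ k) x \<in> up E v0)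
      in (inv_into UNIV b ^^ k) ((a_up n E v0 lab ^^ (n ^ k)) ((b ^^ k) x)))"

definition a_isom ::
  "nat \<Rightarrow> ('v \<times> 'v) set \<Rightarrow> 'v \<Rightarrow> ('v \<Rightarrow> nat) \<Rightarrow> ('v \<Rightarrow> 'v) \<Rightarrow> real \<Rightarrow> 'v isom" where
  "a_isom n E v0 lab b s = (\<lambda>z\<in>upper_half. z + of_real s, a_tree n E v0 lab b)"

definition b_isom :: "nat \<Rightarrow> ('v \<Rightarrow> 'v) \<Rightarrow> 'v isom" where
  "b_isom n b = (\<lambda>z\<in>upper_half. of_nat n * z, b)"

definition phi ::
  "nat \<Rightarrow> nat \<Rightarrow> ('v \<times> 'v) set \<Rightarrow> 'v \<Rightarrow> ('v \<Rightarrow> nat) \<Rightarrow> ('v \<Rightarrow> 'v) \<Rightarrow> real \<Rightarrow> nat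
    \<Rightarrow> bs_gen word set \<Rightarrow> 'v isom" where
  "phi n l E v0 lab b s m = presentation_lift (G_group n E v0)
     (\<lambda>x. case x of
        GenA \<Rightarrow> a_isom n E v0 lab b s [^]\<^bsub>G_group n E v0\<^esub> m
      | GenB \<Rightarrow> b_isom n b [^]\<^bsub>G_group n E v0\<^esub> l)"

definition reduced_multiplier :: "nat \<Rightarrow> nat \<Rightarrow> bool" where
  "reduced_multiplier n m \<longleftrightarrow> m > 0 \<and> (\<forall>p. prime p \<longrightarrow> p dvd m \<longrightarrow> p dvd n) \<and> \<not> n dvd m"

end

theory Submission
  imports Defs "HOL-Combinatorics.Cycles"
begin

text \<open>An element of \<open>G_n\<close> is a pair \<open>(n\<^sup>k z + t, g)\<close>, where \<open>g\<close> is a tree automorphism raising heights by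
  \<open>k\<close>: an orientation preserving isometry of the half plane that scales heights by a constant
  has derivative equal to that constant. For a lattice embedding \<open>\<psi>\<close>, let \<open>A\<close>, \<open>B\<close> be the tree parts of
  \<open>\<psi> a\<close>, \<open>\<psi> b\<^sup>l\<close>. The finite invariant measure on the coset space excludes that all
  of the image preserves heights or fixes a boundary point other than \<open>\<infinity>\<close>; so \<open>\<psi> a\<close> translates by some
  \<open>\<sigma> \<noteq> 0\<close> and \<open>B\<close> raises heights by exactly \<open>l\<close>. It also shows that the image is transitive on the
  vertices of each height. The stabilizer of a suitable vertex \<open>u\<close> on the axis of \<open>B\<close> is then a union of
  cyclic groups that becomes stationary, with a generator \<open>\<alpha>\<close> acting on the vertices above \<open>u\<close>
  exactly as the standard \<open>a\<close> does above \<open>v0\<close>. Hence \<open>(\<alpha>, B)\<close> is conjugate to \<open>(a, b\<^sup>l)\<close>, and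
  \<open>A = \<alpha>\<^sup>m\<close>. Conversely \<open>m\<close> and the height change of a conjugator can be read off from the
  vertices fixed by powers of \<open>a\<^sup>m\<close>.\<close>

section \<open>Trees with a parent function\<close>

text \<open>The condition on \<open>m\<close> removes two ambiguities. Conjugation by the standard
  \<open>b\<close> turns \<open>a\<close> into \<open>a^n\<close>, so \<open>m\<close> and
  \<open>n * m\<close> would give conjugate embeddings; this is settled by taking \<open>u\<close>
  to be the top of the part of the axis fixed by \<open>A\<close>. A power \<open>a^p\<close> with
  \<open>p\<close> prime to \<open>n\<close> acts above \<open>v0\<close> as transitively as
  \<open>a\<close> and is conjugate to it in the tree, so such a factor moves into \<open>s\<close>;
  in the proof this happens because \<open>\<alpha>\<close> generates the stabilizer, which leaves
  in \<open>m\<close> only factors of a power of \<open>n\<close>. Conjugacy rests on frames. A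
  frame gives each vertex coordinates that behave like fractions with denominator a power of
  \<open>n\<close>, and equality of coordinates depends on \<open>n\<close> and \<open>l\<close>
  alone, so any two frames are conjugate. The coset measure is evaluated only on sets described by
  where an element sends a vertex, or from where it reaches a given boundary point. Such sets are
  open conditions or differences of these, and that is all the proof takes from the compact-open
  topology; the length metric has to be analysed just far enough to see this.\<close>

lemma funpow_fixed: "f x = x \<Longrightarrow> (f ^^ k) x = x"
  by (induction k) auto

lemma funpow_commute_apply: "(\<And>x. f (g x) = g (f x)) \<Longrightarrow> f ((g ^^ k) x) = (g ^^ k) (f x)"
  by (induction k) auto

lemma funpow_add_apply: "(f ^^ (i + j)) x = (f ^^ i) ((f ^^ j) x)"
  by (simp add: funpow_add)

lemma funpow_fixed_dvd:
  assumes "(f ^^ d) x = x" "d dvd k" shows "(f ^^ k) x = x"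
  using assms funpow_fixed[of "f ^^ d"] by (auto simp: dvd_def funpow_mult)

lemma least_power_dvd_iff:
  assumes "(f ^^ N) x = x" "N > 0"
  shows "(f ^^ k) x = x \<longleftrightarrow> least_power f x dvd k"
  using least_powerI[where f = f, OF assms] least_power_minimal[of k f x] funpow_fixed_dvd[of "least_power f x" f x k]
  by blast

lemma bij_periodic_on_finite:
  assumes "inj f" "finite S" "\<And>k. (f ^^ k) x \<in> S"
  obtains N where "N > 0" "(f ^^ N) x = x"
proof -
  have "\<not> inj (\<lambda>k. (f ^^ k) x)"
    using assms(2,3) by (meson finite_subset image_subset_iff infinite_iff_countable_subset infinite_UNIV_nat finite_imageD)
  then obtain i j where "i < j" "(f ^^ i) x = (f ^^ j) x"
    unfolding inj_def by (metis linorder_neqE_nat)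
  then have "(f ^^ (j - i)) x = x" using funpow_diff[OF assms(1)] by (metis less_imp_le)
  then show ?thesis using that[of "j - i"] \<open>i < j\<close> by simp
qed

text \<open>The least period of \<open>x\<close> is the number of points of its orbit. Nonnegative
  powers suffice, because an injective map is periodic on a finite orbit.\<close>

lemma cyclic_orbit_fixed_iff:
  assumes "inj f" "finite S" "S \<noteq> {}" "S = (\<lambda>p. (f ^^ p) x) ` UNIV"
  shows "(f ^^ p) x = x \<longleftrightarrow> card S dvd p"
proof -
  obtain N where N: "N > 0" "(f ^^ N) x = x"
    using bij_periodic_on_finite[OF assms(1,2)] assms(4) by blast
  let ?d = "least_power f x"
  have d: "(f ^^ k) x = x \<longleftrightarrow> ?d dvd k" for k using least_power_dvd_iff[OF N(2,1)] .
  have dpos: "?d > 0" using least_powerI(2)[where f = f, OF N(2,1)] .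
  have "S = (\<lambda>p. (f ^^ p) x) ` {..<?d}"
  proof -
    have "(f ^^ p) x \<in> (\<lambda>p. (f ^^ p) x) ` {..<?d}" for p
    proof
      have "(f ^^ p) x = (f ^^ (p mod ?d + ?d * (p div ?d))) x" by simp
      also have "\<dots> = (f ^^ (p mod ?d)) x"
        unfolding funpow_add_apply using d[of "?d * (p div ?d)"] by simp
      finally show "(f ^^ p) x = (f ^^ (p mod ?d)) x" .
    qed (use dpos in auto)
    then show ?thesis using assms(4) by auto
  qed
  moreover have "inj_on (\<lambda>p. (f ^^ p) x) {..<?d}"
  proof (rule linorder_inj_onI)
    fix i j assume "i < j" "i \<in> {..<?d}" "j \<in> {..<?d}"
    then have "\<not> ?d dvd j - i" by (auto dest: dvd_imp_le)
    then show "(f ^^ i) x \<noteq> (f ^^ j) x"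
      using d funpow_diff[OF assms(1), of i j x] \<open>i < j\<close> by (metis less_imp_le)
  qed auto
  ultimately have "card S = ?d" by (simp add: card_image)
  then show ?thesis using d by simp
qed

text \<open>Each prime split off from \<open>m\<close> is absorbed by one more factor
  \<open>n\<close>.\<close>

lemma dvd_power_of_prime_divisors:
  fixes m n :: nat
  assumes "m > 0" "\<forall>p. prime p \<longrightarrow> p dvd m \<longrightarrow> p dvd n"
  shows "\<exists>k. m dvd n ^ k"
  using assms
proof (induction m rule: less_induct)
  case (less m)
  show ?case
  proof (cases "m = 1")
    case False
    then obtain p where p: "prime p" "p dvd m" using prime_factor_nat by blast
    then obtain m1 where m1: "m = p * m1" by (auto simp: dvd_def)
    have "m1 < m" using p(1) m1 less.prems(1) prime_gt_1_nat by simp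
    then obtain k where "m1 dvd n ^ k" using less m1 by (metis dvd_mult gr0I mult_is_0 not_less0)
    then have "m dvd n ^ Suc k" using less.prems(2) p m1 by (simp add: mult_dvd_mono)
    then show ?thesis by blast
  qed auto
qed

text \<open>With exactly one edge into every vertex, the oriented tree is recorded by its parent
  map: \<open>common_ancestor\<close> stands for connectedness, and \<open>ht_par\<close> excludes
  cycles. The combinatorial argument can then be run on iterates of \<open>par\<close> instead of
  paths.\<close>

locale horo_tree =
  fixes par :: "'v \<Rightarrow> 'v" and ht :: "'v \<Rightarrow> int" and n :: nat
  assumes ht_par: "ht (par v) = ht v - 1"
    and common_ancestor: "\<exists>i j. (par ^^ i) v = (par ^^ j) w"
    and card_children: "card {w. par w = v} = n"
    and n_ge_2: "n \<ge> 2"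
begin

text \<open>Respecting oriented edges amounts to commuting with \<open>par\<close>, since the edge
  into \<open>v\<close> starts at \<open>par v\<close>; see \<open>tree_aut_iff\<close>.\<close>

definition aut :: "('v \<Rightarrow> 'v) \<Rightarrow> bool" where
  "aut g \<longleftrightarrow> bij g \<and> (\<forall>v. g (par v) = par (g v))"

lemma ht_par_pow: "ht ((par ^^ k) v) = ht v - int k"
  by (induction k) (auto simp: ht_par)

lemma common_ancestor_same:
  assumes "ht v = ht w"
  obtains k where "(par ^^ k) v = (par ^^ k) w"
proof -
  obtain i j where ij: "(par ^^ i) v = (par ^^ j) w" using common_ancestor by blast
  then have "ht v - int i = ht w - int j" by (metis ht_par_pow)
  then show ?thesis using assms ij that[of i] by simp
qed

lemma par_pow_mono: "(par ^^ k) v = (par ^^ k) w \<Longrightarrow> k \<le> k' \<Longrightarrow> (par ^^ k') v = (par ^^ k') w"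
  by (metis funpow_add_apply le_add_diff_inverse2)

lemma autI: "bij g \<Longrightarrow> (\<And>v. g (par v) = par (g v)) \<Longrightarrow> aut g"
  by (simp add: aut_def)

lemma aut_bij: "aut g \<Longrightarrow> bij g"
  by (simp add: aut_def)

lemma aut_inj: "aut g \<Longrightarrow> inj g"
  by (simp add: aut_def bij_def)

lemma aut_eq_iff: "aut g \<Longrightarrow> g x = g y \<longleftrightarrow> x = y"
  using aut_inj by (auto simp: inj_eq)

lemma aut_par: "aut g \<Longrightarrow> g (par v) = par (g v)"
  by (simp add: aut_def)

lemma aut_par_pow: "aut g \<Longrightarrow> g ((par ^^ k) v) = (par ^^ k) (g v)"
  by (simp add: funpow_commute_apply aut_par)

lemma aut_id: "aut id" "aut (\<lambda>x. x)"
  by (auto simp: aut_def id_def[symmetric])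

lemma aut_comp: "aut f \<Longrightarrow> aut g \<Longrightarrow> aut (f \<circ> g)"
  by (auto simp: aut_def bij_comp)

lemma aut_funpow: "aut f \<Longrightarrow> aut (f ^^ k)"
  by (induction k) (auto intro: aut_comp simp: aut_id)

lemma aut_inv_cancel: "aut g \<Longrightarrow> g (inv_into UNIV g x) = x" "aut g \<Longrightarrow> inv_into UNIV g (g x) = x"
  by (simp_all add: aut_bij aut_inj bij_is_surj surj_f_inv_f)

lemma aut_inv: assumes "aut g" shows "aut (inv_into UNIV g)"
proof (rule autI)
  show "bij (inv_into UNIV g)" using assms by (simp add: aut_bij bij_imp_bij_inv)
  fix v
  have "g (par (inv_into UNIV g v)) = par v" using assms by (simp add: aut_par aut_inv_cancel)
  then show "inv_into UNIV g (par v) = par (inv_into UNIV g v)" using assms by (metis aut_inv_cancel(2))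
qed

text \<open>The change of height is the same at a vertex and at its ancestors, and any two vertices
  share an ancestor.\<close>

lemma ht_aut: assumes "aut g" shows "ht (g v) - ht v = ht (g w) - ht w"
proof -
  obtain i j where ij: "(par ^^ i) v = (par ^^ j) w" using common_ancestor by blast
  have "ht v - int i = ht w - int j" using ij by (metis ht_par_pow)
  moreover have "ht (g v) - int i = ht (g w) - int j"
    using ij by (metis assms aut_par_pow ht_par_pow)
  ultimately show ?thesis by simp
qed

lemma finite_children: "finite {w. par w = v}"
  using card_children[of v] n_ge_2 by (metis card.infinite not_numeral_le_zero)

lemma descendants:
  "finite {w. (par ^^ k) w = v} \<and> card {w. (par ^^ k) w = v} = n ^ k"
proof (induction k)
  case (Suc k)
  have eq: "{w. (par ^^ Suc k) w = v} = (\<Union>u\<in>{u. (par ^^ k) u = v}. {w. par w = u})"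
    by (auto simp: funpow_swap1)
  have "card (\<Union>u\<in>{u. (par ^^ k) u = v}. {w. par w = u}) = (\<Sum>u\<in>{u. (par ^^ k) u = v}. card {w. par w = u})"
    by (rule card_UN_disjoint) (use Suc finite_children in auto)
  then show ?case unfolding eq using Suc finite_children card_children by (simp add: mult.commute)
qed simp

lemma finite_descendants: "finite {w. (par ^^ k) w = v}"
  and card_descendants: "card {w. (par ^^ k) w = v} = n ^ k"
  using descendants by auto

text \<open>\<open>v\<close> and \<open>g v\<close> meet after equally many steps down, and
  \<open>g\<close> maps the meeting vertex to itself.\<close>

lemma elliptic_fixes_ancestor:
  assumes "aut g" "ht (g v) = ht v"
  obtains k where "g ((par ^^ k) v) = (par ^^ k) v"
  using common_ancestor_same[OF assms(2)] assms(1) by (metis aut_par_pow)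

text \<open>The orbit stays among the finitely many descendants, at one level, of a fixed ancestor.
  Hence at each single vertex the inverse of an elliptic automorphism acts like a nonnegative power
  of it.\<close>

lemma elliptic_periodic:
  assumes "aut g" "ht (g v) = ht v"
  obtains N where "N > 0" "(g ^^ N) v = v"
proof -
  obtain k where k: "g ((par ^^ k) v) = (par ^^ k) v" using elliptic_fixes_ancestor[OF assms] .
  have "(par ^^ k) ((g ^^ i) v) = (par ^^ k) v" for i
    using aut_par_pow[OF aut_funpow[OF assms(1), of i], of k v] funpow_fixed[where f = g, OF k, of i] by simp
  then have "\<And>i. (g ^^ i) v \<in> {w. (par ^^ k) w = (par ^^ k) v}" by simp
  then show ?thesis
    using bij_periodic_on_finite[OF aut_inj[OF assms(1)] finite_descendants] that by metis
qed

section \<open>Axes of hyperbolic automorphisms, and frames\<close>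

lemma ht_funpow: assumes "aut g" shows "ht ((g ^^ k) w) = ht w + int k * (ht (g v) - ht v)"
proof (induction k)
  case (Suc k)
  have "ht (g ((g ^^ k) w)) - ht ((g ^^ k) w) = ht (g v) - ht v" by (rule ht_aut[OF assms])
  then show ?case using Suc by (simp add: algebra_simps)
qed simp

text \<open>An automorphism \<beta> of translation length \<open>l\<close> need not have an
  \<open>l\<close>-th root, so the unit step along its axis is made by applying \<beta> and
  descending. For \<open>l > 1\<close> the map is not injective on the tree, but it commutes with
  \<open>par\<close> and \<beta>, and on the axis it is the unit translation.\<close>

definition axis_step :: "nat \<Rightarrow> ('v \<Rightarrow> 'v) \<Rightarrow> 'v \<Rightarrow> 'v" where
  "axis_step l \<beta> v = (par ^^ (l - 1)) (\<beta> v)"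

text \<open>The last clause makes the \<open>n ^ k\<close> descendants of \<open>u\<close> at level
  \<open>k\<close> a single orbit of \<alpha>, with the axis vertex as base point. So \<alpha> is an
  adding machine above \<open>u\<close>, and the relation with \<beta> determines it on the rest of
  the tree.\<close>

definition frame :: "nat \<Rightarrow> ('v \<Rightarrow> 'v) \<Rightarrow> ('v \<Rightarrow> 'v) \<Rightarrow> 'v \<Rightarrow> bool" where
  "frame l \<alpha> \<beta> u \<longleftrightarrow> l \<ge> 1 \<and> aut \<alpha> \<and> aut \<beta> \<and> (\<forall>x. \<beta> (\<alpha> x) = (\<alpha> ^^ (n ^ l)) (\<beta> x)) \<and>
     \<alpha> u = u \<and> (par ^^ l) (\<beta> u) = u \<and>
     (\<forall>k w. (par ^^ k) w = u \<longrightarrow> (\<exists>p. w = (\<alpha> ^^ p) ((axis_step l \<beta> ^^ k) u)))"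

lemma conj_funpow:
  assumes "bij g" shows "((\<lambda>x. inv_into UNIV g (f (g x))) ^^ t) x = inv_into UNIV g ((f ^^ t) (g x))"
  by (induction t) (use assms in \<open>auto simp: bij_is_inj bij_is_surj surj_f_inv_f\<close>)

lemma twisted_commute:
  fixes A B :: "'v \<Rightarrow> 'v"
  assumes "\<And>x. B (A x) = (A ^^ q) (B x)"
  shows "(B ^^ i) ((A ^^ p) x) = (A ^^ (q ^ i * p)) ((B ^^ i) x)"
proof -
  have 1: "B ((A ^^ p) x) = (A ^^ (q * p)) (B x)" for p x
    by (induction p) (simp_all add: assms funpow_add)
  show ?thesis by (induction i) (simp_all add: 1 mult.assoc)
qed

context
  fixes l \<beta> u
  assumes l: "l \<ge> 1" and \<beta>: "aut \<beta>" and ax: "(par ^^ l) (\<beta> u) = u"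
begin

lemma axis_step_par: "axis_step l \<beta> (par v) = par (axis_step l \<beta> v)"
  by (simp add: axis_step_def aut_par[OF \<beta>] funpow_swap1)

lemma axis_step_self: "axis_step l \<beta> (\<beta> v) = \<beta> (axis_step l \<beta> v)"
  by (simp add: axis_step_def aut_par_pow[OF \<beta>])

lemma par_axis_step: "par (axis_step l \<beta> u) = u"
proof -
  have "par (axis_step l \<beta> u) = (par ^^ Suc (l - 1)) (\<beta> u)" by (simp add: axis_step_def)
  then show ?thesis using l ax by simp
qed

lemma par_axis_Suc: "par ((axis_step l \<beta> ^^ Suc k) u) = (axis_step l \<beta> ^^ k) u"
proof -
  have "par ((axis_step l \<beta> ^^ Suc k) u) = par ((axis_step l \<beta> ^^ k) (axis_step l \<beta> u))"
    by (simp only: funpow_Suc_right comp_apply)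
  also have "\<dots> = (axis_step l \<beta> ^^ k) (par (axis_step l \<beta> u))"
    by (rule funpow_commute_apply) (simp add: axis_step_par)
  finally show ?thesis by (simp add: par_axis_step)
qed

lemma par_pow_axis: "(par ^^ k) ((axis_step l \<beta> ^^ k) u) = u"
proof (induction k)
  case (Suc k)
  then show ?case by (simp only: funpow_Suc_right[of k par] comp_apply par_axis_Suc)
qed simp

lemma ht_axis: "ht ((axis_step l \<beta> ^^ k) u) = ht u + int k"
  using par_pow_axis[of k] ht_par_pow[of k "(axis_step l \<beta> ^^ k) u"] by simp

lemma ax_\<beta>: "(par ^^ l) (\<beta> (\<beta> u)) = \<beta> u"
  using aut_par_pow[OF \<beta>] ax by metis

lemma axis_step_pow: "(axis_step l \<beta> ^^ k) v = (par ^^ ((l - 1) * k)) ((\<beta> ^^ k) v)"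
proof (induction k)
  case (Suc k)
  then show ?case
    by (simp add: axis_step_def aut_par_pow[OF \<beta>] funpow_add_apply)
qed simp

end

lemma axis_pow:
  assumes "l \<ge> 1" "aut \<beta>" "(par ^^ l) (\<beta> u) = u"
  shows "(par ^^ (l * k)) ((\<beta> ^^ k) u) = u"
proof (induction k)
  case (Suc k)
  have "(par ^^ (l * Suc k)) ((\<beta> ^^ Suc k) u) = (par ^^ (l * k)) ((par ^^ l) ((\<beta> ^^ k) (\<beta> u)))"
    by (simp only: funpow_Suc_right comp_apply mult_Suc_right add.commute[of l] funpow_add_apply)
  also have "(par ^^ l) ((\<beta> ^^ k) (\<beta> u)) = (\<beta> ^^ k) u"
    by (metis aut_par_pow[OF aut_funpow[OF assms(2)]] assms(3))
  finally show ?case using Suc by simp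
qed simp

text \<open>In \<open>axis_step ^^ l\<close> the \<open>l - 1\<close> surplus applications of
  \<beta> cancel against the descents, by \<open>axis_pow\<close> started at
  \<open>\<beta> u\<close>.\<close>

lemma beta_axis:
  assumes "l \<ge> 1" "aut \<beta>" "(par ^^ l) (\<beta> u) = u"
  shows "\<beta> u = (axis_step l \<beta> ^^ l) u"
proof -
  have "(axis_step l \<beta> ^^ l) u = (par ^^ ((l - 1) * l)) ((\<beta> ^^ (l - 1)) (\<beta> u))"
    using axis_step_pow[OF assms, of l u] assms(1)
    by (metis Suc_diff_1 comp_apply funpow_Suc_right less_eq_Suc_le One_nat_def)
  also have "\<dots> = \<beta> u"
    using axis_pow[OF assms(1,2) ax_\<beta>[OF assms], of "l - 1"] by (simp add: mult.commute)
  finally show ?thesis ..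
qed

lemma beta_pow_axis:
  assumes "l \<ge> 1" "aut \<beta>" "(par ^^ l) (\<beta> u) = u"
  shows "(\<beta> ^^ i) ((axis_step l \<beta> ^^ k) u) = (axis_step l \<beta> ^^ (l * i + k)) u"
proof (induction i)
  case (Suc i)
  have "\<beta> ((axis_step l \<beta> ^^ (l * i + k)) u) = (axis_step l \<beta> ^^ (l * i + k)) (\<beta> u)"
    by (rule funpow_commute_apply) (simp add: axis_step_self[OF assms])
  also have "\<dots> = (axis_step l \<beta> ^^ (l * Suc i + k)) u"
    unfolding beta_axis[OF assms, symmetric] using beta_axis[OF assms]
    by (simp add: funpow_add_apply[symmetric] ac_simps)
  finally show ?case using Suc by simp
qed simp

text \<open>Level \<open>k\<close> above \<open>u\<close> has \<open>n ^ k\<close> vertices and is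
  one orbit of \<alpha>, so \<open>n ^ k\<close> is the period there.\<close>

lemma frame_fixes_iff:
  assumes "frame l \<alpha> \<beta> u"
  shows "(\<alpha> ^^ p) ((axis_step l \<beta> ^^ k) u) = (axis_step l \<beta> ^^ k) u \<longleftrightarrow> n ^ k dvd p"
proof -
  let ?e = "(axis_step l \<beta> ^^ k) u" and ?S = "{w. (par ^^ k) w = u}"
  have F: "l \<ge> 1" "aut \<beta>" "(par ^^ l) (\<beta> u) = u" "aut \<alpha>" "\<alpha> u = u"
    using assms by (auto simp: frame_def)
  have "(\<alpha> ^^ p) ?e \<in> ?S" for p
    using par_pow_axis[OF F(1-3), of k] aut_par_pow[OF aut_funpow[OF F(4), of p], of k ?e]
      funpow_fixed[where f = \<alpha>, OF F(5), of p] by simp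
  moreover have "\<And>w. w \<in> ?S \<Longrightarrow> \<exists>p. w = (\<alpha> ^^ p) ?e" using assms by (auto simp: frame_def)
  ultimately have "?S = (\<lambda>p. (\<alpha> ^^ p) ?e) ` UNIV" by blast
  from cyclic_orbit_fixed_iff[OF aut_inj[OF F(4)] finite_descendants _ this]
  show ?thesis using par_pow_axis[OF F(1-3), of k] by (auto simp: card_descendants)
qed

lemma frame_eq_iff:
  assumes "frame l \<alpha> \<beta> u"
  shows "(\<alpha> ^^ p) ((axis_step l \<beta> ^^ k) u) = (\<alpha> ^^ p') ((axis_step l \<beta> ^^ k) u) \<longleftrightarrow> p mod n ^ k = p' mod n ^ k"
proof -
  have inj: "inj \<alpha>" using assms aut_inj by (auto simp: frame_def)
  have *: "(\<alpha> ^^ p) ((axis_step l \<beta> ^^ k) u) = (\<alpha> ^^ p') ((axis_step l \<beta> ^^ k) u) \<longleftrightarrow> p mod n ^ k = p' mod n ^ k"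
    if "p \<le> p'" for p p'
  proof
    assume "(\<alpha> ^^ p) ((axis_step l \<beta> ^^ k) u) = (\<alpha> ^^ p') ((axis_step l \<beta> ^^ k) u)"
    then have "n ^ k dvd p' - p" using funpow_diff[OF inj that] frame_fixes_iff[OF assms] by metis
    then show "p mod n ^ k = p' mod n ^ k" using that by (metis mod_eq_dvd_iff_nat)
  next
    assume "p mod n ^ k = p' mod n ^ k"
    then have "n ^ k dvd p' - p" using that by (metis mod_eq_dvd_iff_nat)
    then have "(\<alpha> ^^ (p' - p)) ((axis_step l \<beta> ^^ k) u) = (axis_step l \<beta> ^^ k) u"
      using frame_fixes_iff[OF assms] by blast
    then show "(\<alpha> ^^ p) ((axis_step l \<beta> ^^ k) u) = (\<alpha> ^^ p') ((axis_step l \<beta> ^^ k) u)"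
      using that by (metis funpow_add_apply le_add_diff_inverse)
  qed
  show ?thesis using *[of p p'] *[of p' p] by (metis nle_le)
qed

section \<open>Coordinates with respect to a frame, and conjugacy of frames\<close>

lemma frame_ht:
  assumes "frame l \<alpha> \<beta> u"
  shows "ht ((\<alpha> ^^ p) v) = ht v" "ht (\<beta> v) = ht v + int l"
proof -
  have F: "l \<ge> 1" "aut \<beta>" "(par ^^ l) (\<beta> u) = u" "aut \<alpha>" "\<alpha> u = u"
    using assms by (auto simp: frame_def)
  show "ht ((\<alpha> ^^ p) v) = ht v"
    using ht_funpow[OF F(4), of p v u] F(5) by simp
  have "ht u = ht (\<beta> u) - int l" using F(3) ht_par_pow by metis
  then show "ht (\<beta> v) = ht v + int l" using ht_aut[OF F(2), of v u] by simp
qed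

text \<open>\<open>w\<close> has an ancestor in common with \<open>u\<close>, lying \<open>d\<close>
  steps below \<open>u\<close>. As \<open>\<beta>^d\<close> raises the axis by
  \<open>l * d \<ge> d\<close> steps, it brings \<open>w\<close> above \<open>u\<close>, where the
  last clause of \<open>frame\<close> applies.\<close>

lemma frame_coords:
  assumes "frame l \<alpha> \<beta> u"
  shows "\<exists>i p k. (\<beta> ^^ i) w = (\<alpha> ^^ p) ((axis_step l \<beta> ^^ k) u)"
proof -
  have F: "l \<ge> 1" "aut \<beta>" "(par ^^ l) (\<beta> u) = u" "aut \<alpha>" "\<alpha> u = u"
    using assms by (auto simp: frame_def)
  obtain c d where cd: "(par ^^ c) w = (par ^^ d) u" using common_ancestor by blast
  have "d \<le> l * d" using F(1) by simp
  then have "(par ^^ (l * d - d + c)) w = (par ^^ (l * d)) u"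
    using cd by (metis funpow_add_apply le_add_diff_inverse2)
  then have "(par ^^ (l * d - d + c)) ((\<beta> ^^ d) w) = (par ^^ (l * d)) ((\<beta> ^^ d) u)"
    by (metis aut_funpow[OF F(2)] aut_par_pow)
  then have "(par ^^ (l * d - d + c)) ((\<beta> ^^ d) w) = u" using axis_pow[OF F(1-3)] by simp
  then show ?thesis using assms unfolding frame_def by blast
qed

text \<open>As with fractions over powers of \<open>n\<close>, a coordinate triple can be expanded;
  two triples of one vertex can therefore be compared at a common exponent of \<beta>.\<close>

lemma frame_coords_shift:
  assumes "frame l \<alpha> \<beta> u" "(\<beta> ^^ i) w = (\<alpha> ^^ p) ((axis_step l \<beta> ^^ k) u)"
  shows "(\<beta> ^^ (j + i)) w = (\<alpha> ^^ ((n ^ l) ^ j * p)) ((axis_step l \<beta> ^^ (l * j + k)) u)"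
proof -
  have F: "l \<ge> 1" "aut \<beta>" "(par ^^ l) (\<beta> u) = u" and tw: "\<And>x. \<beta> (\<alpha> x) = (\<alpha> ^^ (n ^ l)) (\<beta> x)"
    using assms(1) by (auto simp: frame_def)
  show ?thesis
    by (simp only: funpow_add_apply[of j] assms(2) twisted_commute[of \<beta> \<alpha> "n ^ l", OF tw] beta_pow_axis[OF F])
qed

text \<open>The graph of the future conjugator: vertices sharing a coordinate triple. A relation
  avoids choosing one triple for each vertex.\<close>

definition frame_rel where
  "frame_rel l \<alpha> \<beta> u \<alpha>' \<beta>' u' w w' \<longleftrightarrow> (\<exists>i p k. (\<beta> ^^ i) w = (\<alpha> ^^ p) ((axis_step l \<beta> ^^ k) u) \<and>
     (\<beta>' ^^ i) w' = (\<alpha>' ^^ p) ((axis_step l \<beta>' ^^ k) u'))"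

lemma frame_rel_sym: "frame_rel l \<alpha> \<beta> u \<alpha>' \<beta>' u' w w' \<Longrightarrow> frame_rel l \<alpha>' \<beta>' u' \<alpha> \<beta> u w' w"
  unfolding frame_rel_def by blast

lemma frame_rel_total:
  assumes "frame l \<alpha> \<beta> u" "frame l \<alpha>' \<beta>' u'"
  shows "\<exists>w'. frame_rel l \<alpha> \<beta> u \<alpha>' \<beta>' u' w w'"
proof -
  obtain i p k where "(\<beta> ^^ i) w = (\<alpha> ^^ p) ((axis_step l \<beta> ^^ k) u)"
    using frame_coords[OF assms(1)] by blast
  moreover have "aut (\<beta>' ^^ i)" using assms(2) aut_funpow by (auto simp: frame_def)
  ultimately show ?thesis unfolding frame_rel_def using aut_inv_cancel(1) by blast
qed

text \<open>Both triples are expanded to the exponent \<open>i + i2\<close>. Heights then force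
  equal levels, and equality of vertices becomes a congruence modulo a power of \<open>n\<close>
  that is the same in both frames.\<close>

lemma frame_rel_unique:
  assumes F: "frame l \<alpha> \<beta> u" and F': "frame l \<alpha>' \<beta>' u'"
    and "frame_rel l \<alpha> \<beta> u \<alpha>' \<beta>' u' w w1" "frame_rel l \<alpha> \<beta> u \<alpha>' \<beta>' u' w w2"
  shows "w1 = w2"
proof -
  have ax: "l \<ge> 1" "aut \<beta>" "(par ^^ l) (\<beta> u) = u" using F by (auto simp: frame_def)
  obtain i p k where 1: "(\<beta> ^^ i) w = (\<alpha> ^^ p) ((axis_step l \<beta> ^^ k) u)"
     "(\<beta>' ^^ i) w1 = (\<alpha>' ^^ p) ((axis_step l \<beta>' ^^ k) u')"
    using assms(3) unfolding frame_rel_def by blast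
  obtain i2 p2 k2 where 2: "(\<beta> ^^ i2) w = (\<alpha> ^^ p2) ((axis_step l \<beta> ^^ k2) u)"
     "(\<beta>' ^^ i2) w2 = (\<alpha>' ^^ p2) ((axis_step l \<beta>' ^^ k2) u')"
    using assms(4) unfolding frame_rel_def by blast
  let ?P = "(n ^ l) ^ i2 * p" and ?K = "l * i2 + k" and ?P2 = "(n ^ l) ^ i * p2" and ?K2 = "l * i + k2"
  have e: "(\<alpha> ^^ ?P) ((axis_step l \<beta> ^^ ?K) u) = (\<alpha> ^^ ?P2) ((axis_step l \<beta> ^^ ?K2) u)"
    using frame_coords_shift[OF F 1(1), of i2] frame_coords_shift[OF F 2(1), of i]
    by (simp add: add.commute)
  have "ht ((axis_step l \<beta> ^^ ?K) u) = ht ((axis_step l \<beta> ^^ ?K2) u)"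
    using e frame_ht(1)[OF F] by metis
  then have "int ?K = int ?K2" unfolding ht_axis[OF ax] by (rule add_left_imp_eq)
  then have K: "?K = ?K2" by (simp only: of_nat_eq_iff)
  have "(\<alpha>' ^^ ?P) ((axis_step l \<beta>' ^^ ?K) u') = (\<alpha>' ^^ ?P2) ((axis_step l \<beta>' ^^ ?K2) u')"
    using e unfolding K frame_eq_iff[OF F] frame_eq_iff[OF F'] .
  then have "(\<beta>' ^^ (i2 + i)) w1 = (\<beta>' ^^ (i + i2)) w2"
    using frame_coords_shift[OF F' 1(2), of i2] frame_coords_shift[OF F' 2(2), of i] by simp
  moreover have "aut (\<beta>' ^^ (i + i2))" using F' aut_funpow by (auto simp: frame_def)
  ultimately show ?thesis using aut_eq_iff by (metis add.commute)
qed

lemma frame_rel_par: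
  assumes F: "frame l \<alpha> \<beta> u" and F': "frame l \<alpha>' \<beta>' u'"
    and "frame_rel l \<alpha> \<beta> u \<alpha>' \<beta>' u' w w'"
  shows "frame_rel l \<alpha> \<beta> u \<alpha>' \<beta>' u' (par w) (par w')"
proof -
  obtain i p k where 1: "(\<beta> ^^ i) w = (\<alpha> ^^ p) ((axis_step l \<beta> ^^ k) u)"
     "(\<beta>' ^^ i) w' = (\<alpha>' ^^ p) ((axis_step l \<beta>' ^^ k) u')"
    using assms(3) unfolding frame_rel_def by blast
  \<comment> \<open>One extra application of \<beta> makes the level positive, so that
    \<open>par\<close> can lower it even when \<open>k = 0\<close>.\<close>
  have *: "(\<beta> ^^ Suc i) (par w) = (\<alpha> ^^ (n ^ l * p)) ((axis_step l \<beta> ^^ (l + k - 1)) u)"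
    if F: "frame l \<alpha> \<beta> u" and 1: "(\<beta> ^^ i) w = (\<alpha> ^^ p) ((axis_step l \<beta> ^^ k) u)" for \<alpha> \<beta> u w
  proof -
    have ax: "l \<ge> 1" "aut \<beta>" "(par ^^ l) (\<beta> u) = u" "aut \<alpha>" using F by (auto simp: frame_def)
    have "(\<beta> ^^ Suc i) (par w) = par ((\<beta> ^^ Suc i) w)"
      by (rule aut_par[OF aut_funpow[OF ax(2)]])
    also have "(\<beta> ^^ Suc i) w = (\<alpha> ^^ (n ^ l * p)) ((axis_step l \<beta> ^^ Suc (l + k - 1)) u)"
      using frame_coords_shift[OF F 1, of 1] ax(1) by simp
    also have "par \<dots> = (\<alpha> ^^ (n ^ l * p)) (par ((axis_step l \<beta> ^^ Suc (l + k - 1)) u))"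
      by (rule aut_par[OF aut_funpow[OF ax(4)], symmetric])
    finally show ?thesis by (simp only: par_axis_Suc[OF ax(1-3)])
  qed
  show ?thesis unfolding frame_rel_def using *[OF F 1(1)] *[OF F' 1(2)] by blast
qed

lemma frame_rel_alpha:
  assumes F: "frame l \<alpha> \<beta> u" and F': "frame l \<alpha>' \<beta>' u'"
    and "frame_rel l \<alpha> \<beta> u \<alpha>' \<beta>' u' w w'"
  shows "frame_rel l \<alpha> \<beta> u \<alpha>' \<beta>' u' (\<alpha> w) (\<alpha>' w')"
proof -
  obtain i p k where 1: "(\<beta> ^^ i) w = (\<alpha> ^^ p) ((axis_step l \<beta> ^^ k) u)"
     "(\<beta>' ^^ i) w' = (\<alpha>' ^^ p) ((axis_step l \<beta>' ^^ k) u')"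
    using assms(3) unfolding frame_rel_def by blast
  have *: "(\<beta> ^^ i) (\<alpha> w) = (\<alpha> ^^ ((n ^ l) ^ i + p)) ((axis_step l \<beta> ^^ k) u)"
    if F: "frame l \<alpha> \<beta> u" and 1: "(\<beta> ^^ i) w = (\<alpha> ^^ p) ((axis_step l \<beta> ^^ k) u)" for \<alpha> \<beta> u w
  proof -
    have tw: "\<And>x. \<beta> (\<alpha> x) = (\<alpha> ^^ (n ^ l)) (\<beta> x)" using F by (auto simp: frame_def)
    show ?thesis
      using twisted_commute[of \<beta> \<alpha> "n ^ l" i 1, OF tw] 1 by (simp add: funpow_add_apply)
  qed
  show ?thesis unfolding frame_rel_def using *[OF F 1(1)] *[OF F' 1(2)] by blast
qed

lemma frame_rel_beta:
  assumes F: "frame l \<alpha> \<beta> u" and F': "frame l \<alpha>' \<beta>' u'"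
    and "frame_rel l \<alpha> \<beta> u \<alpha>' \<beta>' u' w w'"
  shows "frame_rel l \<alpha> \<beta> u \<alpha>' \<beta>' u' (\<beta> w) (\<beta>' w')"
proof -
  obtain i p k where 1: "(\<beta> ^^ i) w = (\<alpha> ^^ p) ((axis_step l \<beta> ^^ k) u)"
     "(\<beta>' ^^ i) w' = (\<alpha>' ^^ p) ((axis_step l \<beta>' ^^ k) u')"
    using assms(3) unfolding frame_rel_def by blast
  have "(\<beta> ^^ i) (\<beta> w) = (\<alpha> ^^ (n ^ l * p)) ((axis_step l \<beta> ^^ (l + k)) u)"
    if F: "frame l \<alpha> \<beta> u" and 1: "(\<beta> ^^ i) w = (\<alpha> ^^ p) ((axis_step l \<beta> ^^ k) u)" for \<alpha> \<beta> u w
    using frame_coords_shift[OF F 1, of 1] by (simp add: funpow_swap1)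
  from this[OF F 1(1)] this[OF F' 1(2)] show ?thesis unfolding frame_rel_def by blast
qed

text \<open>The relation is total and functional, and so is its converse by symmetry; it is thus a
  bijection, compatible with \<open>par\<close>, \<alpha> and \<beta>.\<close>

lemma frame_conjugate:
  assumes F: "frame l \<alpha> \<beta> u" and F': "frame l \<alpha>' \<beta>' u'"
  obtains \<gamma> where "aut \<gamma>" "\<And>x. \<gamma> (\<alpha> x) = \<alpha>' (\<gamma> x)" "\<And>x. \<gamma> (\<beta> x) = \<beta>' (\<gamma> x)" "\<gamma> u = u'"
proof -
  let ?R = "frame_rel l \<alpha> \<beta> u \<alpha>' \<beta>' u'"
  obtain \<gamma> where \<gamma>: "\<And>w. ?R w (\<gamma> w)" using frame_rel_total[OF F F'] by metis
  have eq: "\<gamma> w = w'" if "?R w w'" for w w' using frame_rel_unique[OF F F' \<gamma> that] .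
  have "inj \<gamma>"
    by (rule injI) (metis \<gamma> F F' frame_rel_sym frame_rel_unique)
  moreover have "surj \<gamma>"
    by (rule surjI[of _ "\<lambda>w'. SOME w. ?R w w'"])
      (metis (mono_tags, lifting) eq F F' frame_rel_sym frame_rel_total someI_ex)
  moreover have "?R u u'" unfolding frame_rel_def
    by (rule exI[of _ 0], rule exI[of _ 0], rule exI[of _ 0]) simp
  ultimately show ?thesis
    using that[of \<gamma>] eq[OF frame_rel_par[OF F F' \<gamma>]] eq[OF frame_rel_alpha[OF F F' \<gamma>]]
      eq[OF frame_rel_beta[OF F F' \<gamma>]] eq by (simp add: autI bij_def)
qed

section \<open>Construction of a frame from transitivity on heights\<close>

lemma hyperbolic_axis:
  assumes "aut B" "\<And>v. ht (B v) = ht v + int l"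
  obtains k where "(par ^^ l) (B ((par ^^ k) w)) = (par ^^ k) w"
proof -
  have "ht ((par ^^ l) (B w)) = ht w" by (simp add: ht_par_pow assms(2))
  then obtain k where "(par ^^ k) ((par ^^ l) (B w)) = (par ^^ k) w"
    using common_ancestor_same by blast
  then show ?thesis
    using that[of k] by (simp add: aut_par_pow[OF assms(1)] funpow_add_apply[symmetric] add.commute)
qed

text \<open>In group terms, the last hypothesis says that the conjugates \<open>B^-i A^p B^i\<close>
  act transitively on the vertices of each height.\<close>

lemma frame_of_transitive:
  assumes A: "aut A" "\<And>v. ht (A v) = ht v" and B: "aut B" "\<And>v. ht (B v) = ht v + int l"
    and l: "l \<ge> 1" and tw: "\<And>x. B (A x) = (A ^^ (n ^ l)) (B x)"
    and trans: "\<And>y w. ht y = ht w \<Longrightarrow> \<exists>i p. (B ^^ i) w = (A ^^ p) ((B ^^ i) y)"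
  obtains \<alpha> u m where "frame l \<alpha> B u" "A = \<alpha> ^^ m" "m > 0"
    "\<forall>p. prime p \<longrightarrow> p dvd m \<longrightarrow> p dvd n" "\<not> n dvd m"
proof -
  define q where "q = n ^ l"
  let ?E = "axis_step l B"
  note twc = twisted_commute[of B A q, OF tw[folded q_def]]
  have q0: "q > 0" using n_ge_2 by (simp add: q_def)
  \<comment> \<open>Otherwise \<open>A\<close> fixes every axis vertex above a fixed one. The powers
    \<open>B^i\<close> keep \<open>?E u\<close> on the axis, so no conjugate
    \<open>B^-i A^p B^i\<close> can move it to another child of \<open>u\<close>.\<close>
  have "\<exists>u. (par ^^ l) (B u) = u \<and> A u = u \<and> A (?E u) \<noteq> ?E u"
  proof (rule ccontr)
    assume "\<nexists>u. (par ^^ l) (B u) = u \<and> A u = u \<and> A (?E u) \<noteq> ?E u"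
    then have step: "A (?E u) = ?E u" if "(par ^^ l) (B u) = u" "A u = u" for u
      using that by blast
    fix w :: 'v
    obtain k where k: "(par ^^ l) (B ((par ^^ k) w)) = (par ^^ k) w"
      using hyperbolic_axis[OF B] by blast
    obtain d where d: "A ((par ^^ d) ((par ^^ k) w)) = (par ^^ d) ((par ^^ k) w)"
      using elliptic_fixes_ancestor[OF A(1)] A(2) by blast
    \<comment> \<open>Ancestors of an axis vertex lie on the axis again, so \<open>u\<close> is both
      on the axis and fixed by \<open>A\<close>.\<close>
    define u where "u = (par ^^ d) ((par ^^ k) w)"
    have ax: "(par ^^ l) (B u) = u"
      unfolding u_def
      by (metis k aut_par_pow[OF B(1)] add.commute funpow_add_apply)
    have Au: "A u = u" using d u_def by simp
    note E = l B(1)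
    have fixE: "A ((?E ^^ j) u) = (?E ^^ j) u \<and> (par ^^ l) (B ((?E ^^ j) u)) = (?E ^^ j) u" for j
    proof (induction j)
      case (Suc j)
      have "(par ^^ l) (B (?E x)) = ?E x" if "(par ^^ l) (B x) = x" for x
      proof -
        have "(par ^^ l) (B (?E x)) = ?E ((par ^^ l) (B x))"
          by (simp add: axis_step_def aut_par_pow[OF B(1)] funpow_add_apply[symmetric] add.commute)
        then show ?thesis using that by simp
      qed
      then show ?case using Suc step by simp
    qed (simp add: Au ax)
    have "card {w. par w = u} \<ge> 2" using card_children n_ge_2 by simp
    moreover have "par (?E u) = u" by (rule par_axis_step[OF E ax])
    ultimately obtain c where c: "par c = u" "c \<noteq> ?E u"
      by (metis (mono_tags, lifting) card_le_Suc0_iff_eq finite_children mem_Collect_eq not_less_eq_eq numeral_2_eq_2)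
    have "ht (?E u) = ht c"
      using c(1) \<open>par (?E u) = u\<close> ht_par[of c] ht_par[of "?E u"] by simp
    then obtain i p where ip: "(B ^^ i) c = (A ^^ p) ((B ^^ i) (?E u))" using trans by blast
    have "(B ^^ i) (?E u) = (?E ^^ (l * i + 1)) u"
      using beta_pow_axis[OF E ax, of i 1] by simp
    then have "(A ^^ p) ((B ^^ i) (?E u)) = (B ^^ i) (?E u)"
      using fixE[of "l * i + 1"] by (simp add: funpow_fixed)
    then have "c = ?E u" using ip aut_eq_iff[OF aut_funpow[OF B(1)]] by metis
    then show False using c by simp
  qed
  then obtain u where u: "(par ^^ l) (B u) = u" "A u = u" "A (?E u) \<noteq> ?E u" by blast
  note ax = l B(1) u(1)
  \<comment> \<open>\<open>c i\<close> is the period of \<open>A\<close> at \<open>B^i u\<close>, so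
    \<open>r i\<close> below generates the stabilizer of \<open>u\<close> in the cyclic group
    generated by \<open>B^-i A B^i\<close>. These groups increase with \<open>i\<close>, because
    \<open>A = B^-1 A^q B\<close>.\<close>
  define c where "c i = least_power A ((B ^^ i) u)" for i
  have c: "(A ^^ p) ((B ^^ i) u) = (B ^^ i) u \<longleftrightarrow> c i dvd p" and c0: "c i > 0" for i p
  proof -
    obtain N where "N > 0" "(A ^^ N) ((B ^^ i) u) = (B ^^ i) u" using elliptic_periodic[OF A(1)] A(2) by blast
    then show "(A ^^ p) ((B ^^ i) u) = (B ^^ i) u \<longleftrightarrow> c i dvd p" "c i > 0"
      unfolding c_def using least_power_dvd_iff least_powerI by metis+
  qed
  define r where "r i = (\<lambda>x. inv_into UNIV (B ^^ i) ((A ^^ c i) ((B ^^ i) x)))" for i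
  have aut_r: "aut (r i)" for i
  proof -
    have "r i = inv_into UNIV (B ^^ i) \<circ> (A ^^ c i) \<circ> (B ^^ i)" by (auto simp: r_def)
    then show ?thesis using aut_comp aut_inv aut_funpow A(1) B(1) by metis
  qed
  have Br: "(B ^^ i) ((r i ^^ t) x) = (A ^^ (c i * t)) ((B ^^ i) x)" for i t x
    unfolding r_def conj_funpow[OF aut_bij[OF aut_funpow[OF B(1)]]]
    by (simp add: aut_inv_cancel(1)[OF aut_funpow[OF B(1)]] funpow_mult)
  have Binj: "(B ^^ i) x = (B ^^ i) y \<longleftrightarrow> x = y" for i x y
    by (rule aut_eq_iff[OF aut_funpow[OF B(1)]])
  have cSuc: "c i dvd c (Suc i)" for i
  proof -
    have "(par ^^ l) ((B ^^ Suc i) u) = (B ^^ i) u"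
      by (metis aut_par_pow[OF aut_funpow[OF B(1)]] u(1) comp_apply funpow_Suc_right)
    then have "(A ^^ c (Suc i)) ((B ^^ i) u) = (B ^^ i) u"
      using c[of "c (Suc i)" "Suc i"] by (metis aut_funpow[OF A(1)] aut_par_pow dvd_refl)
    then show ?thesis using c by blast
  qed
  have cq: "c (Suc i) dvd q * c i" for i
  proof -
    have "(A ^^ (q * c i)) ((B ^^ Suc i) u) = B ((A ^^ c i) ((B ^^ i) u))"
      using twc[of 1 "c i" "(B ^^ i) u"] by simp
    also have "\<dots> = (B ^^ Suc i) u" using c[of "c i" i] by simp
    finally show ?thesis using c by blast
  qed
  \<comment> \<open>This measures how far the stabilizer grows at step \<open>i\<close>:
    \<open>r i\<close> is the \<open>e i\<close>-th power of \<open>r (Suc i)\<close>.\<close>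
  define e where "e i = q * c i div c (Suc i)" for i
  have e: "q * c i = c (Suc i) * e i" for i using cq[of i] by (simp add: e_def)
  have r_Suc: "r i = r (Suc i) ^^ e i" for i
  proof
    fix x
    have "(B ^^ Suc i) ((r (Suc i) ^^ e i) x) = (A ^^ (q * c i)) ((B ^^ Suc i) x)"
      by (simp only: Br e)
    also have "\<dots> = B ((A ^^ c i) ((B ^^ i) x))"
      using twc[of 1 "c i" "(B ^^ i) x"] by simp
    also have "\<dots> = (B ^^ Suc i) (r i x)" using Br[of i 1 x] by simp
    finally show "r i x = (r (Suc i) ^^ e i) x" using Binj by metis
  qed
  have r_mono: "\<exists>s. r i = r (i + j) ^^ s" for i j
  proof (induction j)
    case 0 then show ?case by (auto intro: exI[of _ 1])
  next
    case (Suc j)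
    then show ?case using r_Suc[of "i + j"] by (metis add_Suc_right funpow_mult)
  qed
  \<comment> \<open>The element \<open>B^-i A^p B^i\<close> taking the axis vertex to
    \<open>w\<close> fixes \<open>u\<close>, the ancestor of both at level \<open>k\<close>. So it
    is a power of \<open>r i\<close>, and then of every later generator.\<close>
  have r_orbit: "\<exists>i. \<forall>j\<ge>i. \<exists>t. w = (r j ^^ t) ((?E ^^ k) u)" if w: "(par ^^ k) w = u" for k w
  proof -
    have pE: "(par ^^ k) ((?E ^^ k) u) = u" by (rule par_pow_axis[OF ax])
    then have "ht ((?E ^^ k) u) = ht w" using w ht_par_pow by (metis diff_eq_eq)
    then obtain i p where ip: "(B ^^ i) w = (A ^^ p) ((B ^^ i) ((?E ^^ k) u))" using trans by blast
    then have "(par ^^ k) ((B ^^ i) w) = (A ^^ p) ((B ^^ i) ((par ^^ k) ((?E ^^ k) u)))"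
      using aut_par_pow[OF aut_funpow[OF A(1)]] aut_par_pow[OF aut_funpow[OF B(1)]] by metis
    then have "(B ^^ i) u = (A ^^ p) ((B ^^ i) u)"
      using pE w aut_par_pow[OF aut_funpow[OF B(1)]] by metis
    then have "c i dvd p" using c[of p i] by simp
    then obtain t where "p = c i * t" by (auto simp: dvd_def)
    then have t: "w = (r i ^^ t) ((?E ^^ k) u)" using ip Br Binj by metis
    have "\<exists>t. w = (r j ^^ t) ((?E ^^ k) u)" if "j \<ge> i" for j
      using r_mono[of i "j - i"] that t by (metis funpow_mult le_add_diff_inverse)
    then show ?thesis by blast
  qed
  \<comment> \<open>Level \<open>l\<close> is the right one to inspect: its size
    \<open>n ^ l\<close> equals the exponent \<open>q\<close> in the relation, which bounds the
    growth of the stabilizers.\<close>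
  let ?S = "{w. (par ^^ l) w = u}" and ?w = "(?E ^^ l) u"
  have "\<exists>i. \<forall>w\<in>?S. \<forall>j\<ge>i. \<exists>t. w = (r j ^^ t) ?w"
  proof -
    have "\<forall>w\<in>?S. \<exists>i. \<forall>j\<ge>i. \<exists>t. w = (r j ^^ t) ?w" using r_orbit[of l] by simp
    then obtain f where f: "\<forall>w\<in>?S. \<forall>j\<ge>f w. \<exists>t. w = (r j ^^ t) ?w" using bchoice by metis
    have "f w \<le> Max (f ` ?S)" if "w \<in> ?S" for w using that finite_descendants by simp
    then have "\<forall>w\<in>?S. \<forall>j\<ge>Max (f ` ?S). \<exists>t. w = (r j ^^ t) ?w" using f order_trans by blast
    then show ?thesis by blast
  qed
  then obtain i1 where i1: "\<And>w j. (par ^^ l) w = u \<Longrightarrow> j \<ge> i1 \<Longrightarrow> \<exists>t. w = (r j ^^ t) ?w" by blast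
  have ru: "r i u = u" for i using Br[of i 1 u] c[of "c i" i] Binj by simp
  have fixw: "(r j ^^ t) ?w = ?w \<longleftrightarrow> q dvd t" if "j \<ge> i1" for j t
  proof -
    have "(r j ^^ t) ?w \<in> ?S" for t
      using par_pow_axis[OF ax, of l] aut_par_pow[OF aut_funpow[OF aut_r[of j], of t], of l ?w]
        funpow_fixed[where f = "r j", OF ru[of j], of t] by simp
    then have S: "?S = (\<lambda>p. (r j ^^ p) ?w) ` UNIV" using i1[OF _ that] by blast
    have "?S \<noteq> {}" using par_pow_axis[OF ax, of l] by auto
    then show ?thesis
      using cyclic_orbit_fixed_iff[OF aut_inj[OF aut_r] finite_descendants _ S]
      by (simp add: card_descendants q_def)
  qed
  \<comment> \<open>Beyond \<open>i1\<close> every generator is a \<open>q\<close>-cycle on level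
    \<open>l\<close>. Writing \<open>c (Suc i) = c i * d\<close>, one has
    \<open>e i * d = q\<close>, while \<open>(r i)^d = (r (Suc i))^q\<close> fixes
    \<open>?w\<close>; so \<open>q\<close> divides \<open>d\<close>, which leaves
    \<open>e i = 1\<close>.\<close>
  have r_stable: "r (Suc i) = r i" if "i \<ge> i1" for i
  proof -
    obtain d where d: "c (Suc i) = c i * d" using cSuc by (auto simp: dvd_def)
    have "e i * d = q" using e[of i] d c0[of i] by (simp add: mult.commute)
    have "(r i ^^ d) ?w = (r (Suc i) ^^ q) ?w"
      unfolding r_Suc[of i] funpow_mult \<open>e i * d = q\<close> ..
    also have "\<dots> = ?w" using fixw[of "Suc i" q] that by simp
    finally have "q dvd d" using fixw[OF that] by blast
    then have "q \<le> d" using c0[of "Suc i"] d by (auto intro: dvd_imp_le)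
    then have "e i \<le> 1" using \<open>e i * d = q\<close> q0
      by (metis mult.commute mult_le_cancel1 nat_mult_1_right not_gr0 order.trans mult_le_mono2)
    moreover have "e i \<noteq> 0" using \<open>e i * d = q\<close> q0 by auto
    ultimately have "e i = 1" by simp
    then show ?thesis using r_Suc[of i] by simp
  qed
  have r_stable': "r (i1 + j) = r i1" for j
    by (induction j) (simp_all add: r_stable)
  let ?\<alpha> = "r i1"
  have "frame l ?\<alpha> B u"
    unfolding frame_def
  proof (intro conjI allI impI)
    show "l \<ge> 1" "aut ?\<alpha>" "aut B" "?\<alpha> u = u" "(par ^^ l) (B u) = u" using l aut_r B(1) ru u by auto
    fix k w assume "(par ^^ k) w = u"
    then obtain i where "\<forall>j\<ge>i. \<exists>t. w = (r j ^^ t) ((?E ^^ k) u)" using r_orbit by blast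
    then have "\<exists>t. w = (r (i1 + i) ^^ t) ((?E ^^ k) u)" by auto
    then show "\<exists>p. w = (?\<alpha> ^^ p) ((?E ^^ k) u)" by (simp add: r_stable')
  next
    fix x
    have "(B ^^ i1) (B (?\<alpha> x)) = B ((A ^^ (c i1)) ((B ^^ i1) x))"
      using Br[of i1 1 x] by (simp add: funpow_swap1[symmetric])
    also have "\<dots> = (A ^^ (c i1 * q)) ((B ^^ i1) (B x))"
      using twc[of 1 "c i1" "(B ^^ i1) x"] by (simp add: funpow_swap1 mult.commute)
    also have "\<dots> = (B ^^ i1) ((?\<alpha> ^^ (n ^ l)) (B x))" by (simp add: Br q_def)
    finally show "B (?\<alpha> x) = (?\<alpha> ^^ (n ^ l)) (B x)" using Binj by simp
  qed
  \<comment> \<open>\<open>A^(q^i1)\<close> is the conjugate of \<open>A\<close> by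
    \<open>B^i1\<close>, and \<open>A\<close> fixes \<open>u\<close>. The resulting \<open>m\<close>
    is the exponent of \<open>A\<close> over \<alpha>; as a divisor of a power of \<open>n\<close>
    it has only prime factors of \<open>n\<close>.\<close>
  have "(A ^^ (q ^ i1)) ((B ^^ i1) u) = (B ^^ i1) u"
    using twc[of i1 1 u] u(2) by simp
  then have "c i1 dvd q ^ i1" using c by blast
  then obtain m where m: "q ^ i1 = c i1 * m" by (auto simp: dvd_def)
  have m0: "m > 0" using m q0 by (metis gr0I mult_is_0 power_not_zero)
  have Am: "A = ?\<alpha> ^^ m"
  proof
    fix x
    have "(B ^^ i1) (A x) = (B ^^ i1) ((?\<alpha> ^^ m) x)"
      using twc[of i1 1 x] Br[of i1 m x] m by simp
    then show "A x = (?\<alpha> ^^ m) x" using Binj by blast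
  qed
  have "p dvd n" if "prime p" "p dvd m" for p
  proof -
    have "p dvd q ^ i1" using that(2) m by simp
    then show ?thesis using that(1) unfolding q_def by (metis prime_dvd_power)
  qed
  \<comment> \<open>\<open>A\<close> moves the first axis vertex above \<open>u\<close>, whose
    period under \<alpha> is \<open>n\<close>.\<close>
  moreover have "\<not> n dvd m"
    using frame_fixes_iff[OF \<open>frame l ?\<alpha> B u\<close>, of m 1] Am u(3) by simp
  ultimately show ?thesis using that \<open>frame l ?\<alpha> B u\<close> Am m0 by blast
qed

section \<open>Vertices fixed by powers of \<alpha>, and the invariance of the multiplier\<close>

lemma frame_fixes_coords:
  assumes F: "frame l \<alpha> \<beta> u"
  obtains i K where "int K = int (l * i) + (ht v - ht u)"
    "\<And>N. (\<alpha> ^^ N) v = v \<longleftrightarrow> n ^ K dvd n ^ (l * i) * N"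
proof -
  have F': "l \<ge> 1" "aut \<beta>" "(par ^^ l) (\<beta> u) = u" "aut \<alpha>" and tw: "\<And>x. \<beta> (\<alpha> x) = (\<alpha> ^^ (n ^ l)) (\<beta> x)"
    using F by (auto simp: frame_def)
  obtain i p K where K: "(\<beta> ^^ i) v = (\<alpha> ^^ p) ((axis_step l \<beta> ^^ K) u)"
    using frame_coords[OF F] by blast
  have "ht ((\<beta> ^^ i) v) = ht v + int (l * i)"
    using ht_funpow[OF F'(2), of i v u] frame_ht(2)[OF F] by simp
  moreover have "ht ((\<beta> ^^ i) v) = ht u + int K"
    unfolding K using frame_ht(1)[OF F] ht_axis[OF F'(1-3)] by simp
  moreover have "(\<alpha> ^^ N) v = v \<longleftrightarrow> n ^ K dvd n ^ (l * i) * N" for N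
  proof -
    have "(\<alpha> ^^ N) v = v \<longleftrightarrow> (\<beta> ^^ i) ((\<alpha> ^^ N) v) = (\<beta> ^^ i) v"
      using aut_eq_iff[OF aut_funpow[OF F'(2)]] by blast
    also have "\<dots> \<longleftrightarrow> (\<alpha> ^^ (n ^ (l * i) * N)) ((\<alpha> ^^ p) ((axis_step l \<beta> ^^ K) u)) = (\<alpha> ^^ p) ((axis_step l \<beta> ^^ K) u)"
      using twisted_commute[of \<beta> \<alpha> "n ^ l" i N, OF tw] by (simp add: K power_mult)
    also have "\<dots> \<longleftrightarrow> (\<alpha> ^^ p) ((\<alpha> ^^ (n ^ (l * i) * N)) ((axis_step l \<beta> ^^ K) u)) = (\<alpha> ^^ p) ((axis_step l \<beta> ^^ K) u)"
      by (simp add: funpow_add_apply[symmetric] add.commute)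
    finally show ?thesis
      using aut_eq_iff[OF aut_funpow[OF F'(4)]] frame_fixes_iff[OF F] by simp
  qed
  ultimately show ?thesis by (intro that[of K i]) simp_all
qed

text \<open>Only the height of \<open>v\<close> counts, not whether \<open>v\<close> lies above
  \<open>u\<close>: a power of \<beta> moves \<open>v\<close> above \<open>u\<close> and multiplies
  the period and the exponent by the same power of \<open>n\<close>.\<close>

lemma frame_fixes_vertex:
  assumes F: "frame l \<alpha> \<beta> u" and "ht v = ht u + int k"
  shows "(\<alpha> ^^ N) v = v \<longleftrightarrow> n ^ k dvd N"
proof -
  obtain i K where "int K = int (l * i) + (ht v - ht u)"
    and *: "\<And>N. (\<alpha> ^^ N) v = v \<longleftrightarrow> n ^ K dvd n ^ (l * i) * N"
    using frame_fixes_coords[OF F] by blast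
  then have "K = l * i + k" using assms(2) by linarith
  then show ?thesis using * n_ge_2 by (simp add: power_add)
qed

lemma frame_fixes_low:
  assumes F: "frame l \<alpha> \<beta> u" and "ht v \<le> ht u"
  shows "(\<alpha> ^^ N) v = v"
proof -
  obtain i K where "int K = int (l * i) + (ht v - ht u)"
    and *: "\<And>N. (\<alpha> ^^ N) v = v \<longleftrightarrow> n ^ K dvd n ^ (l * i) * N"
    using frame_fixes_coords[OF F] by blast
  then have "K \<le> l * i" using assms(2) by linarith
  then show ?thesis using * by (simp add: le_imp_power_dvd)
qed

text \<open>\<gamma> matches the fixed vertices of \<open>\<alpha>^(m * N)\<close> with those of
  \<open>\<alpha>^(m' * N)\<close>. These sets are determined by heights and divisibility, so they
  detect both the height change of \<gamma> and the multiplier.\<close>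

lemma frame_conjugate_multipliers:
  assumes F: "frame l \<alpha> \<beta> u" and g: "aut \<gamma>" "\<And>x. \<gamma> ((\<alpha> ^^ m) x) = (\<alpha> ^^ m') (\<gamma> x)"
    and m: "m > 0" "\<forall>p. prime p \<longrightarrow> p dvd m \<longrightarrow> p dvd n" "\<not> n dvd m"
    and m': "m' > 0" "\<forall>p. prime p \<longrightarrow> p dvd m' \<longrightarrow> p dvd n" "\<not> n dvd m'"
  shows "m = m'" "ht (\<gamma> v) = ht v"
proof -
  have F': "l \<ge> 1" "aut \<beta>" "(par ^^ l) (\<beta> u) = u" "aut \<alpha>" using F by (auto simp: frame_def)
  have gN: "\<gamma> ((\<alpha> ^^ (m * N)) x) = (\<alpha> ^^ (m' * N)) (\<gamma> x)" for N x
  proof (induction N)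
    case (Suc N)
    then show ?case using g(2) by (simp add: funpow_add_apply)
  qed simp
  have stab: "(\<alpha> ^^ (m * N)) x = x \<longleftrightarrow> (\<alpha> ^^ (m' * N)) (\<gamma> x) = \<gamma> x" for N x
    by (metis aut_eq_iff[OF g(1)] gN)
  define d where "d = ht (\<gamma> u) - ht u"
  have d: "ht (\<gamma> x) = ht x + d" for x using ht_aut[OF g(1), of x u] by (simp add: d_def)
  let ?e = "\<lambda>k. (axis_step l \<beta> ^^ k) u"
  have hte: "ht (?e k) = ht u + int k" for k by (rule ht_axis[OF F'(1-3)])
  \<comment> \<open>Otherwise \<gamma> lowers the axis vertex \<open>?e 1\<close> to a height where
    \<alpha> fixes everything. Then \<open>\<alpha>^m\<close> fixes \<open>?e 1\<close>, and
    \<open>n\<close> divides \<open>m\<close>.\<close>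
  have "\<not> d < 0"
  proof
    assume "d < 0"
    then have "ht (\<gamma> (?e 1)) \<le> ht u" using d hte[of 1] by simp
    then have "(\<alpha> ^^ m) (?e 1) = ?e 1" using stab[of 1] frame_fixes_low[OF F] by (metis mult.right_neutral)
    then show False using frame_fixes_iff[OF F, of m 1] m(3) by simp
  qed
  \<comment> \<open>Otherwise \<open>\<gamma> u\<close> lies higher than \<open>u\<close> and is
    fixed by \<open>\<alpha>^m'\<close>, because \<open>\<alpha>^m\<close> fixes \<open>u\<close>.
    Then \<open>n\<close> divides \<open>m'\<close>.\<close>
  moreover have "\<not> d > 0"
  proof
    assume "d > 0"
    then have "ht (\<gamma> u) = ht u + int (nat d)" using d by simp
    then have "n ^ nat d dvd m'" using stab[of 1 u] frame_fixes_low[OF F, of u] frame_fixes_vertex[OF F, of "\<gamma> u" "nat d" m'] by simp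
    then show False using m'(3) \<open>d > 0\<close> by (metis dvd_power dvd_trans zero_less_nat_eq)
  qed
  ultimately have d0: "d = 0" by simp
  then show "ht (\<gamma> v) = ht v" using d by simp
  obtain k where k: "m dvd n ^ k" using dvd_power_of_prime_divisors[OF m(1,2)] by blast
  obtain k' where k': "m' dvd n ^ k'" using dvd_power_of_prime_divisors[OF m'(1,2)] by blast
  have key: "n ^ K dvd m * N \<longleftrightarrow> n ^ K dvd m' * N" for K N
    using stab[of N "?e K"] frame_fixes_vertex[OF F hte, of "m * N" K]
      frame_fixes_vertex[OF F, of "\<gamma> (?e K)" K "m' * N"] d d0 hte by simp
  have n0: "n ^ K \<noteq> 0" for K using n_ge_2 by simp
  \<comment> \<open>Here the prime factors of \<open>m\<close> matter: they provide a cofactor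
    \<open>N\<close> with \<open>m * N\<close> a power of \<open>n\<close>, and \<open>N\<close>
    cancels from \<open>m * N dvd m' * N\<close>.\<close>
  have "m dvd m'"
  proof -
    obtain N where N: "n ^ k = m * N" using k by (auto simp: dvd_def)
    then have "m * N dvd m' * N" using key[of k N] by simp
    then show ?thesis using N n0[of k] by (simp add: mult.commute)
  qed
  moreover have "m' dvd m"
  proof -
    obtain N where N: "n ^ k' = m' * N" using k' by (auto simp: dvd_def)
    then have "m' * N dvd m * N" using key[of k' N] by simp
    then show ?thesis using N n0[of k'] by (simp add: mult.commute)
  qed
  ultimately show "m = m'" by (rule dvd_antisym)
qed

end

section \<open>The oriented tree\<close>

definition parent :: "('v \<times> 'v) set \<Rightarrow> 'v \<Rightarrow> 'v" where
  "parent E v = (THE u. (u, v) \<in> E)"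

locale oriented_1n_tree =
  fixes n :: nat and E :: "('v \<times> 'v) set" and v0 :: 'v
  assumes n2: "n \<ge> 2" and tree: "tree_1n n E"
begin

abbreviation par where "par \<equiv> parent E"

lemma edge_iff: "(u, v) \<in> E \<longleftrightarrow> u = par v"
proof -
  have "card {u. (u, v) \<in> E} = 1" using tree by (simp add: tree_1n_def)
  then obtain x where x: "{u. (u, v) \<in> E} = {x}" by (rule card_1_singletonE)
  then have "(u, v) \<in> E \<longleftrightarrow> u = x" for u by auto
  then show ?thesis by (simp add: parent_def)
qed

lemma adj_iff: "adj E u v \<longleftrightarrow> u = par v \<or> v = par u"
  by (auto simp: adj_def edge_iff)

lemma unique_path: "\<exists>!p. simple_path E u v p"
  using tree by (simp add: tree_1n_def oriented_tree_def)

lemma geodesic_eqI: "simple_path E u v p \<Longrightarrow> geodesic E u v = p"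
  unfolding geodesic_def using unique_path by (metis the_equality)

lemma simple_path_geodesic: "simple_path E u v (geodesic E u v)"
  unfolding geodesic_def using unique_path by (rule theI')

text \<open>Along a path between the two vertices, each edge prolongs one of the two descents by one
  step.\<close>

lemma ancestor_exists: "\<exists>i j. (par ^^ i) v = (par ^^ j) w"
proof -
  have "\<exists>i j. (par ^^ i) (hd p) = (par ^^ j) (last p)" if "p \<noteq> []" "successively (adj E) p" for p
    using that
  proof (induction p)
    case (Cons x p)
    show ?case
    proof (cases "p = []")
      case False
      then obtain i j where ij: "(par ^^ i) (hd p) = (par ^^ j) (last p)"
        using Cons by (auto simp: successively_Cons)
      have "adj E x (hd p)" using Cons.prems False by (auto simp: successively_Cons)
      then consider "x = par (hd p)" | "hd p = par x" by (auto simp: adj_iff)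
      then show ?thesis
      proof cases
        case 1
        have "(par ^^ i) x = (par ^^ Suc j) (last p)"
          unfolding 1 by (simp add: ij[symmetric] funpow_swap1)
        then show ?thesis using False by (metis last_ConsR list.sel(1))
      next
        case 2
        have "(par ^^ Suc i) x = (par ^^ j) (last p)"
          unfolding ij[symmetric] 2 by (simp add: funpow_swap1)
        then show ?thesis using False by (metis last_ConsR list.sel(1))
      qed
    qed auto
  qed auto
  from this[of "geodesic E v w"] show ?thesis
    using simple_path_geodesic[of v w] by (auto simp: simple_path_def)
qed

text \<open>A cycle of length at least 3 would join \<open>v\<close> to \<open>par v\<close> by two
  simple paths, the edge itself and the way around. Lengths 1 and 2 contradict
  \<open>asym E\<close>.\<close>

lemma par_acyclic: assumes "(par ^^ k) v = v" shows "k = 0"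
proof (rule ccontr)
  assume "k \<noteq> 0"
  define d where "d = least_power par v"
  have d: "(par ^^ d) v = v" "d > 0" using least_powerI[where f = par, OF assms] \<open>k \<noteq> 0\<close> by (auto simp: d_def)
  have min: "\<not> (par ^^ i) v = v" if "0 < i" "i < d" for i
    using least_power_le[where f = par, of i v] that by (auto simp: d_def)
  have asym: "asym E" using tree by (simp add: tree_1n_def oriented_tree_def)
  have "d \<noteq> 1" using asym d(1) edge_iff[of v v] by (auto dest: asymD)
  moreover have "d \<noteq> 2"
  proof
    assume "d = 2"
    then have "(v, par v) \<in> E" "(par v, v) \<in> E" using d(1) by (simp_all add: edge_iff numeral_2_eq_2)
    then show False using asym by (auto dest: asymD)
  qed
  ultimately have "d \<ge> 3" using d(2) by linarith
  then have "par v \<noteq> v" using min[of 1] by simp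
  then have 1: "simple_path E v (par v) [v, par v]"
    by (auto simp: simple_path_def adj_iff)
  \<comment> \<open>The way around, starting at \<open>par^d v = v\<close> and climbing until
    \<open>par v\<close>.\<close>
  let ?p = "map (\<lambda>t. (par ^^ (d - t)) v) [0..<d]"
  have ne: "(par ^^ i) v \<noteq> (par ^^ j) v" if "i < j" "0 < i" "j \<le> d" for i j
  proof
    assume "(par ^^ i) v = (par ^^ j) v"
    then have "(par ^^ (d - j + i)) v = (par ^^ (d - j + j)) v" by (simp only: funpow_add_apply)
    then show False using min[of "d - j + i"] that d(1) by (simp add: less_diff_conv2)
  qed
  have "distinct ?p"
  proof -
    have "inj_on (\<lambda>t. (par ^^ (d - t)) v) {0..<d}"
    proof (rule linorder_inj_onI)
      fix s t assume "s < t" "s \<in> {0..<d}" "t \<in> {0..<d}"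
      then show "(par ^^ (d - s)) v \<noteq> (par ^^ (d - t)) v" using ne[of "d - t" "d - s"] diff_less_mono2[of s t d] by auto
    qed auto
    then show ?thesis by (simp add: distinct_map)
  qed
  moreover have "successively (adj E) ?p"
    unfolding successively_conv_nth
  proof (intro allI impI)
    fix i assume i: "Suc i < length ?p"
    have "par ((par ^^ (d - Suc i)) v) = (par ^^ (d - i)) v"
      using i by (metis Suc_diff_Suc Suc_lessD funpow.simps(2) comp_apply length_map length_upt minus_nat.diff_0)
    then show "adj E (?p ! i) (?p ! Suc i)" using i by (simp add: adj_iff)
  qed
  moreover have "hd ?p = v" "last ?p = par v" using d by (auto simp: hd_map last_map)
  ultimately have "simple_path E v (par v) ?p" using d(2) by (simp add: simple_path_def)
  then have "?p = [v, par v]" using 1 unique_path by blast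
  then have "length ?p = 2" by simp
  then show False using \<open>d \<ge> 3\<close> by simp
qed

lemma par_pow_inject: "(par ^^ i) v = (par ^^ j) v \<Longrightarrow> i = j"
proof (induction i j rule: linorder_wlog)
  case (le i j)
  then have "(par ^^ (j - i)) ((par ^^ i) v) = (par ^^ i) v"
    by (metis funpow_add_apply le_add_diff_inverse2)
  then show ?case using par_acyclic le by fastforce
qed auto

text \<open>The geodesic from \<open>v\<close> to \<open>w\<close>, provided that the descent stops
  at the first common ancestor.\<close>

definition join_path :: "nat \<Rightarrow> nat \<Rightarrow> 'v \<Rightarrow> 'v \<Rightarrow> 'v list" where
  "join_path i j v w = map (\<lambda>t. if t \<le> i then (par ^^ t) v else (par ^^ (i + j - t)) w) [0..<Suc (i + j)]"

lemma join_path_nth: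
  assumes "(par ^^ i) v = (par ^^ j) w" "t < Suc (i + j)"
  shows "t \<le> i \<Longrightarrow> join_path i j v w ! t = (par ^^ t) v"
    "t \<ge> i \<Longrightarrow> join_path i j v w ! t = (par ^^ (i + j - t)) w"
  using assms unfolding join_path_def by (auto simp del: upt_Suc)

text \<open>Minimality of \<open>i\<close> separates the descending half from the ascending one;
  within a half, acyclicity of \<open>par\<close> does.\<close>

lemma simple_path_join_path:
  assumes "(par ^^ i) v = (par ^^ j) w" and min: "\<And>a b. a < i \<Longrightarrow> (par ^^ a) v \<noteq> (par ^^ b) w"
  shows "simple_path E v w (join_path i j v w)"
  unfolding simple_path_def
proof (intro conjI)
  let ?p = "join_path i j v w"
  have len: "length ?p = Suc (i + j)" by (simp add: join_path_def)
  then show ne: "?p \<noteq> []" by auto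
  show "hd ?p = v" using join_path_nth(1)[OF assms(1), of 0] ne by (simp add: hd_conv_nth)
  show "last ?p = w" using join_path_nth(2)[OF assms(1), of "i + j"] ne len by (simp add: last_conv_nth)
  have ne: "?p ! s \<noteq> ?p ! t" if "s < t" "t < Suc (i + j)" for s t
  proof -
    have st: "s < Suc (i + j)" using that by simp
    note N = join_path_nth[OF assms(1) st] join_path_nth[OF assms(1) that(2)]
    consider "t \<le> i" | "s < i" "i < t" | "i \<le> s" using that by linarith
    then show ?thesis
    proof cases
      case 1 then show ?thesis using N that par_pow_inject[of s v t] by auto
    next
      case 2 then show ?thesis using N min[of s] by auto
    next
      case 3 then show ?thesis using N that par_pow_inject[of "i + j - s" w "i + j - t"] by auto
    qed
  qed
  show "distinct ?p" unfolding distinct_conv_nth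
    by (metis len ne linorder_neqE_nat)
  show "successively (adj E) ?p"
    unfolding successively_conv_nth
  proof (intro allI impI)
    fix t assume "Suc t < length ?p"
    then have t: "Suc t < Suc (i + j)" "t < Suc (i + j)" using len by auto
    note N = join_path_nth[OF assms(1) t(2)] join_path_nth[OF assms(1) t(1)]
    show "adj E (?p ! t) (?p ! Suc t)"
    proof (cases "Suc t \<le> i")
      case True then show ?thesis using N by (simp add: adj_iff)
    next
      case False
      then have "par ((par ^^ (i + j - Suc t)) w) = (par ^^ (i + j - t)) w"
        using t by (metis Suc_diff_Suc Suc_less_eq funpow.simps(2) comp_apply)
      then show ?thesis using N False by (simp add: adj_iff)
    qed
  qed
qed

lemma signed_length_join_path:
  assumes "(par ^^ i) v = (par ^^ j) w"
  shows "signed_length E (join_path i j v w) = int j - int i"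
proof -
  let ?p = "join_path i j v w"
  have len: "length ?p - 1 = i + j" by (simp add: join_path_def)
  have down: "(?p ! t, ?p ! Suc t) \<notin> E" if "t < i" for t
  proof
    assume "(?p ! t, ?p ! Suc t) \<in> E"
    then have "(par ^^ t) v = (par ^^ Suc (Suc t)) v"
      using that join_path_nth(1)[OF assms, of t] join_path_nth(1)[OF assms, of "Suc t"] by (simp add: edge_iff)
    then show False using par_pow_inject by fastforce
  qed
  have up: "(?p ! (i + t), ?p ! Suc (i + t)) \<in> E" if "t < j" for t
  proof -
    have "par ((par ^^ (j - Suc t)) w) = (par ^^ (j - t)) w"
      using that by (metis Suc_diff_Suc funpow.simps(2) comp_apply)
    then show ?thesis using that join_path_nth(2)[OF assms, of "i + t"] join_path_nth(2)[OF assms, of "Suc (i + t)"]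
      by (simp add: edge_iff)
  qed
  let ?f = "\<lambda>t. if (?p ! t, ?p ! Suc t) \<in> E then 1 else - 1 :: int"
  have "signed_length E ?p = (\<Sum>t<i + j. ?f t)" by (simp only: signed_length_def len)
  also have "\<dots> = (\<Sum>t<i. ?f t) + (\<Sum>t<j. ?f (i + t))"
  proof -
    have "(\<Sum>t<i + j. ?f t) = sum ?f {0..<i} + sum ?f {i..<i + j}"
      by (simp add: lessThan_atLeast0 sum.atLeastLessThan_concat)
    also have "sum ?f {i..<i + j} = (\<Sum>t<j. ?f (i + t))"
      using sum.shift_bounds_nat_ivl[of ?f 0 i j] by (simp add: lessThan_atLeast0 add.commute)
    finally show ?thesis by (simp add: lessThan_atLeast0)
  qed
  also have "(\<Sum>t<i. ?f t) = - int i" using down by simp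
  also have "(\<Sum>t<j. ?f (i + t)) = int j" using up by simp
  finally show ?thesis by simp
qed

text \<open>Any common ancestor computes the height: compared with the highest one, where the
  geodesic turns, it prolongs both descents equally.\<close>

lemma vheight_eq:
  assumes "(par ^^ i) v0 = (par ^^ j) w"
  shows "vheight E v0 w = int j - int i"
proof -
  define a where "a = (LEAST a. \<exists>b. (par ^^ a) v0 = (par ^^ b) w)"
  have "\<exists>b. (par ^^ a) v0 = (par ^^ b) w" unfolding a_def by (rule LeastI) (use assms in blast)
  then obtain b where b: "(par ^^ a) v0 = (par ^^ b) w" by blast
  have min: "(par ^^ c) v0 \<noteq> (par ^^ d) w" if "c < a" for c d
    using not_less_Least[of c "\<lambda>a. \<exists>b. (par ^^ a) v0 = (par ^^ b) w"] that unfolding a_def by blast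
  have "a \<le> i" using min[of i j] assms by (meson not_le)
  then have "(par ^^ (i - a + b)) w = (par ^^ j) w"
    using b assms by (metis funpow_add_apply le_add_diff_inverse2)
  then have "i - a + b = j" by (rule par_pow_inject)
  moreover have "vheight E v0 w = int b - int a"
    unfolding vheight_def
    using geodesic_eqI[OF simple_path_join_path[OF b min]] signed_length_join_path[OF b] by simp
  ultimately show ?thesis using \<open>a \<le> i\<close> by simp
qed

abbreviation ht where "ht \<equiv> vheight E v0"

lemma ht_v0: "ht v0 = 0"
  using vheight_eq[of 0 0 v0] by simp

sublocale horo_tree "parent E" "vheight E v0" n
proof
  fix v w
  obtain i j where ij: "(par ^^ i) v0 = (par ^^ j) v" using ancestor_exists by blast
  then have "(par ^^ Suc i) v0 = (par ^^ Suc j) v" by simp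
  then have "ht v = int (Suc j) - int (Suc i)" "ht (par v) = int j - int (Suc i)"
    using vheight_eq[of "Suc i" "Suc j" v] vheight_eq[of "Suc i" j "par v"] by (auto simp: funpow_swap1)
  then show "ht (par v) = ht v - 1" by simp
  show "\<exists>i j. (par ^^ i) v = (par ^^ j) w" by (rule ancestor_exists)
  have "card {w. (v, w) \<in> E} = n" using tree by (simp add: tree_1n_def)
  moreover have "{w. (v, w) \<in> E} = {w. par w = v}" by (auto simp: edge_iff)
  ultimately show "card {w. par w = v} = n" by simp
qed (rule n2)

lemma tree_aut_iff: "g \<in> tree_aut E \<longleftrightarrow> aut g"
proof
  assume g: "g \<in> tree_aut E"
  then have "g (par v) = par (g v)" for v
    using edge_iff[of "par v" v] edge_iff[of "g (par v)" "g v"] by (simp add: tree_aut_def)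
  then show "aut g" using g by (simp add: tree_aut_def aut_def)
next
  assume "aut g"
  then show "g \<in> tree_aut E"
    using aut_par[of g] aut_eq_iff[of g] by (simp add: tree_aut_def edge_iff aut_bij flip: aut_par)
qed

lemma successively_par:
  "p \<noteq> [] \<Longrightarrow> successively (\<lambda>x y. (x, y) \<in> E) p \<Longrightarrow> (par ^^ (length p - 1)) (last p) = hd p"
proof (induction p)
  case (Cons x p)
  show ?case
  proof (cases "p = []")
    case False
    then have "(par ^^ (length p - 1)) (last p) = hd p" "x = par (hd p)"
      using Cons by (auto simp: successively_Cons edge_iff)
    moreover have "length (x # p) - 1 = Suc (length p - 1)" using False by (cases p) auto
    moreover have "(par ^^ length p) (last p) = par ((par ^^ (length p - 1)) (last p))"
      using False by (cases p) auto
    ultimately show ?thesis using False by simp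
  qed simp
qed simp

text \<open>Together with \<open>vheight_eq\<close> this translates the definitions by geodesics
  into the parent map.\<close>

lemma up_level_iff: "w \<in> up_level E k v \<longleftrightarrow> (par ^^ k) w = v"
proof
  assume "w \<in> up_level E k v"
  then have "successively (\<lambda>x y. (x, y) \<in> E) (geodesic E v w)" "length (geodesic E v w) = Suc k"
    by (auto simp: up_level_def up_def)
  then show "(par ^^ k) w = v"
    using successively_par[of "geodesic E v w"] simple_path_geodesic[of v w]
    by (auto simp: simple_path_def)
next
  assume w: "(par ^^ k) w = v"
  then have j: "(par ^^ 0) v = (par ^^ k) w" by simp
  have g: "geodesic E v w = join_path 0 k v w"
    by (rule geodesic_eqI[OF simple_path_join_path[OF j]]) simp
  have len: "length (join_path 0 k v w) = Suc k" by (simp add: join_path_def)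
  have "successively (\<lambda>x y. (x, y) \<in> E) (join_path 0 k v w)"
    unfolding successively_conv_nth
  proof (intro allI impI)
    fix t assume "Suc t < length (join_path 0 k v w)"
    then have t: "t < k" using len by simp
    then have "par ((par ^^ (k - Suc t)) w) = (par ^^ (k - t)) w"
      by (metis Suc_diff_Suc funpow.simps(2) comp_apply)
    then show "(join_path 0 k v w ! t, join_path 0 k v w ! Suc t) \<in> E"
      using t join_path_nth(2)[OF j, of t] join_path_nth(2)[OF j, of "Suc t"] by (simp add: edge_iff)
  qed
  then show "w \<in> up_level E k v" using len g by (simp add: up_level_def up_def)
qed

lemma up_iff: "w \<in> up E v \<longleftrightarrow> (\<exists>k. (par ^^ k) w = v)"
proof
  assume w: "w \<in> up E v"
  have "geodesic E v w \<noteq> []" using simple_path_geodesic by (simp add: simple_path_def)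
  then have "length (geodesic E v w) = Suc (length (geodesic E v w) - 1)" by simp
  then have "w \<in> up_level E (length (geodesic E v w) - 1) v" using w by (simp add: up_level_def)
  then show "\<exists>k. (par ^^ k) w = v" using up_level_iff by blast
next
  assume "\<exists>k. (par ^^ k) w = v"
  then show "w \<in> up E v" using up_level_iff by (auto simp: up_level_def)
qed

end

text \<open>Passing to \<open>\<beta>^l\<close> keeps the axis, and \<open>axis_step\<close>
  recovers the same axis vertices, so the orbit clause carries over. The standard \<open>a\<close>
  and \<open>b^l\<close> obtain their frame in this way.\<close>

lemma (in horo_tree) frame_power:
  assumes F: "frame 1 \<alpha> \<beta> u" and l: "l \<ge> 1"
  shows "frame l \<alpha> (\<beta> ^^ l) u"
proof -
  have F': "aut \<alpha>" "aut \<beta>" "\<And>x. \<beta> (\<alpha> x) = (\<alpha> ^^ n) (\<beta> x)" "\<alpha> u = u" "(par ^^ 1) (\<beta> u) = u"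
    and orb: "\<And>k w. (par ^^ k) w = u \<Longrightarrow> \<exists>p. w = (\<alpha> ^^ p) ((\<beta> ^^ k) u)"
    using F by (auto simp: frame_def axis_step_def[abs_def])
  have ax: "(par ^^ j) ((\<beta> ^^ (j + k)) u) = (\<beta> ^^ k) u" for j k
  proof -
    have "par (\<beta> ((\<beta> ^^ k) u)) = par ((\<beta> ^^ k) (\<beta> u))" by (simp only: funpow_swap1)
    also have "\<dots> = (\<beta> ^^ k) u"
      using aut_par[OF aut_funpow[OF F'(2)], of k "\<beta> u"] F'(5) by simp
    finally have "par (\<beta> ((\<beta> ^^ k) u)) = (\<beta> ^^ k) u" .
    then show ?thesis using axis_pow[OF _ F'(2), of 1 "(\<beta> ^^ k) u" j] by (simp add: funpow_add_apply)
  qed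
  have axl: "(par ^^ l) ((\<beta> ^^ l) u) = u" using ax[of l 0] by simp
  have "(axis_step l (\<beta> ^^ l) ^^ k) u = (\<beta> ^^ k) u" for k
  proof -
    have "(axis_step l (\<beta> ^^ l) ^^ k) u = (par ^^ ((l - 1) * k)) ((\<beta> ^^ (l * k)) u)"
      using axis_step_pow[OF l aut_funpow[OF F'(2)] axl] by (simp add: funpow_mult)
    moreover have "l * k = (l - 1) * k + k" using l by (metis Suc_pred' add.commute less_eq_Suc_le mult_Suc One_nat_def)
    ultimately show ?thesis using ax by metis
  qed
  moreover have "(\<beta> ^^ l) (\<alpha> x) = (\<alpha> ^^ (n ^ l)) ((\<beta> ^^ l) x)" for x
    using twisted_commute[of \<beta> \<alpha> n l 1, OF F'(3)] by simp
  ultimately show ?thesis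
    using l F' axl orb aut_funpow by (simp add: frame_def)
qed

section \<open>The labelled tree and its standard automorphisms\<close>

locale standard_tree = oriented_1n_tree n E v0 for n :: nat and E :: "('v \<times> 'v) set" and v0 :: 'v +
  fixes lab :: "'v \<Rightarrow> nat" and b :: "'v \<Rightarrow> 'v"
  assumes labels: "compatible_labels n E v0 lab" and b_ext: "b_extension n E v0 lab b"
begin

abbreviation L where "L k \<equiv> up_level E k v0"

lemma lab_bij: "bij_betw lab (L k) {..<n ^ k}"
  using labels by (simp add: compatible_labels_def)

lemma lab_par: "w \<in> L (Suc k) \<Longrightarrow> lab (par w) = lab w mod n ^ k"
  using labels edge_iff unfolding compatible_labels_def by blast

lemma lab_eqD: "w \<in> L k \<Longrightarrow> w' \<in> L k \<Longrightarrow> lab w = lab w' \<Longrightarrow> w = w'"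
  using lab_bij by (auto simp: bij_betw_def inj_on_def)

lemma lab_less: "w \<in> L k \<Longrightarrow> lab w < n ^ k"
  using lab_bij[of k] by (auto simp: bij_betw_def)

lemma L_unique: "w \<in> L k \<Longrightarrow> w \<in> L j \<Longrightarrow> k = j"
  using par_pow_inject by (auto simp: up_level_iff)

lemma par_L: "w \<in> L (Suc k) \<Longrightarrow> par w \<in> L k"
  by (simp add: up_level_iff funpow_swap1)

lemma aut_b: "aut b"
  using b_ext tree_aut_iff by (simp add: b_extension_def)

lemma b_L: "w \<in> L k \<Longrightarrow> b w \<in> L (Suc k)" "w \<in> L k \<Longrightarrow> lab (b w) = n * lab w"
  using b_ext by (auto simp: b_extension_def)

lemma b_pow_L: "w \<in> L k \<Longrightarrow> (b ^^ j) w \<in> L (j + k)"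
  by (induction j) (auto simp: b_L)

lemma v0_L: "v0 \<in> L 0"
  by (simp add: up_level_iff)

lemma par_b_v0: "par (b v0) = v0"
  using b_L(1)[OF v0_L] by (simp add: up_level_iff)

abbreviation a1 where "a1 \<equiv> a_up n E v0 lab"

lemma a_up_L: assumes "w \<in> L k"
  shows "a1 w \<in> L k \<and> lab (a1 w) = (lab w + 1) mod n ^ k"
proof -
  have "(lab w + 1) mod n ^ k \<in> {..<n ^ k}" using n2 by simp
  then obtain w' where w': "w' \<in> L k" "lab w' = (lab w + 1) mod n ^ k"
    using lab_bij[of k] unfolding bij_betw_def by (metis imageE)
  have "a1 w = w'"
    unfolding a_up_def
  proof (rule the_equality)
    show "\<exists>k. w \<in> L k \<and> w' \<in> L k \<and> lab w' = (lab w + 1) mod n ^ k" using assms w' by blast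
    fix w'' assume "\<exists>k. w \<in> L k \<and> w'' \<in> L k \<and> lab w'' = (lab w + 1) mod n ^ k"
    then show "w'' = w'" using L_unique[OF assms] w' lab_eqD by metis
  qed
  then show ?thesis using w' by simp
qed

lemma a_up_pow: "w \<in> L k \<Longrightarrow> (a1 ^^ p) w \<in> L k \<and> lab ((a1 ^^ p) w) = (lab w + p) mod n ^ k"
  by (induction p) (auto simp: a_up_L lab_less mod_simps)

lemma par_a_up: assumes "w \<in> L (Suc k)" shows "par ((a1 ^^ p) w) = (a1 ^^ p) (par w)"
proof (rule lab_eqD[of _ k])
  show "par ((a1 ^^ p) w) \<in> L k" "(a1 ^^ p) (par w) \<in> L k"
    using assms a_up_pow par_L by blast+
  have "n ^ k dvd n ^ Suc k" by simp
  then show "lab (par ((a1 ^^ p) w)) = lab ((a1 ^^ p) (par w))"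
    using lab_par[of "(a1 ^^ p) w" k] a_up_pow[OF assms, of p] a_up_pow[OF par_L[OF assms], of p] lab_par[OF assms]
    by (simp add: mod_mod_cancel mod_simps del: power_Suc)
qed

text \<open>On labels this is distributivity; multiplication by \<open>n\<close> turns the modulus
  \<open>n ^ k\<close> into \<open>n ^ Suc k\<close>.\<close>

lemma b_a_up: assumes "w \<in> L k" shows "b ((a1 ^^ p) w) = (a1 ^^ (n * p)) (b w)"
proof (rule lab_eqD[of _ "Suc k"])
  show "b ((a1 ^^ p) w) \<in> L (Suc k)" "(a1 ^^ (n * p)) (b w) \<in> L (Suc k)"
    using assms a_up_pow b_L by blast+
  show "lab (b ((a1 ^^ p) w)) = lab ((a1 ^^ (n * p)) (b w))"
    using a_up_pow[OF assms, of p] b_L(2)[of "(a1 ^^ p) w" k] b_L[OF assms] a_up_pow[OF b_L(1)[OF assms], of "n * p"]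
    by (simp add: mult_mod_right distrib_left)
qed

lemma b_pow_a_up: assumes "w \<in> L k" shows "(b ^^ j) ((a1 ^^ p) w) = (a1 ^^ (n ^ j * p)) ((b ^^ j) w)"
proof (induction j)
  case (Suc j)
  then show ?case using b_a_up[OF b_pow_L[OF assms], of "n ^ j * p" j] by (simp add: mult.assoc)
qed simp

lemma up_v0_iff: "w \<in> up E v0 \<longleftrightarrow> (\<exists>k. w \<in> L k)"
  by (simp add: up_iff up_level_iff)

lemma eventually_up: "\<exists>j k. (b ^^ j) x \<in> L k"
proof -
  obtain c d where cd: "(par ^^ c) x = (par ^^ d) v0" using common_ancestor by blast
  then have "(par ^^ c) ((b ^^ d) x) = (par ^^ d) ((b ^^ d) v0)"
    using aut_par_pow[OF aut_funpow[OF aut_b]] by metis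
  then show ?thesis using axis_pow[OF _ aut_b, of 1 v0 d] par_b_v0 by (auto simp: up_level_iff)
qed

abbreviation a where "a \<equiv> a_tree n E v0 lab b"

text \<open>Frees \<open>a_tree\<close> from its least exponent: by \<open>b_pow_a_up\<close>, any
  \<open>j\<close> that brings \<open>x\<close> above \<open>v0\<close> computes
  \<open>a x\<close>.\<close>

lemma b_pow_a: assumes "(b ^^ j) x \<in> L k" shows "(b ^^ j) (a x) = (a1 ^^ (n ^ j)) ((b ^^ j) x)"
proof -
  define K where "K = (LEAST k. (b ^^ k) x \<in> up E v0)"
  have ex: "(b ^^ j) x \<in> up E v0" using assms up_v0_iff by blast
  have "K \<le> j" unfolding K_def by (rule Least_le) (rule ex)
  have "(b ^^ K) x \<in> up E v0" unfolding K_def by (rule LeastI) (rule ex)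
  then obtain k' where k': "(b ^^ K) x \<in> L k'" using up_v0_iff by blast
  have "a x = inv_into UNIV (b ^^ K) ((a1 ^^ (n ^ K)) ((b ^^ K) x))"
    unfolding a_tree_def K_def Let_def using inv_fn[OF aut_bij[OF aut_b]] by simp
  then have "(b ^^ K) (a x) = (a1 ^^ (n ^ K)) ((b ^^ K) x)"
    using aut_inv_cancel(1)[OF aut_funpow[OF aut_b]] by simp
  then have "(b ^^ (j - K)) ((b ^^ K) (a x)) = (a1 ^^ (n ^ (j - K) * n ^ K)) ((b ^^ (j - K)) ((b ^^ K) x))"
    using b_pow_a_up[OF k'] by simp
  then show ?thesis using \<open>K \<le> j\<close> by (simp add: funpow_add_apply[symmetric] power_add[symmetric])
qed

lemma a_L: "w \<in> L k \<Longrightarrow> a w = a1 w"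
  using b_pow_a[of 0 w k] by simp

lemma b_inj: "(b ^^ j) x = (b ^^ j) y \<longleftrightarrow> x = y"
  by (rule aut_eq_iff[OF aut_funpow[OF aut_b]])

lemma a_up_inj: assumes "w \<in> L k" "w' \<in> L k" "(a1 ^^ p) w = (a1 ^^ p) w'" shows "w = w'"
proof -
  have "(lab w + p) mod n ^ k = (lab w' + p) mod n ^ k"
    using a_up_pow assms by metis
  then have "lab w mod n ^ k = lab w' mod n ^ k" by (simp add: nat_mod_eq_iff)
  then show ?thesis using lab_eqD assms lab_less by simp
qed

lemma aut_a: "aut a"
proof (rule autI)
  have "inj a"
  proof (rule injI)
    fix x y assume eq: "a x = a y"
    obtain j k where x: "(b ^^ j) x \<in> L k" using eventually_up by blast
    obtain j' k' where y: "(b ^^ j') y \<in> L k'" using eventually_up by blast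
    have x': "(b ^^ (j + j')) x \<in> L (j' + k)" using b_pow_L[OF x, of j'] by (simp add: funpow_add_apply[symmetric] add.commute)
    have y': "(b ^^ (j + j')) y \<in> L (j + k')" using b_pow_L[OF y, of j] by (simp add: funpow_add_apply[symmetric])
    have e: "(a1 ^^ (n ^ (j + j'))) ((b ^^ (j + j')) x) = (a1 ^^ (n ^ (j + j'))) ((b ^^ (j + j')) y)"
      using b_pow_a[OF x'] b_pow_a[OF y'] eq by simp
    then have "j' + k = j + k'" using a_up_pow x' y' L_unique by metis
    then show "x = y" using a_up_inj[OF x' _ e] y' b_inj by simp
  qed
  moreover have "\<exists>x. y = a x" for y
  proof -
    obtain j k where y: "(b ^^ j) y \<in> L k" using eventually_up by blast
    let ?f = "a1 ^^ (n ^ j)"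
    \<comment> \<open>Surjectivity by counting: an injection of the finite level \<open>L k\<close>
      into itself is onto.\<close>
    have "?f ` L k \<subseteq> L k" "inj_on ?f (L k)" using a_up_pow a_up_inj by (auto intro!: inj_onI)
    moreover have "L k = {w. (par ^^ k) w = v0}" by (auto simp: up_level_iff)
    then have "finite (L k)" using finite_descendants by simp
    ultimately have "?f ` L k = L k" by (intro endo_inj_surj)
    then obtain z where z: "z \<in> L k" "(b ^^ j) y = ?f z" using y by blast
    define x where "x = inv_into UNIV (b ^^ j) z"
    have "(b ^^ j) x = z" using aut_inv_cancel(1)[OF aut_funpow[OF aut_b]] by (simp add: x_def)
    then have "(b ^^ j) (a x) = (b ^^ j) y" using b_pow_a[of j x k] z by simp
    then show ?thesis using b_inj by metis
  qed
  ultimately show "bij a" by (auto simp: bij_def surj_def)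
  fix x
  obtain j k where "(b ^^ j) x \<in> L k" using eventually_up by blast
  \<comment> \<open>One application of \<open>b\<close> beyond \<open>j\<close> keeps the parent
    above \<open>v0\<close> as well.\<close>
  then have x: "(b ^^ Suc j) x \<in> L (Suc k)" using b_L by simp
  then have p: "(b ^^ Suc j) (par x) \<in> L k" using par_L aut_par[OF aut_funpow[OF aut_b]] by metis
  have "(b ^^ Suc j) (a (par x)) = (a1 ^^ (n ^ Suc j)) ((b ^^ Suc j) (par x))"
    by (rule b_pow_a[OF p])
  also have "\<dots> = par ((a1 ^^ (n ^ Suc j)) ((b ^^ Suc j) x))"
    using par_a_up[OF x] aut_par[OF aut_funpow[OF aut_b]] by metis
  also have "\<dots> = par ((b ^^ Suc j) (a x))" by (simp only: b_pow_a[OF x])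
  also have "\<dots> = (b ^^ Suc j) (par (a x))" by (rule aut_par[OF aut_funpow[OF aut_b], symmetric])
  finally show "a (par x) = par (a x)" using b_inj by blast
qed

lemma b_a: "b (a x) = (a ^^ n) (b x)"
proof -
  obtain j k where x: "(b ^^ j) x \<in> L k" using eventually_up by blast
  have y: "(b ^^ j) (b x) \<in> L (Suc k)" using b_L(1)[OF x] by (simp add: funpow_swap1)
  have "(b ^^ j) ((a ^^ p) (b x)) \<in> L (Suc k) \<and> (b ^^ j) ((a ^^ p) (b x)) = (a1 ^^ (n ^ j * p)) ((b ^^ j) (b x))" for p
  proof (induction p)
    case (Suc p)
    then have "(b ^^ j) (a ((a ^^ p) (b x))) = (a1 ^^ (n ^ j)) ((a1 ^^ (n ^ j * p)) ((b ^^ j) (b x)))"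
      using b_pow_a[of j "(a ^^ p) (b x)" "Suc k"] by metis
    then show ?case using a_up_pow[OF y, of "n ^ j * Suc p"] by (simp add: funpow_add_apply)
  qed (use y in simp)
  from this[of n] have "(b ^^ j) ((a ^^ n) (b x)) = (a1 ^^ (n ^ j * n)) ((b ^^ j) (b x))" by blast
  moreover have "(b ^^ j) (b (a x)) = b ((a1 ^^ (n ^ j)) ((b ^^ j) x))"
    using b_pow_a[OF x] by (simp add: funpow_swap1[symmetric])
  moreover have "\<dots> = (a1 ^^ (n * n ^ j)) ((b ^^ j) (b x))"
    using b_a_up[OF x] by (simp add: funpow_swap1)
  ultimately have "(b ^^ j) (b (a x)) = (b ^^ j) ((a ^^ n) (b x))" by (simp add: mult.commute)
  then show ?thesis using b_inj by blast
qed

text \<open>\<open>b^k v0\<close> has label 0, because \<open>b\<close> multiplies labels by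
  \<open>n\<close>. Hence the exponent of \<open>a\<close> needed to reach a vertex above
  \<open>v0\<close> is its label.\<close>

lemma frame_standard: "frame 1 a b v0"
proof -
  have "\<exists>p. w = (a ^^ p) ((axis_step 1 b ^^ k) v0)" if "(par ^^ k) w = v0" for k w
  proof -
    have w: "w \<in> L k" using that by (simp add: up_level_iff)
    have e: "(b ^^ k) v0 \<in> L k" "lab ((b ^^ k) v0) = 0"
    proof -
      show "(b ^^ k) v0 \<in> L k" using b_pow_L[OF v0_L, of k] by simp
      show "lab ((b ^^ k) v0) = 0"
      proof (induction k)
        case 0 show ?case using lab_less[OF v0_L] by simp
      next
        case (Suc k) then show ?case using b_L(2)[OF b_pow_L[OF v0_L, of k]] by simp
      qed
    qed
    have "(a ^^ p) ((b ^^ k) v0) = (a1 ^^ p) ((b ^^ k) v0)" for p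
      by (induction p) (use a_L a_up_pow[OF e(1)] in auto)
    then have "(a ^^ lab w) ((b ^^ k) v0) = w"
      using lab_eqD[OF _ w] a_up_pow[OF e(1), of "lab w"] e(2) lab_less[OF w] by simp
    then show ?thesis by (auto simp: axis_step_def[abs_def] intro!: exI[of _ "lab w"])
  qed
  moreover have "a v0 = v0" using a_L[OF v0_L] a_up_L[OF v0_L] by (simp add: up_level_iff)
  ultimately show ?thesis using aut_a aut_b b_a par_b_v0 by (simp add: frame_def)
qed

end

section \<open>The hyperbolic plane\<close>

lemma valid_path_good_set:
  fixes \<gamma> :: "real \<Rightarrow> complex"
  assumes "valid_path \<gamma>"
  obtains S where "finite S" "\<And>t. t \<in> {0..1} - S \<Longrightarrow> (\<gamma> has_vector_derivative vector_derivative \<gamma> (at t)) (at t)"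
    "continuous_on ({0..1} - S) (\<lambda>t. vector_derivative \<gamma> (at t))" "continuous_on {0..1} \<gamma>"
proof -
  from assms obtain S where S: "finite S" "\<gamma> C1_differentiable_on ({0..1} - S)" "continuous_on {0..1} \<gamma>"
    by (auto simp: valid_path_def piecewise_C1_differentiable_on_def)
  then show ?thesis
    using that[of S] by (auto simp: C1_differentiable_on_eq vector_derivative_works)
qed

lemma AE_lborel_finite: "finite S \<Longrightarrow> AE t in lborel. (t::real) \<notin> S"
  by (intro AE_not_in countable_imp_null_set_lborel countable_finite)

lemma hyp_length_cong:
  assumes "finite S" "\<And>t. t \<in> {0..1} - S \<Longrightarrow> norm (vector_derivative \<gamma> (at t)) / Im (\<gamma> t) = norm (vector_derivative \<gamma>' (at t)) / Im (\<gamma>' t)"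
  shows "hyp_length \<gamma> = hyp_length \<gamma>'"
  unfolding hyp_length_def
proof (rule nn_integral_cong_AE)
  show "AE t in lborel. ennreal (norm (vector_derivative \<gamma> (at t)) / Im (\<gamma> t)) * indicator {0..1} t
      = ennreal (norm (vector_derivative \<gamma>' (at t)) / Im (\<gamma>' t)) * indicator {0..1} t"
    using AE_lborel_finite[OF assms(1)] by eventually_elim (use assms(2) in \<open>auto split: split_indicator\<close>)
qed

lemma path_Im_pos: "path_image \<gamma> \<subseteq> upper_half \<Longrightarrow> t \<in> {0..1} \<Longrightarrow> Im (\<gamma> t) > 0"
  by (auto simp: path_image_def upper_half_def image_subset_iff)

lemma hyp_speed_measurable:
  assumes \<gamma>: "valid_path \<gamma>" "path_image \<gamma> \<subseteq> upper_half"
  shows "(\<lambda>t. ennreal (norm (vector_derivative \<gamma> (at t)) / Im (\<gamma> t)) * indicator {0..1} t) \<in> borel_measurable borel"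
proof -
  obtain S where S: "finite S" "\<And>t. t \<in> {0..1} - S \<Longrightarrow> (\<gamma> has_vector_derivative vector_derivative \<gamma> (at t)) (at t)"
    "continuous_on ({0..1} - S) (\<lambda>t. vector_derivative \<gamma> (at t))" "continuous_on {0..1} \<gamma>"
    by (rule valid_path_good_set[OF \<gamma>(1)]) (rule that)
  note Im = path_Im_pos[OF \<gamma>(2)]
  have B: "{0..1} - S \<in> sets borel" using S(1) by (simp add: sets.Diff borel_closed finite_imp_closed)
  have "(\<lambda>t. indicator ({0..1} - S) t *\<^sub>R (norm (vector_derivative \<gamma> (at t)) / Im (\<gamma> t))) \<in> borel_measurable borel"
    by (rule borel_measurable_continuous_on_indicator[OF B])
      (intro continuous_intros S(3) continuous_on_subset[OF S(4)], use Im in \<open>auto simp: order_less_imp_not_eq2\<close>)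
  then have 1: "(\<lambda>t. ennreal (indicator ({0..1} - S) t *\<^sub>R (norm (vector_derivative \<gamma> (at t)) / Im (\<gamma> t)))) \<in> borel_measurable borel"
    by simp
  \<comment> \<open>At the points of \<open>S\<close> the value of \<open>vector_derivative\<close>
    is arbitrary; a change on a countable set preserves measurability.\<close>
  have "(\<lambda>t. ennreal (norm (vector_derivative \<gamma> (at t)) / Im (\<gamma> t)) * indicator {0..1} t) =
    (\<lambda>t. if t \<in> S then ennreal (norm (vector_derivative \<gamma> (at t)) / Im (\<gamma> t)) * indicator {0..1} t
       else ennreal (indicator ({0..1} - S) t *\<^sub>R (norm (vector_derivative \<gamma> (at t)) / Im (\<gamma> t))))"
    by (auto split: split_indicator)
  moreover have "\<dots> \<in> borel_measurable borel"
  proof (rule measurable_discrete_difference[OF 1, of S])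
    show "countable S" using S(1) by (rule countable_finite)
  qed auto
  ultimately show "(\<lambda>t. ennreal (norm (vector_derivative \<gamma> (at t)) / Im (\<gamma> t)) * indicator {0..1} t) \<in> borel_measurable borel"
    by simp
qed

text \<open>Below height \<open>Y\<close> the Euclidean speed is at most \<open>Y\<close> times the
  hyperbolic speed.\<close>

lemma hyp_length_ge:
  assumes \<gamma>: "valid_path \<gamma>" "path_image \<gamma> \<subseteq> upper_half" and s: "s \<in> {0..1}"
    and Y: "\<And>t. t \<in> {0..s} \<Longrightarrow> Im (\<gamma> t) \<le> Y"
  shows "ennreal (norm (\<gamma> s - \<gamma> 0)) \<le> ennreal Y * hyp_length \<gamma>"
proof -
  obtain S where S: "finite S" "\<And>t. t \<in> {0..1} - S \<Longrightarrow> (\<gamma> has_vector_derivative vector_derivative \<gamma> (at t)) (at t)"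
    "continuous_on ({0..1} - S) (\<lambda>t. vector_derivative \<gamma> (at t))" "continuous_on {0..1} \<gamma>"
    by (rule valid_path_good_set[OF \<gamma>(1)]) (rule that)
  have Im: "Im (\<gamma> t) > 0" if "t \<in> {0..1}" for t
    using \<gamma>(2) that by (auto simp: path_image_def upper_half_def image_subset_iff)
  then have Y0: "Y > 0" using Y[of 0] s by fastforce
  define A where "A = {0..s} - S"
  have A: "A \<in> sets borel" using S(1) by (simp add: A_def sets.Diff borel_closed finite_imp_closed)
  have A01: "A \<subseteq> {0..1} - S" using s by (auto simp: A_def)
  define g where "g t = indicator A t *\<^sub>R vector_derivative \<gamma> (at t)" for t
  have g: "g \<in> borel_measurable lborel"
    unfolding g_def using borel_measurable_continuous_on_indicator[OF A continuous_on_subset[OF S(3) A01]] by simp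
  have "ennreal (norm (\<gamma> s - \<gamma> 0)) \<le> (\<integral>\<^sup>+t. ennreal (norm (g t)) \<partial>lborel)"
  \<comment> \<open>If the Euclidean length is infinite the bound is trivial. Otherwise the
    derivative is Lebesgue integrable, and its integral is the displacement by the fundamental
    theorem.\<close>
  proof (cases "(\<integral>\<^sup>+t. ennreal (norm (g t)) \<partial>lborel) < \<infinity>")
    case True
    then have int: "integrable lborel g" using g by (intro integrableI_bounded) auto
    have "((\<lambda>t. vector_derivative \<gamma> (at t)) has_integral (\<gamma> s - \<gamma> 0)) {0..s}"
      by (rule fundamental_theorem_of_calculus_interior_strong[OF S(1)])
        (use s S(2) in \<open>auto intro: continuous_on_subset[OF S(4)]\<close>)
    then have "((\<lambda>t. if t \<in> {0..s} then vector_derivative \<gamma> (at t) else 0) has_integral (\<gamma> s - \<gamma> 0)) UNIV"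
      by (simp only: has_integral_restrict_UNIV)
    then have "(g has_integral (\<gamma> s - \<gamma> 0)) UNIV"
      by (rule has_integral_spike_finite[OF S(1), rotated]) (auto simp: g_def A_def)
    then have "\<gamma> s - \<gamma> 0 = integral\<^sup>L lborel g"
      using has_integral_integral_lborel[OF int] has_integral_unique by blast
    then show ?thesis using integral_norm_bound_ennreal[OF int] by simp
  qed (simp add: not_less top_unique)
  also have "\<dots> \<le> (\<integral>\<^sup>+t. ennreal Y * (ennreal (norm (vector_derivative \<gamma> (at t)) / Im (\<gamma> t)) * indicator {0..1} t) \<partial>lborel)"
  proof (rule nn_integral_mono)
    fix t
    show "ennreal (norm (g t)) \<le> ennreal Y * (ennreal (norm (vector_derivative \<gamma> (at t)) / Im (\<gamma> t)) * indicator {0..1} t)"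
    proof (cases "t \<in> A")
      case True
      then have t: "t \<in> {0..1}" "t \<in> {0..s}" using s by (auto simp: A_def)
      have "norm (vector_derivative \<gamma> (at t)) * Im (\<gamma> t) \<le> norm (vector_derivative \<gamma> (at t)) * Y"
        using Y[OF t(2)] by (simp add: mult_left_mono)
      then have "norm (vector_derivative \<gamma> (at t)) \<le> Y * (norm (vector_derivative \<gamma> (at t)) / Im (\<gamma> t))"
        using Im[OF t(1)] by (simp add: field_simps)
      then show ?thesis using t True Y0 Im[OF t(1)]
        by (simp add: g_def ennreal_mult''[symmetric])
    qed (simp add: g_def)
  qed
  also have "\<dots> = ennreal Y * hyp_length \<gamma>"
    unfolding hyp_length_def
  proof (rule nn_integral_cmult)
    show "(\<lambda>t. ennreal (norm (vector_derivative \<gamma> (at t)) / Im (\<gamma> t)) * indicator {0..1} t) \<in> borel_measurable lborel"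
      using hyp_speed_measurable[OF \<gamma>] by simp
  qed
  finally show ?thesis .
qed

text \<open>Up to the first exit from the disc of radius \<rho> the height is at most
  \<open>Im (\<gamma> 0) + \<rho>\<close>, so leaving the disc costs length at least
  \<open>\<rho> / (Im (\<gamma> 0) + \<rho>)\<close>.\<close>

lemma short_path_stays_close:
  assumes \<gamma>: "valid_path \<gamma>" "path_image \<gamma> \<subseteq> upper_half" and "\<rho> > 0"
    and len: "hyp_length \<gamma> < ennreal (\<rho> / (Im (\<gamma> 0) + \<rho>))" and t: "t \<in> {0..1}"
  shows "norm (\<gamma> t - \<gamma> 0) < \<rho>"
proof (rule ccontr)
  assume t': "\<not> norm (\<gamma> t - \<gamma> 0) < \<rho>"
  have cont: "continuous_on {0..1} \<gamma>" using \<gamma>(1) by (simp add: valid_path_def piecewise_C1_differentiable_on_def)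
  let ?f = "\<lambda>t. norm (\<gamma> t - \<gamma> 0)"
  have contf: "continuous_on {0..1} ?f" by (intro continuous_intros cont)
  let ?K = "{0..1} \<inter> ?f -` {\<rho>..}"
  have "closed ?K" by (intro continuous_closed_preimage contf) auto
  then have "compact ?K" by (metis compact_Icc compact_Int_closed inf.left_idem)
  moreover have "?K \<noteq> {}" using t t' by auto
  ultimately obtain s where s: "s \<in> ?K" "\<And>t. t \<in> ?K \<Longrightarrow> s \<le> t" by (metis compact_attains_inf)
  have "\<exists>x\<ge>0. x \<le> s \<and> ?f x = \<rho>"
    by (rule IVT') (use s assms(3) in \<open>auto intro: continuous_on_subset[OF contf]\<close>)
  then obtain x where x: "0 \<le> x" "x \<le> s" "?f x = \<rho>" by blast
  then have "s \<le> x" using s by (intro s(2)) auto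
  then have fs: "?f s = \<rho>" using x by simp
  have "Im (\<gamma> t) \<le> Im (\<gamma> 0) + \<rho>" if "t \<in> {0..s}" for t
  proof -
    have "?f t \<le> \<rho>"
    proof (cases "t = s")
      case False
      then have "t \<notin> ?K" using s(2)[of t] that by auto
      then show ?thesis using that s(1) by auto
    qed (simp add: fs)
    then have "\<bar>Im (\<gamma> t - \<gamma> 0)\<bar> \<le> \<rho>" using abs_Im_le_cmod order_trans by blast
    then show ?thesis by simp
  qed
  then have *: "ennreal \<rho> \<le> ennreal (Im (\<gamma> 0) + \<rho>) * hyp_length \<gamma>"
    using hyp_length_ge[OF \<gamma>, of s "Im (\<gamma> 0) + \<rho>"] s(1) fs by simp
  have "\<gamma> 0 \<in> path_image \<gamma>" by (auto simp: path_image_def)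
  then have pos: "Im (\<gamma> 0) + \<rho> > 0" using \<gamma>(2) assms(3) by (auto simp: upper_half_def)
  have "ennreal (Im (\<gamma> 0) + \<rho>) * hyp_length \<gamma> < ennreal (Im (\<gamma> 0) + \<rho>) * ennreal (\<rho> / (Im (\<gamma> 0) + \<rho>))"
    using len pos by (intro ennreal_mult_strict_left_mono) auto
  also have "\<dots> = ennreal \<rho>" using pos assms(3) by (simp add: ennreal_mult[symmetric])
  finally show False using * by simp
qed

section \<open>Elementary bounds for the hyperbolic distance, and height-scaling isometries\<close>

definition hyp_paths :: "complex \<Rightarrow> complex \<Rightarrow> (real \<Rightarrow> complex) set" where
  "hyp_paths z w = {\<gamma>. valid_path \<gamma> \<and> path_image \<gamma> \<subseteq> upper_half \<and> pathstart \<gamma> = z \<and> pathfinish \<gamma> = w}"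

lemma hyp_dist_eq: "hyp_dist z w = enn2real (INF \<gamma>\<in>hyp_paths z w. hyp_length \<gamma>)"
  by (simp add: hyp_dist_def hyp_paths_def)

lemma convex_upper_half: "convex upper_half"
  unfolding upper_half_def by (rule convex_halfspace_Im_gt)

lemma open_upper_half: "open upper_half"
  unfolding upper_half_def by (rule open_halfspace_Im_gt)

lemma linepath_hyp_paths:
  assumes "z \<in> upper_half" "w \<in> upper_half" shows "linepath z w \<in> hyp_paths z w"
  using assms closed_segment_subset[OF assms convex_upper_half] by (simp add: hyp_paths_def)

lemma hyp_length_linepath:
  assumes "z \<in> upper_half" "Im z \<le> Im w"
  shows "hyp_length (linepath z w) \<le> ennreal (norm (w - z) / Im z)"
proof -
  have "hyp_length (linepath z w) \<le> (\<integral>\<^sup>+t. ennreal (norm (w - z) / Im z) * indicator {0..1::real} t \<partial>lborel)"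
    unfolding hyp_length_def
  proof (rule nn_integral_mono)
    fix t :: real
    show "ennreal (norm (vector_derivative (linepath z w) (at t)) / Im (linepath z w t)) * indicator {0..1} t
      \<le> ennreal (norm (w - z) / Im z) * indicator {0..1} t"
    proof (cases "t \<in> {0..1}")
      case True
      have "t * Im z \<le> t * Im w" using True assms(2) by (auto intro: mult_left_mono)
      then have Im: "Im z \<le> Im (linepath z w t)" by (simp add: linepath_def algebra_simps)
      have pos: "Im z > 0" using assms by (simp add: upper_half_def)
      have "norm (w - z) / Im (linepath z w t) \<le> norm (w - z) / Im z"
        by (rule divide_left_mono[OF Im]) (use pos Im in simp_all)
      then show ?thesis using True by (simp add: ennreal_leI)
    qed simp
  qed
  also have "\<dots> = ennreal (norm (w - z) / Im z)" by (simp add: nn_integral_cmult_indicator)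
  finally show ?thesis .
qed

text \<open>With \<open>hyp_dist_ge\<close> this stands in for the closed formula: both bounds equal
  \<open>norm (w - z) / Im z\<close> to first order, which is all that a derivative sees.\<close>

lemma hyp_dist_le:
  assumes "z \<in> upper_half" "Im z \<le> Im w"
  shows "hyp_dist z w \<le> norm (w - z) / Im z"
proof -
  have "w \<in> upper_half" using assms by (simp add: upper_half_def)
  then have "(INF \<gamma>\<in>hyp_paths z w. hyp_length \<gamma>) \<le> ennreal (norm (w - z) / Im z)"
    by (rule INF_lower2[where f = hyp_length, OF linepath_hyp_paths[OF assms(1)] hyp_length_linepath[OF assms]])
  then show ?thesis
    unfolding hyp_dist_eq using assms by (intro enn2real_leI) (auto simp: upper_half_def)
qed

lemma hyp_dist_ge:
  assumes "z \<in> upper_half" "w \<in> upper_half" "Im z \<le> Im w"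
  shows "norm (w - z) / (Im z + norm (w - z)) \<le> hyp_dist z w"
proof (cases "w = z")
  case False
  let ?\<rho> = "norm (w - z)"
  have "ennreal (?\<rho> / (Im z + ?\<rho>)) \<le> hyp_length \<gamma>" if "\<gamma> \<in> hyp_paths z w" for \<gamma>
    using short_path_stays_close[of \<gamma> ?\<rho> 1] that False
    by (auto simp: hyp_paths_def pathstart_def pathfinish_def not_less[symmetric])
  then have "ennreal (?\<rho> / (Im z + ?\<rho>)) \<le> (INF \<gamma>\<in>hyp_paths z w. hyp_length \<gamma>)"
    by (rule INF_greatest)
  \<comment> \<open>Finiteness matters because \<open>enn2real\<close> sends infinity to 0.\<close>
  moreover have "(INF \<gamma>\<in>hyp_paths z w. hyp_length \<gamma>) < \<infinity>"
    using INF_lower2[where f = hyp_length, OF linepath_hyp_paths[OF assms(1,2)] hyp_length_linepath[OF assms(1,3)]]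
    by (rule order_le_less_trans) simp
  ultimately have "enn2real (ennreal (?\<rho> / (Im z + ?\<rho>))) \<le> hyp_dist z w"
    unfolding hyp_dist_eq by (intro enn2real_mono) auto
  then show ?thesis using assms(1) by (simp add: upper_half_def)
qed (simp add: hyp_dist_eq)

text \<open>Since \<open>f\<close> scales heights by \<open>c\<close>, comparing distances to nearby points gives
  \<open>|L v| = c |v|\<close> for the derivative \<open>L\<close>; as also \<open>Im (L v) = c Im v\<close> and \<open>det L > 0\<close>, \<open>L\<close> is
  multiplication by \<open>c\<close>.\<close>

lemma hyp_isom_norm_derivative:
  assumes f: "f \<in> hyp_isom" and Im: "\<And>z. z \<in> upper_half \<Longrightarrow> Im (f z) = c * Im z" and c: "c > 0"
    and z: "z \<in> upper_half" and L: "(f has_derivative L) (at z)" and v: "Im v \<ge> 0" "v \<noteq> 0"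
  shows "norm (L v) = c * norm v"
proof -
  have y: "Im z > 0" using z by (simp add: upper_half_def)
  define \<Delta> where "\<Delta> h = f (z + h *\<^sub>R v) - f z" for h :: real
  have bl: "bounded_linear L" using L by (rule has_derivative_bounded_linear)
  have Lh: "L (h *\<^sub>R v) = h *\<^sub>R L v" for h by (rule linear_simps(5)[OF bl])
  have "((\<lambda>k. norm (f (z + k) - f z - L k) / norm k) \<longlongrightarrow> 0) (at 0)"
    using L by (simp add: has_derivative_at)
  moreover have "filterlim (\<lambda>h::real. h *\<^sub>R v) (at 0) (at_right 0)"
  proof (rule filterlim_atI)
    show "((\<lambda>h::real. h *\<^sub>R v) \<longlongrightarrow> 0) (at_right 0)"
      by (rule tendsto_eq_intros | simp)+
    show "\<forall>\<^sub>F h::real in at_right 0. h *\<^sub>R v \<noteq> 0"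
      using eventually_at_right_less by eventually_elim (use v in auto)
  qed
  ultimately have "((\<lambda>h. norm (\<Delta> h - h *\<^sub>R L v) / norm (h *\<^sub>R v)) \<longlongrightarrow> 0) (at_right 0)"
    unfolding \<Delta>_def Lh[symmetric] by (rule filterlim_compose)
  then have "((\<lambda>h. norm (\<Delta> h - h *\<^sub>R L v) / norm (h *\<^sub>R v) * norm v) \<longlongrightarrow> 0) (at_right 0)"
    by (rule tendsto_mult_left_zero)
  moreover have "\<forall>\<^sub>F h in at_right 0. norm (norm (\<Delta> h) / h - norm (L v)) \<le> norm (\<Delta> h - h *\<^sub>R L v) / norm (h *\<^sub>R v) * norm v"
    using eventually_at_right_less[of "0::real"]
  proof eventually_elim
    case (elim h)
    have "\<bar>norm (\<Delta> h) - norm (h *\<^sub>R L v)\<bar> \<le> norm (\<Delta> h - h *\<^sub>R L v)" by (rule norm_triangle_ineq3)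
    moreover have "norm (\<Delta> h) / h - norm (L v) = (norm (\<Delta> h) - norm (h *\<^sub>R L v)) / h"
      using elim by (simp add: field_simps)
    ultimately show ?case using elim v by (simp add: abs_div divide_right_mono)
  qed
  ultimately have "((\<lambda>h. norm (\<Delta> h) / h - norm (L v)) \<longlongrightarrow> 0) (at_right 0)"
    by (rule Lim_null_comparison[rotated])
  then have nq: "((\<lambda>h. norm (\<Delta> h) / h) \<longlongrightarrow> norm (L v)) (at_right 0)"
    by (rule LIM_zero_cancel)
  have h0: "((\<lambda>h. h) \<longlongrightarrow> (0::real)) (at_right 0)" by (rule tendsto_ident_at)
  have "((\<lambda>h. norm (\<Delta> h) / h * h) \<longlongrightarrow> norm (L v) * 0) (at_right 0)"
    by (intro tendsto_mult nq h0)
  moreover have "\<forall>\<^sub>F h in at_right 0. norm (\<Delta> h) / h * h = norm (\<Delta> h)"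
    using eventually_at_right_less[of "0::real"] by eventually_elim simp
  ultimately have \<Delta>0: "((\<lambda>h. norm (\<Delta> h)) \<longlongrightarrow> 0) (at_right 0)"
    using Lim_transform_eventually[of "\<lambda>h. norm (\<Delta> h) / h * h" "norm (L v) * 0" "at_right 0" "\<lambda>h. norm (\<Delta> h)"]
    by simp
  \<comment> \<open>The upper and lower bounds for the distance, used for the two points and for
    their images. \<open>Im v \<ge> 0\<close> supplies the order of heights that both bounds
    require.\<close>
  have near: "\<forall>\<^sub>F h in at_right 0. norm (\<Delta> h) / h / (c * Im z + norm (\<Delta> h)) \<le> norm v / Im z
      \<and> norm v / (Im z + h * norm v) \<le> norm (\<Delta> h) / h / (c * Im z)"
    using eventually_at_right_less[of "0::real"]
  proof eventually_elim
    case (elim h)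
    let ?w = "z + h *\<^sub>R v"
    have w: "?w \<in> upper_half" "Im z \<le> Im ?w" using y v elim by (auto simp: upper_half_def intro!: add_pos_nonneg)
    have fz: "f z \<in> upper_half" "f ?w \<in> upper_half" "Im (f z) \<le> Im (f ?w)"
      using Im[OF z] Im[OF w(1)] w z c by (auto simp: upper_half_def intro!: mult_pos_pos add_pos_nonneg)
    have d: "hyp_dist (f z) (f ?w) = hyp_dist z ?w" using f z w(1) by (simp add: hyp_isom_def)
    have "norm (\<Delta> h) / (c * Im z + norm (\<Delta> h)) \<le> hyp_dist z ?w"
      using hyp_dist_ge[OF fz] d Im[OF z] by (simp add: \<Delta>_def)
    also have "\<dots> \<le> norm (h *\<^sub>R v) / Im z" using hyp_dist_le[OF z w(2)] by simp
    finally have 1: "norm (\<Delta> h) / (c * Im z + norm (\<Delta> h)) / h \<le> norm (h *\<^sub>R v) / Im z / h"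
      using elim by (intro divide_right_mono) auto
    have "norm (h *\<^sub>R v) / (Im z + norm (h *\<^sub>R v)) \<le> hyp_dist z ?w"
      using hyp_dist_ge[OF z w] by simp
    also have "\<dots> \<le> norm (\<Delta> h) / (c * Im z)"
      using hyp_dist_le[OF fz(1,3)] d Im[OF z] by (simp add: \<Delta>_def)
    finally have 2: "norm (h *\<^sub>R v) / (Im z + norm (h *\<^sub>R v)) / h \<le> norm (\<Delta> h) / (c * Im z) / h"
      using elim by (intro divide_right_mono) auto
    have "norm (h *\<^sub>R v) / Im z / h = norm v / Im z"
      "norm (h *\<^sub>R v) / (Im z + norm (h *\<^sub>R v)) / h = norm v / (Im z + h * norm v)"
      "x / k / h = x / h / k" for x k :: real
      using elim by simp_all
    then show ?case using 1 2 by metis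
  qed
  have nontriv: "at_right (0::real) \<noteq> bot" by (rule trivial_limit_at_right_real)
  have t0: "((\<lambda>h. norm (\<Delta> h) / h / (c * Im z + norm (\<Delta> h))) \<longlongrightarrow> norm (L v) / (c * Im z + 0)) (at_right 0)"
    by (intro tendsto_divide nq tendsto_add tendsto_const \<Delta>0) (use c y in simp)
  have t1: "((\<lambda>h. norm v / (Im z + h * norm v)) \<longlongrightarrow> norm v / (Im z + 0 * norm v)) (at_right 0)"
    by (intro tendsto_divide tendsto_add tendsto_mult tendsto_const h0) (use y in simp)
  have t2: "((\<lambda>h. norm (\<Delta> h) / h / (c * Im z)) \<longlongrightarrow> norm (L v) / (c * Im z)) (at_right 0)"
    by (intro tendsto_divide nq tendsto_const) (use c y in simp)
  have "norm (L v) / (c * Im z + 0) \<le> norm v / Im z"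
    by (rule tendsto_le[OF nontriv tendsto_const t0]) (use near in \<open>auto elim: eventually_mono\<close>)
  moreover have "norm v / (Im z + 0 * norm v) \<le> norm (L v) / (c * Im z)"
    by (rule tendsto_le[OF nontriv t2 t1]) (use near in \<open>auto elim: eventually_mono\<close>)
  ultimately show ?thesis using c y by (simp add: field_simps)
qed

lemma hyp_isom_derivative:
  assumes f: "f \<in> hyp_isom" and Im: "\<And>z. z \<in> upper_half \<Longrightarrow> Im (f z) = c * Im z" and c: "c > 0"
    and o: "orientation_preserving f" and z: "z \<in> upper_half"
  shows "(f has_derivative (\<lambda>v. of_real c * v)) (at z)"
proof -
  obtain L where L: "(f has_derivative L) (at z)" "Re (L 1) * Im (L \<i>) - Im (L 1) * Re (L \<i>) > 0"
    using o z by (auto simp: orientation_preserving_def)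
  have bl: "bounded_linear L" using L(1) by (rule has_derivative_bounded_linear)
  have ImL: "Im (L v) = c * Im v" for v
  proof -
    have "((\<lambda>z. Im (f z)) has_derivative (\<lambda>v. Im (L v))) (at z)"
      by (rule has_derivative_Im[OF L(1)])
    moreover have "((\<lambda>z. Im (f z)) has_derivative (\<lambda>v. c * Im v)) (at z)"
    proof (rule has_derivative_transform_within_open[OF _ open_upper_half z])
      show "((\<lambda>z. c * Im z) has_derivative (\<lambda>v. c * Im v)) (at z)"
        by (auto intro!: derivative_eq_intros)
    qed (simp add: Im)
    ultimately show ?thesis using has_derivative_unique by metis
  qed
  have "norm (L 1) = c" "norm (L \<i>) = c"
    using hyp_isom_norm_derivative[OF f Im c z L(1), of 1] hyp_isom_norm_derivative[OF f Im c z L(1), of \<i>] by simp_all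
  then have "Re (L 1) ^ 2 = c ^ 2" "Re (L \<i>) ^ 2 + c ^ 2 = c ^ 2"
    using ImL[of 1] ImL[of \<i>] cmod_power2[of "L 1"] cmod_power2[of "L \<i>"] by simp_all
  \<comment> \<open>The determinant is \<open>Re (L 1) * c\<close>, so its sign excludes the
    reflection.\<close>
  moreover have "Re (L 1) > 0" using L(2) ImL[of 1] ImL[of \<i>] c by (simp add: zero_less_mult_iff)
  ultimately have L1: "L 1 = of_real c" and Li: "L \<i> = of_real c * \<i>"
    using ImL[of 1] ImL[of \<i>] c by (auto simp: complex_eq_iff power2_eq_iff)
  have lin: "L v = Re v *\<^sub>R L 1 + Im v *\<^sub>R L \<i>" for v
  proof -
    have "v = Re v *\<^sub>R 1 + Im v *\<^sub>R \<i>" by (simp add: complex_eq_iff)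
    then show ?thesis using bl by (metis linear_simps(1) linear_simps(5))
  qed
  have "L v = of_real c * v" for v
    unfolding lin[of v] L1 Li by (simp add: complex_eq_iff)
  then have "L = (\<lambda>v. of_real c * v)" by (rule ext)
  then show ?thesis using L(1) by simp
qed

text \<open>The difference of \<open>f\<close> and multiplication by \<open>c\<close> has zero
  derivative on a convex set. The constant is real because heights are scaled exactly by
  \<open>c\<close>.\<close>

lemma hyp_isom_affine:
  assumes f: "f \<in> hyp_isom" and Im: "\<And>z. z \<in> upper_half \<Longrightarrow> Im (f z) = c * Im z" and c: "c > 0"
    and o: "orientation_preserving f"
  obtains t :: real where "\<And>z. z \<in> upper_half \<Longrightarrow> f z = of_real c * z + of_real t"
proof -
  have "\<exists>k. \<forall>z\<in>upper_half. f z - of_real c * z = k"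
  proof (rule has_derivative_zero_constant[OF convex_upper_half])
    fix z assume "z \<in> upper_half"
    then have "(f has_derivative (\<lambda>v. of_real c * v)) (at z within upper_half)"
      using hyp_isom_derivative[OF f Im c o] has_derivative_at_withinI by blast
    then have "((\<lambda>z. f z - of_real c * z) has_derivative (\<lambda>v. of_real c * v - of_real c * v)) (at z within upper_half)"
      by (auto intro!: derivative_eq_intros)
    then show "((\<lambda>z. f z - of_real c * z) has_derivative (\<lambda>v. 0)) (at z within upper_half)" by simp
  qed
  then obtain k where k: "\<And>z. z \<in> upper_half \<Longrightarrow> f z - of_real c * z = k" by auto
  have i: "\<i> \<in> upper_half" by (simp add: upper_half_def)
  have "Im k = 0" using k[OF i] Im[OF i] by (metis Im_complex_of_real minus_complex.simps(2) cancel_comm_monoid_add_class.diff_cancel complex_i_mult_minus scaleR_complex.simps(2) scaleR_conv_of_real)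
  then have "k = of_real (Re k)" by (simp add: complex_eq_iff)
  then show ?thesis using that[of "Re k"] k by (metis diff_add_cancel add.commute)
qed

section \<open>Affine maps as isometries of the half plane\<close>

definition hyp_affine :: "real \<Rightarrow> real \<Rightarrow> complex \<Rightarrow> complex" where
  "hyp_affine c t = (\<lambda>z\<in>upper_half. of_real c * z + of_real t)"

lemma hyp_affine_in: "c > 0 \<Longrightarrow> z \<in> upper_half \<Longrightarrow> of_real c * z + of_real t \<in> upper_half"
  by (simp add: upper_half_def)

text \<open>Comparing the infima in \<open>ennreal\<close>, before \<open>enn2real\<close>, avoids
  questions of finiteness; the inverse map yields the opposite inequality.\<close>

lemma hyp_affine_dist_le:
  assumes "c > 0" "z \<in> upper_half" "w \<in> upper_half"
  shows "(INF \<gamma>\<in>hyp_paths (of_real c * z + of_real t) (of_real c * w + of_real t). hyp_length \<gamma>)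
    \<le> (INF \<gamma>\<in>hyp_paths z w. hyp_length \<gamma>)"
proof (rule INF_mono)
  fix \<gamma> assume "\<gamma> \<in> hyp_paths z w"
  then have \<gamma>: "valid_path \<gamma>" "path_image \<gamma> \<subseteq> upper_half" "\<gamma> 0 = z" "\<gamma> 1 = w"
    by (auto simp: hyp_paths_def pathstart_def pathfinish_def)
  let ?f = "\<lambda>z. of_real c * z + of_real t :: complex"
  have D: "(?f has_field_derivative of_real c) (at z)" for z
    by (auto intro!: derivative_eq_intros)
  have "valid_path (?f \<circ> \<gamma>)"
  proof (rule valid_path_compose[OF \<gamma>(1)])
    show "?f field_differentiable at x" for x using D field_differentiable_def by blast
    have "deriv ?f = (\<lambda>_. of_real c)" using DERIV_imp_deriv[OF D] by auto
    then show "continuous_on (path_image \<gamma>) (deriv ?f)" by simp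
  qed
  moreover have "path_image (?f \<circ> \<gamma>) \<subseteq> upper_half"
    using \<gamma>(2) hyp_affine_in[OF assms(1)] by (auto simp: path_image_compose)
  ultimately have p: "?f \<circ> \<gamma> \<in> hyp_paths (?f z) (?f w)"
    using \<gamma> by (simp add: hyp_paths_def pathstart_def pathfinish_def)
  obtain S where S: "finite S" "\<And>t. t \<in> {0..1} - S \<Longrightarrow> (\<gamma> has_vector_derivative vector_derivative \<gamma> (at t)) (at t)"
    by (rule valid_path_good_set[OF \<gamma>(1)]) (rule that)
  have "hyp_length (?f \<circ> \<gamma>) = hyp_length \<gamma>"
  proof (rule hyp_length_cong[OF S(1)])
    fix s assume s: "s \<in> {0..1} - S"
    have "(?f \<circ> \<gamma> has_vector_derivative (vector_derivative \<gamma> (at s) * of_real c)) (at s)"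
      by (rule field_vector_diff_chain_at[OF S(2)[OF s] D])
    then have "vector_derivative (?f \<circ> \<gamma>) (at s) = vector_derivative \<gamma> (at s) * of_real c"
      by (rule vector_derivative_at)
    then show "norm (vector_derivative (?f \<circ> \<gamma>) (at s)) / Im ((?f \<circ> \<gamma>) s) = norm (vector_derivative \<gamma> (at s)) / Im (\<gamma> s)"
      using assms(1) by (simp add: norm_mult)
  qed
  then show "\<exists>\<gamma>'\<in>hyp_paths (?f z) (?f w). hyp_length \<gamma>' \<le> hyp_length \<gamma>" using p by (metis order_refl)
qed

lemma hyp_affine_isom:
  assumes c: "c > 0" shows "hyp_affine c t \<in> hyp_isom"
proof -
  let ?f = "\<lambda>z. of_real c * z + of_real t :: complex"
  have inv: "of_real (1/c) * ?f z + of_real (- t / c) = z" "?f (of_real (1/c) * z + of_real (- t / c)) = z" for z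
    using c by (simp_all add: field_simps)
  have "bij_betw (hyp_affine c t) upper_half upper_half"
  proof (rule bij_betwI[where g = "hyp_affine (1/c) (-t/c)"])
    have c': "1 / c > 0" using c by simp
    show "hyp_affine c t \<in> upper_half \<rightarrow> upper_half" "hyp_affine (1/c) (-t/c) \<in> upper_half \<rightarrow> upper_half"
      unfolding hyp_affine_def
      by (rule funcsetI, simp only: restrict_apply' hyp_affine_in[OF c] hyp_affine_in[OF c'])+
    show "hyp_affine (1/c) (-t/c) (hyp_affine c t z) = z" "hyp_affine c t (hyp_affine (1/c) (-t/c) z) = z"
      if "z \<in> upper_half" for z
      using that by (simp_all only: hyp_affine_def restrict_apply' hyp_affine_in[OF c] hyp_affine_in[OF c'] inv)
  qed
  moreover have "hyp_dist (?f z) (?f w) = hyp_dist z w" if "z \<in> upper_half" "w \<in> upper_half" for z w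
  proof -
    have "(INF \<gamma>\<in>hyp_paths z w. hyp_length \<gamma>) \<le> (INF \<gamma>\<in>hyp_paths (?f z) (?f w). hyp_length \<gamma>)"
      using hyp_affine_dist_le[of "1/c" "?f z" "?f w" "- t / c"] hyp_affine_in[OF c] that c unfolding inv by simp
    then show ?thesis unfolding hyp_dist_eq using hyp_affine_dist_le[OF c that, of t] by (metis antisym)
  qed
  ultimately show ?thesis by (simp add: hyp_isom_def Bij_def hyp_affine_def)
qed

lemma hyp_affine_fixes_infinity: assumes "c > 0" shows "fixes_infinity (hyp_affine c t)"
proof -
  have "filterlim (\<lambda>z. of_real c * z + of_real t :: complex) at_infinity at_infinity"
    using assms by (intro tendsto_add_filterlim_at_infinity' tendsto_mult_filterlim_at_infinity tendsto_const filterlim_ident) auto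
  then have "filterlim (\<lambda>z. of_real c * z + of_real t :: complex) at_infinity (inf at_infinity (principal upper_half))"
    by (rule filterlim_mono) auto
  then show ?thesis
    unfolding fixes_infinity_def
    by (rule filterlim_cong[THEN iffD1, rotated -1]) (auto simp: eventually_inf_principal hyp_affine_def)
qed

lemma hyp_affine_orientation: assumes "c > 0" shows "orientation_preserving (hyp_affine c t)"
  unfolding orientation_preserving_def
proof
  fix z assume z: "z \<in> upper_half"
  have "(hyp_affine c t has_derivative (\<lambda>v. of_real c * v)) (at z)"
    by (rule has_derivative_transform_within_open[OF _ open_upper_half z, of "\<lambda>z. of_real c * z + of_real t"])
      (auto intro!: derivative_eq_intros simp: hyp_affine_def)
  then show "\<exists>L. (hyp_affine c t has_derivative L) (at z) \<and> Re (L 1) * Im (L \<i>) - Im (L 1) * Re (L \<i>) > 0"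
    using assms by (intro exI[of _ "\<lambda>v. of_real c * v"]) simp
qed

section \<open>The isometry group\<close>

lemma hyp_affine_compose:
  assumes "c' > 0"
  shows "compose upper_half (hyp_affine c t) (hyp_affine c' t') = hyp_affine (c * c') (c * t' + t)"
  using hyp_affine_in[OF assms] by (auto simp: compose_def hyp_affine_def fun_eq_iff algebra_simps)

lemma hyp_affine_id: "hyp_affine 1 0 = (\<lambda>z\<in>upper_half. z)"
  by (auto simp: hyp_affine_def)

lemma hyp_affine_eq_iff: "hyp_affine c t = hyp_affine c' t' \<longleftrightarrow> c = c' \<and> t = t'"
proof
  assume "hyp_affine c t = hyp_affine c' t'"
  then have "hyp_affine c t \<i> = hyp_affine c' t' \<i>" by simp
  then show "c = c' \<and> t = t'" by (simp add: hyp_affine_def upper_half_def complex_eq_iff)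
qed simp

lemma hyp_affine_Im: "z \<in> upper_half \<Longrightarrow> Im (hyp_affine c t z) = c * Im z"
  by (simp add: hyp_affine_def)

lemma hyp_affine_Bij: "c > 0 \<Longrightarrow> hyp_affine c t \<in> Bij upper_half"
  using hyp_affine_isom[of c t] by (simp add: hyp_isom_def)

definition vertex_point :: "'v \<Rightarrow> 'v \<Rightarrow> real" where
  "vertex_point v = (\<lambda>x. if x = v then 1 else 0)"

lemma vertex_point_in: "vertex_point v \<in> tree_points E"
proof -
  have "{x. vertex_point v x \<noteq> 0} = {v}" by (auto simp: vertex_point_def)
  then show ?thesis by (auto simp: tree_points_def) (auto simp: vertex_point_def)
qed

lemma theight_vertex_point: "theight E v0 (vertex_point v) = of_int (vheight E v0 v)"
proof -
  have "{x. vertex_point v x \<noteq> 0} = {v}" by (auto simp: vertex_point_def)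
  then show ?thesis by (simp add: theight_def) (simp add: vertex_point_def)
qed

lemma act_tree_vertex_point: "bij g \<Longrightarrow> act_tree g (vertex_point v) = vertex_point (g v)"
  by (auto simp: act_tree_def vertex_point_def fun_eq_iff bij_is_surj bij_is_inj surj_f_inv_f)

context oriented_1n_tree
begin

abbreviation G where "G \<equiv> G_group n E v0"

text \<open>Barycentric coordinates sum to 1, so a constant shift of all vertex heights shifts the
  height of every point by that constant.\<close>

lemma theight_act_tree:
  assumes g: "aut g" and \<alpha>: "\<alpha> \<in> tree_points E"
  shows "theight E v0 (act_tree g \<alpha>) = theight E v0 \<alpha> + of_int (ht (g v0))"
proof -
  have supp: "{x. act_tree g \<alpha> x \<noteq> 0} = g ` {x. \<alpha> x \<noteq> 0}"
  proof (intro equalityI subsetI)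
    fix x assume "x \<in> {x. act_tree g \<alpha> x \<noteq> 0}"
    then show "x \<in> g ` {x. \<alpha> x \<noteq> 0}"
      by (intro image_eqI[of _ _ "inv_into UNIV g x"]) (simp_all add: act_tree_def aut_inv_cancel[OF g])
  qed (auto simp: act_tree_def aut_inv_cancel[OF g])
  define s where "s = ht (g v0)"
  have h: "ht (g x) = ht x + s" for x
    using ht_aut[OF g, of x v0] by (simp add: ht_v0 s_def)
  have "theight E v0 (act_tree g \<alpha>) = (\<Sum>x | \<alpha> x \<noteq> 0. act_tree g \<alpha> (g x) * of_int (ht (g x)))"
    unfolding theight_def supp by (rule sum.reindex_cong[OF inj_on_subset[OF aut_inj[OF g] subset_UNIV]]) auto
  also have "\<dots> = (\<Sum>x | \<alpha> x \<noteq> 0. \<alpha> x * of_int (ht x) + \<alpha> x * of_int s)"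
    by (intro sum.cong refl) (simp add: act_tree_def aut_inv_cancel[OF g] h distrib_left)
  also have "\<dots> = theight E v0 \<alpha> + of_int s"
    using \<alpha> by (simp add: sum.distrib theight_def tree_points_def flip: sum_distrib_right)
  finally show ?thesis unfolding s_def .
qed

definition shift :: "('v \<Rightarrow> 'v) \<Rightarrow> int" where "shift g = ht (g v0)"

lemma ht_shift: "aut g \<Longrightarrow> ht (g v) = ht v + shift g"
  using ht_aut[of g v v0] by (simp add: ht_v0 shift_def)

lemma shift_comp: "aut f \<Longrightarrow> aut g \<Longrightarrow> shift (f \<circ> g) = shift f + shift g"
  using ht_shift[of f "g v0"] by (simp add: shift_def)

lemma shift_id: "shift id = 0"
  by (simp add: shift_def ht_v0)

lemma shift_inv: "aut g \<Longrightarrow> shift (inv_into UNIV g) = - shift g"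
  using ht_shift[of g "inv_into UNIV g v0"] by (simp add: aut_inv_cancel ht_v0 shift_def)

abbreviation scale :: "('v \<Rightarrow> 'v) \<Rightarrow> real" where "scale g \<equiv> real n powi shift g"

lemma scale_pos: "scale g > 0"
  using n2 by simp

text \<open>By \<open>carrier_G\<close> these are all elements of the group when \<open>g\<close>
  ranges over the automorphisms. The group is thus a semidirect product of the translations with the
  tree automorphisms, which act on translations through \<open>scale\<close>.\<close>

definition elt :: "real \<Rightarrow> ('v \<Rightarrow> 'v) \<Rightarrow> 'v isom" where
  "elt t g = (hyp_affine (scale g) t, g)"

lemma elt_eq_iff: "elt t g = elt t' g' \<longleftrightarrow> t = t' \<and> g = g'"
  by (auto simp: elt_def hyp_affine_eq_iff)

text \<open>Compatibility of heights, tested at the vertex \<open>v0\<close>, already makes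
  \<open>f\<close> scale heights by \<open>scale g\<close>, so \<open>hyp_isom_affine\<close>
  applies.\<close>

lemma carrier_G: "carrier G = {elt t g | t g. aut g}"
proof (intro equalityI subsetI)
  fix p assume "p \<in> carrier G"
  then obtain f g where p: "p = (f, g)" and f: "f \<in> hyp_isom" and g: "aut g" and o: "orientation_preserving f"
    and h: "\<And>z \<alpha>. z \<in> upper_half \<Longrightarrow> \<alpha> \<in> tree_points E \<Longrightarrow>
      hheight n (f z) - hheight n z = theight E v0 (act_tree g \<alpha>) - theight E v0 \<alpha>"
    by (auto simp: G_group_def Isom_X_def tree_aut_iff)
  have Im: "Im (f z) = scale g * Im z" if z: "z \<in> upper_half" for z
  proof -
    have "f z \<in> upper_half" using f z by (auto simp: hyp_isom_def Bij_def bij_betw_def)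
    then have pos: "Im (f z) > 0" "Im z > 0" using z by (auto simp: upper_half_def)
    have "log n (Im (f z)) - log n (Im z) = of_int (shift g)"
      using h[OF z vertex_point_in[of v0]] theight_act_tree[OF g vertex_point_in] by (simp add: hheight_def shift_def)
    then have "log n (Im (f z) / Im z) = of_int (shift g)" using pos n2 by (simp add: log_divide)
    moreover have "real n powr log n (Im (f z) / Im z) = Im (f z) / Im z"
      using pos n2 by (intro powr_log_cancel) auto
    moreover have "real n powr of_int (shift g) = scale g" using n2 by (intro powr_real_of_int') auto
    ultimately have "Im (f z) / Im z = scale g" by simp
    then show ?thesis using pos by (simp add: field_simps)
  qed
  obtain t where t: "\<And>z. z \<in> upper_half \<Longrightarrow> f z = of_real (scale g) * z + of_real t"
    using hyp_isom_affine[OF f Im scale_pos o] by blast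
  have "f \<in> extensional upper_half" using f by (simp add: hyp_isom_def Bij_def)
  then have "f = hyp_affine (scale g) t"
    by (intro extensionalityI[of f upper_half]) (auto simp: hyp_affine_def t)
  then show "p \<in> {elt t g | t g. aut g}" using p g by (auto simp: elt_def)
next
  fix p assume "p \<in> {elt t g | t g. aut g}"
  then obtain t g where p: "p = elt t g" and g: "aut g" by blast
  have "hheight n (hyp_affine (scale g) t z) - hheight n z = theight E v0 (act_tree g \<alpha>) - theight E v0 \<alpha>"
    if "z \<in> upper_half" "\<alpha> \<in> tree_points E" for z \<alpha>
  proof -
    have "Im z > 0" using that by (simp add: upper_half_def)
    moreover have "log n (scale g) = of_int (shift g)"
    proof -
      have "scale g = real n powr of_int (shift g)" using n2 by (intro powr_real_of_int'[symmetric]) auto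
      then show ?thesis using n2 by simp
    qed
    ultimately show ?thesis
      using that scale_pos[of g] n2 theight_act_tree[OF g that(2)] by (simp add: hheight_def hyp_affine_Im log_mult_pos) (simp add: shift_def)
  qed
  then show "p \<in> carrier G"
    using hyp_affine_isom[OF scale_pos] hyp_affine_fixes_infinity[OF scale_pos] hyp_affine_orientation[OF scale_pos] g
    by (simp add: G_group_def Isom_X_def tree_aut_iff p elt_def)
qed

lemma elt_carrier: "aut g \<Longrightarrow> elt t g \<in> carrier G"
  using carrier_G by blast

lemma carrierE: assumes "p \<in> carrier G" obtains t g where "p = elt t g" "aut g"
  using assms carrier_G by blast

abbreviation big where "big \<equiv> BijGroup upper_half \<times>\<times> BijGroup (UNIV :: 'v set)"

lemma elt_big: "aut g \<Longrightarrow> elt t g \<in> carrier big"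
  using hyp_affine_Bij[OF scale_pos] by (simp add: BijGroup_def elt_def aut_bij Bij_def)

lemma mult_big: assumes "aut g" "aut g'"
  shows "elt t g \<otimes>\<^bsub>big\<^esub> elt t' g' = elt (scale g * t' + t) (g \<circ> g')"
proof -
  have "elt t g \<otimes>\<^bsub>big\<^esub> elt t' g' = (compose upper_half (hyp_affine (scale g) t) (hyp_affine (scale g') t'), compose UNIV g g')"
    using hyp_affine_Bij[OF scale_pos] assms by (simp add: elt_def BijGroup_def Bij_def aut_bij)
  also have "\<dots> = (hyp_affine (scale g * scale g') (scale g * t' + t), g \<circ> g')"
    by (simp add: hyp_affine_compose[OF scale_pos]) (simp add: compose_def fun_eq_iff)
  also have "scale g * scale g' = scale (g \<circ> g')"
    using n2 by (simp add: shift_comp assms power_int_add)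
  finally show ?thesis by (simp only: elt_def)
qed

lemma one_big: "\<one>\<^bsub>big\<^esub> = elt 0 id"
  by (simp add: elt_def BijGroup_def shift_id hyp_affine_id fun_eq_iff)

lemma inv_elt_mult: "aut g \<Longrightarrow> elt (- t / scale g) (inv_into UNIV g) \<otimes>\<^bsub>big\<^esub> elt t g = \<one>\<^bsub>big\<^esub>"
proof -
  assume g: "aut g"
  have "scale (inv_into UNIV g) * t + - t / scale g = 0"
    using scale_pos[of g] by (simp add: shift_inv g power_int_minus field_simps)
  moreover have "inv_into UNIV g \<circ> g = id" using aut_inv_cancel(2)[OF g] by (simp add: fun_eq_iff)
  ultimately show ?thesis unfolding one_big mult_big[OF aut_inv[OF g] g] elt_eq_iff by simp
qed

lemma group_big: "group big"
  by (intro DirProd_group group_BijGroup)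

lemma subgroup_G: "subgroup (carrier G) big"
proof (rule group.subgroupI[OF group_big])
  show "carrier G \<subseteq> carrier big" using elt_big by (blast elim: carrierE)
  show "carrier G \<noteq> {}" using elt_carrier aut_id by blast
next
  fix p assume "p \<in> carrier G"
  then obtain t g where p: "p = elt t g" "aut g" by (rule carrierE)
  have "inv\<^bsub>big\<^esub> p = elt (- t / scale g) (inv_into UNIV g)"
    using group.inv_equality[OF group_big inv_elt_mult[OF p(2), of t]] elt_big p aut_inv by simp
  then show "inv\<^bsub>big\<^esub> p \<in> carrier G" using elt_carrier aut_inv p(2) by simp
next
  fix p q assume "p \<in> carrier G" "q \<in> carrier G"
  then show "p \<otimes>\<^bsub>big\<^esub> q \<in> carrier G"
    by (elim carrierE) (simp add: mult_big elt_carrier aut_comp)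
qed

lemma G_eq: "G = big \<lparr>carrier := carrier G\<rparr>"
  by (simp add: G_group_def)

lemma group_G: "group G"
  using subgroup.subgroup_is_group[OF subgroup_G group_big] G_eq by simp

lemma mult_G: assumes "aut g" "aut g'"
  shows "elt t g \<otimes>\<^bsub>G\<^esub> elt t' g' = elt (scale g * t' + t) (g \<circ> g')"
  using mult_big[OF assms] by (simp add: G_group_def)

lemma one_G: "\<one>\<^bsub>G\<^esub> = elt 0 id"
  using one_big by (simp add: G_group_def)

lemma inv_G: assumes "aut g" shows "inv\<^bsub>G\<^esub> (elt t g) = elt (- t / scale g) (inv_into UNIV g)"
proof (rule group.inv_equality[OF group_G])
  show "elt (- t / scale g) (inv_into UNIV g) \<otimes>\<^bsub>G\<^esub> elt t g = \<one>\<^bsub>G\<^esub>"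
    using inv_elt_mult[OF assms, of t] by (simp add: G_group_def)
qed (use assms aut_inv elt_carrier in auto)

lemma shift_funpow: "aut g \<Longrightarrow> shift (g ^^ k) = int k * shift g"
  using ht_funpow[of g k v0 v0] by (simp add: shift_def ht_v0)

text \<open>In the two cases allowed the translation part is linear in \<open>k\<close>; in general
  it is a geometric sum.\<close>

lemma pow_G: assumes "aut g" "shift g = 0 \<or> t = 0"
  shows "elt t g [^]\<^bsub>G\<^esub> (k::nat) = elt (k * t) (g ^^ k)"
proof (induction k)
  case 0
  have "g ^^ 0 = id" by (simp add: id_def)
  then show ?case by (simp only: one_G nat_pow_0 of_nat_0 mult_zero_left)
next
  case (Suc k)
  have "elt t g [^]\<^bsub>G\<^esub> Suc k = elt (k * t) (g ^^ k) \<otimes>\<^bsub>G\<^esub> elt t g"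
    unfolding nat_pow_Suc Suc ..
  also have "\<dots> = elt (scale (g ^^ k) * t + k * t) (g ^^ k \<circ> g)"
    by (rule mult_G[OF aut_funpow[OF assms(1)] assms(1)])
  also have "scale (g ^^ k) * t + k * t = Suc k * t"
    using assms by (auto simp: shift_funpow algebra_simps)
  also have "g ^^ k \<circ> g = g ^^ Suc k" by (rule funpow_Suc_right[symmetric])
  finally show ?case .
qed

end

section \<open>The metric of the horocyclic product\<close>

lemma hyp_length_reversepath:
  assumes \<gamma>: "valid_path \<gamma>" "path_image \<gamma> \<subseteq> upper_half"
  shows "hyp_length (reversepath \<gamma>) = hyp_length \<gamma>"
proof -
  obtain S where S: "finite S" "\<And>t. t \<in> {0..1} - S \<Longrightarrow> (\<gamma> has_vector_derivative vector_derivative \<gamma> (at t)) (at t)"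
    by (rule valid_path_good_set[OF \<gamma>(1)]) (rule that)
  let ?F = "\<lambda>t. ennreal (norm (vector_derivative \<gamma> (at t)) / Im (\<gamma> t)) * indicator {0..1} t"
  have "hyp_length \<gamma> = (\<integral>\<^sup>+t. ?F (1 + -1 * t) \<partial>lborel)"
    unfolding hyp_length_def using nn_integral_real_affine[OF hyp_speed_measurable[OF \<gamma>], of "-1" 1] by simp
  also have "\<dots> = hyp_length (reversepath \<gamma>)"
    unfolding hyp_length_def
  proof (rule nn_integral_cong_AE)
    have "finite ((-) 1 ` S)" using S(1) by simp
    from AE_lborel_finite[OF this]
    show "AE t in lborel. ?F (1 + -1 * t) = ennreal (norm (vector_derivative (reversepath \<gamma>) (at t)) / Im (reversepath \<gamma> t)) * indicator {0..1} t"
    proof eventually_elim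
      case (elim t)
      show ?case
      proof (cases "t \<in> {0..1}")
        case True
        have "1 - t \<notin> S" using elim by (metis add_diff_cancel_left' diff_add_cancel image_eqI)
        then have D: "(\<gamma> has_vector_derivative vector_derivative \<gamma> (at (1 - t))) (at (1 - t))" using S(2) True by auto
        have "((\<lambda>t. 1 - t) has_vector_derivative -1) (at t)" by (auto intro!: derivative_eq_intros)
        then have "(\<gamma> \<circ> (\<lambda>t. 1 - t) has_vector_derivative (-1) *\<^sub>R vector_derivative \<gamma> (at (1 - t))) (at t)"
          by (rule vector_diff_chain_at[where f = "\<lambda>t. 1 - t" and g = \<gamma> and x = t, OF _ D])
        then have "vector_derivative (reversepath \<gamma>) (at t) = - vector_derivative \<gamma> (at (1 - t))"
          by (simp add: reversepath_def o_def vector_derivative_at)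
        then show ?thesis using True by (simp add: reversepath_def indicator_def)
      qed (auto simp: indicator_def)
    qed
  qed
  finally show ?thesis ..
qed

text \<open>Linear substitution in each half; the joint \<open>1/2\<close> and the rescaled
  exceptional parameters form a finite set, hence a null set.\<close>

lemma hyp_length_join:
  assumes 1: "valid_path \<gamma>1" "path_image \<gamma>1 \<subseteq> upper_half" and 2: "valid_path \<gamma>2" "path_image \<gamma>2 \<subseteq> upper_half"
  shows "hyp_length (\<gamma>1 +++ \<gamma>2) = hyp_length \<gamma>1 + hyp_length \<gamma>2"
proof -
  obtain S1 where S1: "finite S1" "\<And>t. t \<in> {0..1} - S1 \<Longrightarrow> (\<gamma>1 has_vector_derivative vector_derivative \<gamma>1 (at t)) (at t)"
    by (rule valid_path_good_set[OF 1(1)]) (rule that)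
  obtain S2 where S2: "finite S2" "\<And>t. t \<in> {0..1} - S2 \<Longrightarrow> (\<gamma>2 has_vector_derivative vector_derivative \<gamma>2 (at t)) (at t)"
    by (rule valid_path_good_set[OF 2(1)]) (rule that)
  let ?F = "\<lambda>\<gamma> t. ennreal (norm (vector_derivative \<gamma> (at t)) / Im (\<gamma> t)) * indicator {0..1} t"
  note m1 = hyp_speed_measurable[OF 1] and m2 = hyp_speed_measurable[OF 2]
  have "hyp_length \<gamma>1 + hyp_length \<gamma>2 = (\<integral>\<^sup>+t. 2 * ?F \<gamma>1 (0 + 2 * t) \<partial>lborel) + (\<integral>\<^sup>+t. 2 * ?F \<gamma>2 (-1 + 2 * t) \<partial>lborel)"
  proof -
    have "hyp_length \<gamma>1 = (\<integral>\<^sup>+t. 2 * ?F \<gamma>1 (0 + 2 * t) \<partial>lborel)"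
      unfolding hyp_length_def using nn_integral_real_affine[OF m1, of 2 0] measurable_compose[OF _ m1, of "\<lambda>t. 0 + 2 * t" borel]
      by (subst nn_integral_cmult) simp_all
    moreover have "hyp_length \<gamma>2 = (\<integral>\<^sup>+t. 2 * ?F \<gamma>2 (-1 + 2 * t) \<partial>lborel)"
      unfolding hyp_length_def using nn_integral_real_affine[OF m2, of 2 "-1"] measurable_compose[OF _ m2, of "\<lambda>t. -1 + 2 * t" borel]
      by (subst nn_integral_cmult) simp_all
    ultimately show ?thesis by simp
  qed
  also have "\<dots> = (\<integral>\<^sup>+t. 2 * ?F \<gamma>1 (0 + 2 * t) + 2 * ?F \<gamma>2 (-1 + 2 * t) \<partial>lborel)"
    using measurable_compose[OF _ m1, of "\<lambda>t. 0 + 2 * t" borel] measurable_compose[OF _ m2, of "\<lambda>t. -1 + 2 * t" borel]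
    by (subst nn_integral_add) simp_all
  also have "\<dots> = hyp_length (\<gamma>1 +++ \<gamma>2)"
    unfolding hyp_length_def
  proof (rule nn_integral_cong_AE)
    have fin: "finite ({1/2} \<union> (\<lambda>s. s / 2) ` S1 \<union> (\<lambda>s. (s + 1) / 2) ` S2)" using S1(1) S2(1) by simp
    show "AE t in lborel. 2 * ?F \<gamma>1 (0 + 2 * t) + 2 * ?F \<gamma>2 (-1 + 2 * t) = ?F (\<gamma>1 +++ \<gamma>2) t"
      using AE_lborel_finite[OF fin]
    proof eventually_elim
      case (elim t)
      then have t: "t \<noteq> 1/2" "2 * t \<notin> S1" "2 * t - 1 \<notin> S2" 
        using image_eqI[of t "\<lambda>s. s / 2" "2 * t" S1] image_eqI[of t "\<lambda>s. (s + 1) / 2" "2 * t - 1" S2] by auto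
      have two: "2 * ennreal r = ennreal (2 * r)" for r by (simp add: ennreal_mult')
      consider "t \<notin> {0..1}" | "t \<in> {0..1}" "t < 1/2" | "t \<in> {0..1}" "t > 1/2" using t(1) by fastforce
      then show ?case
      proof cases
        case 1 then show ?thesis by (auto simp: indicator_def)
      next
        case 2
        then have D: "(\<gamma>1 has_vector_derivative vector_derivative \<gamma>1 (at (2 * t))) (at (2 * t))" using S1(2) t by auto
        have "((\<lambda>t. 2 * t) has_vector_derivative 2) (at t)" by (auto intro!: derivative_eq_intros)
        then have "(\<gamma>1 \<circ> (\<lambda>t. 2 * t) has_vector_derivative 2 *\<^sub>R vector_derivative \<gamma>1 (at (2 * t))) (at t)"
          by (rule vector_diff_chain_at[where f = "\<lambda>t. 2 * t" and g = \<gamma>1 and x = t, OF _ D])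
        then have "(\<gamma>1 +++ \<gamma>2 has_vector_derivative 2 *\<^sub>R vector_derivative \<gamma>1 (at (2 * t))) (at t)"
          by (rule has_vector_derivative_transform_within_open[of _ _ _ "{..<1/2}"]) (use 2 in \<open>auto simp: joinpaths_def\<close>)
        then have v: "vector_derivative (\<gamma>1 +++ \<gamma>2) (at t) = 2 *\<^sub>R vector_derivative \<gamma>1 (at (2 * t))"
          by (rule vector_derivative_at)
        have "-1 + 2 * t \<notin> {0..1}" using 2 by auto
        moreover have "(\<gamma>1 +++ \<gamma>2) t = \<gamma>1 (2 * t)" using 2 by (simp add: joinpaths_def)
        ultimately show ?thesis using 2 by (simp add: v two indicator_def)
      next
        case 3
        then have D: "(\<gamma>2 has_vector_derivative vector_derivative \<gamma>2 (at (2 * t - 1))) (at (2 * t - 1))" using S2(2) t by auto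
        have "((\<lambda>t. 2 * t - 1) has_vector_derivative 2) (at t)" by (auto intro!: derivative_eq_intros)
        then have "(\<gamma>2 \<circ> (\<lambda>t. 2 * t - 1) has_vector_derivative 2 *\<^sub>R vector_derivative \<gamma>2 (at (2 * t - 1))) (at t)"
          by (rule vector_diff_chain_at[where f = "\<lambda>t. 2 * t - 1" and g = \<gamma>2 and x = t, OF _ D])
        then have "(\<gamma>1 +++ \<gamma>2 has_vector_derivative 2 *\<^sub>R vector_derivative \<gamma>2 (at (2 * t - 1))) (at t)"
          by (rule has_vector_derivative_transform_within_open[of _ _ _ "{1/2<..}"]) (use 3 in \<open>auto simp: joinpaths_def\<close>)
        then have v: "vector_derivative (\<gamma>1 +++ \<gamma>2) (at t) = 2 *\<^sub>R vector_derivative \<gamma>2 (at (2 * t - 1))"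
          by (rule vector_derivative_at)
        have "2 * t \<notin> {0..1}" using 3 by auto
        moreover have "(\<gamma>1 +++ \<gamma>2) t = \<gamma>2 (2 * t - 1)" using 3 by (simp add: joinpaths_def)
        ultimately show ?thesis using 3 by (simp add: v two indicator_def)
      qed
    qed
  qed
  finally show ?thesis ..
qed

lemma hyp_length_C1_finite:
  fixes \<gamma> :: "real \<Rightarrow> complex"
  assumes D: "\<And>t. t \<in> {0..1} \<Longrightarrow> (\<gamma> has_vector_derivative D t) (at t)" and cont: "continuous_on {0..1} D"
    and im: "path_image \<gamma> \<subseteq> upper_half"
  shows "valid_path \<gamma>" "hyp_length \<gamma> < \<infinity>"
proof -
  have c: "continuous_on {0..1} \<gamma>"
    by (rule continuous_at_imp_continuous_on) (use D has_vector_derivative_continuous in blast)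
  then show "valid_path \<gamma>" unfolding valid_path_def
    by (intro C1_differentiable_imp_piecewise) (use D cont in \<open>unfold C1_differentiable_on_def, blast\<close>)
  have "continuous_on {0..1} (\<lambda>t. norm (D t) / Im (\<gamma> t))"
    by (intro continuous_intros c cont) (use path_Im_pos[OF im] in \<open>auto simp: order_less_imp_not_eq2\<close>)
  then have "bounded ((\<lambda>t. norm (D t) / Im (\<gamma> t)) ` {0..1})"
    by (intro compact_imp_bounded compact_continuous_image) auto
  then obtain B where B: "\<And>t. t \<in> {0..1} \<Longrightarrow> norm (D t) / Im (\<gamma> t) \<le> B"
    unfolding bounded_iff by (metis abs_le_D1 image_eqI real_norm_def)
  have "hyp_length \<gamma> \<le> (\<integral>\<^sup>+t. ennreal B * indicator {0..1::real} t \<partial>lborel)"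
    unfolding hyp_length_def
    by (rule nn_integral_mono) (use B vector_derivative_at[OF D] in \<open>auto simp: indicator_def ennreal_leI\<close>)
  also have "\<dots> = ennreal B" by (simp add: nn_integral_cmult_indicator)
  also have "\<dots> < \<infinity>" by simp
  finally show "hyp_length \<gamma> < \<infinity>" .
qed

text \<open>An edge is named by its upper end \<open>v\<close>, which determines it;
  \<open>t\<close> is the distance from the lower end.\<close>

definition edge_point :: "('v \<times> 'v) set \<Rightarrow> 'v \<Rightarrow> real \<Rightarrow> 'v \<Rightarrow> real" where
  "edge_point E v t = (\<lambda>x. if x = v then t else if x = parent E v then 1 - t else 0)"

section \<open>Points of the horocyclic product and paths of finite length\<close>

context oriented_1n_tree
begin

lemma par_neq: "par v \<noteq> v"
  using par_acyclic[of 1 v] by auto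

lemma edge_point_1: "edge_point E v 1 = vertex_point v"
  by (auto simp: edge_point_def vertex_point_def)

lemma edge_point_0: "edge_point E v 0 = vertex_point (par v)"
  using par_neq[of v] by (auto simp: edge_point_def vertex_point_def)

lemma edge_point_props:
  assumes "0 \<le> t" "t \<le> 1"
  shows "edge_point E v t \<in> tree_points E" "theight E v0 (edge_point E v t) = of_int (ht v) - 1 + t"
proof -
  have supp: "{x. edge_point E v t x \<noteq> 0} \<subseteq> {v, par v}" by (auto simp: edge_point_def)
  have s: "(\<Sum>x | edge_point E v t x \<noteq> 0. edge_point E v t x * f x) = t * f v + (1 - t) * f (par v)" for f :: "'v \<Rightarrow> real"
  proof -
    have "(\<Sum>x | edge_point E v t x \<noteq> 0. edge_point E v t x * f x) = (\<Sum>x\<in>{v, par v}. edge_point E v t x * f x)"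
      by (rule sum.mono_neutral_left) (use supp in auto)
    then show ?thesis using par_neq[of v] by (simp add: edge_point_def)
  qed
  show "theight E v0 (edge_point E v t) = of_int (ht v) - 1 + t"
    unfolding theight_def s by (simp add: ht_par algebra_simps)
  consider "t = 0" | "t = 1" | "0 < t" "t < 1" using assms by linarith
  then show "edge_point E v t \<in> tree_points E"
  proof cases
    case 3
    then have "{x. edge_point E v t x \<noteq> 0} = {par v, v}" using par_neq by (auto simp: edge_point_def)
    then show ?thesis using s[of "\<lambda>_. 1"] 3 by (auto simp: tree_points_def edge_iff edge_point_def)
  qed (auto simp: edge_point_0 edge_point_1 vertex_point_in)
qed

lemma tree_points_cases:
  assumes "\<alpha> \<in> tree_points E"
  obtains v t where "0 < t" "t \<le> 1" "\<alpha> = edge_point E v t"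
proof -
  have sum1: "(\<Sum>x | \<alpha> x \<noteq> 0. \<alpha> x) = 1" and nn: "\<And>v. 0 \<le> \<alpha> v" using assms by (auto simp: tree_points_def)
  consider v where "{x. \<alpha> x \<noteq> 0} = {v}" | v where "{x. \<alpha> x \<noteq> 0} = {par v, v}"
    using assms by (auto simp: tree_points_def edge_iff)
  then show ?thesis
  proof cases
    case 1
    then have "\<alpha> v = 1" using sum1 by simp
    then have "\<alpha> = edge_point E v 1" using 1 unfolding edge_point_1 by (auto simp: vertex_point_def fun_eq_iff)
    then show ?thesis using that[of 1 v] by simp
  next
    case 2
    then have "\<alpha> (par v) + \<alpha> v = 1" "\<alpha> v \<noteq> 0" using sum1 par_neq[of v] by auto
    moreover have "\<alpha> x = 0" if "x \<noteq> v" "x \<noteq> par v" for x using 2 that by auto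
    ultimately have "\<alpha> = edge_point E v (\<alpha> v)" by (auto simp: edge_point_def fun_eq_iff)
    then show ?thesis using that[of "\<alpha> v" v] \<open>\<alpha> v \<noteq> 0\<close> nn[of v] nn[of "par v"] \<open>\<alpha> (par v) + \<alpha> v = 1\<close> by simp
  qed
qed

text \<open>The ends of an edge differ by 1 in height. So a nonzero coordinate at \<open>v\<close>
  is a tent function of the height, centred at \<open>ht v\<close>.\<close>

lemma coordinate_from_height:
  assumes "\<alpha> \<in> tree_points E" "\<alpha> v \<noteq> 0"
  shows "\<alpha> v = 1 - \<bar>theight E v0 \<alpha> - of_int (ht v)\<bar>" "0 < \<alpha> v"
proof -
  obtain w t where t: "0 < t" "t \<le> 1" "\<alpha> = edge_point E w t" using tree_points_cases[OF assms(1)] .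
  then have "v = w \<and> \<alpha> v = t \<or> v = par w \<and> \<alpha> v = 1 - t" using assms(2) by (auto simp: edge_point_def split: if_splits)
  moreover have "theight E v0 \<alpha> = of_int (ht w) - 1 + t" using edge_point_props(2)[of t w] t by simp
  moreover have "0 \<le> \<alpha> v" using assms(1) by (simp add: tree_points_def)
  ultimately show "\<alpha> v = 1 - \<bar>theight E v0 \<alpha> - of_int (ht v)\<bar>" "0 < \<alpha> v"
    using t assms(2) by (auto simp: ht_par)
qed

abbreviation X where "X \<equiv> X_space n E v0"

definition X_paths where
  "X_paths x y = {\<gamma>. path \<gamma> \<and> path_image \<gamma> \<subseteq> X \<and> valid_path (fst \<circ> \<gamma>) \<and> pathstart \<gamma> = x \<and> pathfinish \<gamma> = y}"

lemma X_dist_eq: "X_dist n E v0 x y = enn2real (INF \<gamma>\<in>X_paths x y. hyp_length (fst \<circ> \<gamma>))"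
  by (simp add: X_dist_def X_paths_def)

lemma X_iff: "(z, \<alpha>) \<in> X \<longleftrightarrow> \<alpha> \<in> tree_points E \<and> Im z = real n powr theight E v0 \<alpha>"
proof -
  have "hheight n z = theight E v0 \<alpha> \<longleftrightarrow> Im z = real n powr theight E v0 \<alpha>" if "Im z > 0"
  proof -
    have "real n powr log n (Im z) = Im z" using that n2 by (intro powr_log_cancel) auto
    moreover have "log n (real n powr h) = h" for h using n2 by (intro log_powr_cancel) auto
    ultimately show ?thesis unfolding hheight_def by metis
  qed
  moreover have "real n powr theight E v0 \<alpha> > 0" using n2 by simp
  ultimately show ?thesis by (auto simp: X_space_def upper_half_def)
qed

lemma X_paths_fst_image: "\<gamma> \<in> X_paths x y \<Longrightarrow> path_image (fst \<circ> \<gamma>) \<subseteq> upper_half"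
  by (force simp: X_paths_def X_space_def path_image_def)

text \<open>As \<open>enn2real\<close> sends infinity to 0, \<open>X_dist\<close> separates points
  only if they are joined by a path of finite length; this is shown first, in
  \<open>X_conn_all\<close>.\<close>

definition X_conn where "X_conn x y \<longleftrightarrow> (\<exists>\<gamma>\<in>X_paths x y. hyp_length (fst \<circ> \<gamma>) < \<infinity>)"

lemma X_paths_join:
  assumes "\<gamma>1 \<in> X_paths x y" "\<gamma>2 \<in> X_paths y z"
  shows "\<gamma>1 +++ \<gamma>2 \<in> X_paths x z"
    "hyp_length (fst \<circ> (\<gamma>1 +++ \<gamma>2)) = hyp_length (fst \<circ> \<gamma>1) + hyp_length (fst \<circ> \<gamma>2)"
proof -
  have fin: "pathfinish \<gamma>1 = pathstart \<gamma>2" using assms by (simp add: X_paths_def)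
  have "valid_path ((fst \<circ> \<gamma>1) +++ (fst \<circ> \<gamma>2))"
    by (rule valid_path_join) (use assms fin in \<open>auto simp: X_paths_def pathfinish_def pathstart_def\<close>)
  then show "\<gamma>1 +++ \<gamma>2 \<in> X_paths x z"
    using assms fin by (auto simp: X_paths_def path_image_join path_compose_join)
  show "hyp_length (fst \<circ> (\<gamma>1 +++ \<gamma>2)) = hyp_length (fst \<circ> \<gamma>1) + hyp_length (fst \<circ> \<gamma>2)"
    unfolding path_compose_join
    by (rule hyp_length_join) (use assms X_paths_fst_image in \<open>auto simp: X_paths_def\<close>)
qed

lemma X_paths_reverse:
  assumes "\<gamma> \<in> X_paths x y"
  shows "reversepath \<gamma> \<in> X_paths y x" "hyp_length (fst \<circ> reversepath \<gamma>) = hyp_length (fst \<circ> \<gamma>)"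
proof -
  have *: "fst \<circ> reversepath \<gamma> = reversepath (fst \<circ> \<gamma>)" by (auto simp: reversepath_def)
  show "reversepath \<gamma> \<in> X_paths y x" unfolding X_paths_def mem_Collect_eq *
    using assms valid_path_imp_reverse[of "fst \<circ> \<gamma>"] by (auto simp: X_paths_def)
  show "hyp_length (fst \<circ> reversepath \<gamma>) = hyp_length (fst \<circ> \<gamma>)" unfolding *
    by (rule hyp_length_reversepath) (use assms X_paths_fst_image in \<open>auto simp: X_paths_def\<close>)
qed

lemma X_conn_trans: "X_conn x y \<Longrightarrow> X_conn y z \<Longrightarrow> X_conn x z"
  unfolding X_conn_def
proof (elim bexE)
  fix \<gamma>1 \<gamma>2
  assume p: "\<gamma>1 \<in> X_paths x y" "\<gamma>2 \<in> X_paths y z"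
    and l: "hyp_length (fst \<circ> \<gamma>1) < \<infinity>" "hyp_length (fst \<circ> \<gamma>2) < \<infinity>"
  show "\<exists>\<gamma>\<in>X_paths x z. hyp_length (fst \<circ> \<gamma>) < \<infinity>"
    using X_paths_join[OF p] l by (intro bexI[of _ "\<gamma>1 +++ \<gamma>2"]) simp_all
qed

lemma X_conn_sym: "X_conn x y \<Longrightarrow> X_conn y x"
  unfolding X_conn_def
proof (elim bexE)
  fix \<gamma> assume p: "\<gamma> \<in> X_paths x y" and l: "hyp_length (fst \<circ> \<gamma>) < \<infinity>"
  show "\<exists>\<gamma>\<in>X_paths y x. hyp_length (fst \<circ> \<gamma>) < \<infinity>"
    using X_paths_reverse[OF p] l by (intro bexI[of _ "reversepath \<gamma>"]) simp_all
qed

lemma X_connI: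
  assumes D: "\<And>t. t \<in> {0..1} \<Longrightarrow> (f has_vector_derivative D t) (at t)" and cont: "continuous_on {0..1} D"
    and g: "\<And>v. continuous_on {0..1} (\<lambda>t. g t v)" and X: "\<And>t. t \<in> {0..1} \<Longrightarrow> (f t, g t) \<in> X"
  shows "X_conn (f 0, g 0) (f 1, g 1)"
proof -
  let ?\<gamma> = "\<lambda>t. (f t, g t)"
  have fst: "fst \<circ> ?\<gamma> = f" by (auto simp: o_def)
  have im: "path_image f \<subseteq> upper_half" using X by (auto simp: path_image_def X_space_def)
  note C = hyp_length_C1_finite[OF D cont im]
  have "continuous_on {0..1} f" using C(1) by (simp add: valid_path_def piecewise_C1_differentiable_on_def)
  then have "path ?\<gamma>" unfolding path_def
    by (intro continuous_on_Pair continuous_on_coordinatewise_then_product g)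
  then have "?\<gamma> \<in> X_paths (f 0, g 0) (f 1, g 1)"
    using C(1) X unfolding X_paths_def mem_Collect_eq fst
    by (auto simp: path_image_def pathstart_def pathfinish_def)
  then show ?thesis using C(2) unfolding X_conn_def by (metis fst)
qed

lemma X_conn_horizontal:
  assumes "(Complex x y, \<alpha>) \<in> X" shows "X_conn (Complex x y, \<alpha>) (Complex x' y, \<alpha>)"
proof -
  have "X_conn ((\<lambda>t. Complex (x + t * (x' - x)) y) 0, (\<lambda>_. \<alpha>) (0::real)) ((\<lambda>t. Complex (x + t * (x' - x)) y) 1, (\<lambda>_. \<alpha>) (1::real))"
  proof (rule X_connI[where D = "\<lambda>_. of_real (x' - x)"])
    show "((\<lambda>t. Complex (x + t * (x' - x)) y) has_vector_derivative of_real (x' - x)) (at t)" for t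
      unfolding Complex_eq by (auto intro!: derivative_eq_intros)
  qed (use assms in \<open>auto simp: X_iff\<close>)
  then show ?thesis by simp
qed

text \<open>A vertical segment, parametrised so that the tree height falls linearly; hence the power
  of \<open>n\<close> in the imaginary part.\<close>

lemma X_conn_down:
  assumes "0 \<le> t" "t \<le> 1"
  shows "X_conn (Complex x (real n powr (of_int (ht v) - 1 + t)), edge_point E v t)
    (Complex x (real n powr (of_int (ht v) - 1)), vertex_point (par v))"
proof -
  let ?e = "\<lambda>s. of_int (ht v) - 1 + (1 - s) * t"
  let ?f = "\<lambda>s. Complex x (real n powr ?e s)" and ?g = "\<lambda>s. edge_point E v ((1 - s) * t)"
  have "X_conn (?f 0, ?g 0) (?f 1, ?g 1)"
  proof (rule X_connI[where D = "\<lambda>s. Complex 0 (real n powr ?e s * (- t) * ln (real n))"])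
    show "(?f has_vector_derivative Complex 0 (real n powr ?e s * (- t) * ln (real n))) (at s)" for s
      unfolding Complex_eq using n2 by (auto intro!: derivative_eq_intros)
    show "continuous_on {0..1} (\<lambda>s. Complex 0 (real n powr ?e s * (- t) * ln (real n)))"
      unfolding Complex_eq using n2 by (intro continuous_intros) auto
    show "continuous_on {0..1} (\<lambda>s. ?g s w)" for w
      by (cases "w = v"; cases "w = par v") (auto simp: edge_point_def intro!: continuous_intros)
    fix s :: real assume "s \<in> {0..1}"
    then have "0 \<le> (1 - s) * t" "(1 - s) * t \<le> 1" using assms by (auto intro: mult_le_one)
    then show "(?f s, ?g s) \<in> X" by (simp add: X_iff edge_point_props)
  qed
  then show ?thesis by (simp add: edge_point_0)
qed

lemma X_conn_ancestor:
  "X_conn (Complex x (real n powr of_int (ht v)), vertex_point v)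
    (Complex x (real n powr of_int (ht ((par ^^ k) v))), vertex_point ((par ^^ k) v))"
proof (induction k)
  case 0
  show ?case using X_conn_horizontal[of x "real n powr of_int (ht v)" "vertex_point v" x]
    by (simp add: X_iff vertex_point_in theight_vertex_point)
next
  case (Suc k)
  have "X_conn (Complex x (real n powr of_int (ht ((par ^^ k) v))), vertex_point ((par ^^ k) v))
    (Complex x (real n powr of_int (ht ((par ^^ Suc k) v))), vertex_point ((par ^^ Suc k) v))"
    using X_conn_down[of 1 x "(par ^^ k) v"] by (simp add: edge_point_1 ht_par)
  then show ?case using Suc X_conn_trans by blast
qed

text \<open>Both points descend to a common ancestor, and over a fixed vertex horizontal motion is
  free.\<close>

lemma X_conn_all: assumes "x \<in> X" "y \<in> X" shows "X_conn x y"
proof -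
  have *: "\<exists>s v. X_conn x (Complex s (real n powr of_int (ht v)), vertex_point v)" if "x \<in> X" for x
  proof -
    obtain z \<alpha> where x: "x = (z, \<alpha>)" by (cases x)
    then have z: "\<alpha> \<in> tree_points E" "Im z = real n powr theight E v0 \<alpha>" using that X_iff by auto
    obtain v t where t: "0 < t" "t \<le> 1" "\<alpha> = edge_point E v t" using tree_points_cases[OF z(1)] .
    then have "z = Complex (Re z) (real n powr (of_int (ht v) - 1 + t))"
      using z(2) edge_point_props(2)[of t v] by (simp add: complex_eq_iff)
    then show ?thesis using X_conn_down[of t "Re z" v] t x by (metis ht_par less_imp_le of_int_1 of_int_diff)
  qed
  obtain s v where 1: "X_conn x (Complex s (real n powr of_int (ht v)), vertex_point v)" using *[OF assms(1)] by blast
  obtain s' w where 2: "X_conn y (Complex s' (real n powr of_int (ht w)), vertex_point w)" using *[OF assms(2)] by blast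
  obtain i j where ij: "(par ^^ i) v = (par ^^ j) w" using common_ancestor by blast
  have "X_conn x (Complex s (real n powr of_int (ht ((par ^^ i) v))), vertex_point ((par ^^ i) v))"
    using X_conn_trans[OF 1 X_conn_ancestor] .
  moreover have "X_conn (Complex s' (real n powr of_int (ht ((par ^^ i) v))), vertex_point ((par ^^ i) v)) y"
    unfolding ij using X_conn_sym[OF X_conn_trans[OF 2 X_conn_ancestor]] .
  moreover have "X_conn (Complex s (real n powr of_int (ht ((par ^^ i) v))), vertex_point ((par ^^ i) v))
     (Complex s' (real n powr of_int (ht ((par ^^ i) v))), vertex_point ((par ^^ i) v))"
    by (rule X_conn_horizontal) (simp add: X_iff vertex_point_in theight_vertex_point)
  ultimately show ?thesis using X_conn_trans by blast
qed

section \<open>The metric space \<open>X_n\<close> and its open sets\<close>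

lemma X_dist_less_iff:
  assumes "x \<in> X" "y \<in> X" "r > 0"
  shows "X_dist n E v0 x y < r \<longleftrightarrow> (\<exists>\<gamma>\<in>X_paths x y. hyp_length (fst \<circ> \<gamma>) < ennreal r)"
proof -
  have "(INF \<gamma>\<in>X_paths x y. hyp_length (fst \<circ> \<gamma>)) < \<infinity>"
    using X_conn_all[OF assms(1,2)] unfolding X_conn_def INF_less_iff .
  then have "X_dist n E v0 x y < r \<longleftrightarrow> (INF \<gamma>\<in>X_paths x y. hyp_length (fst \<circ> \<gamma>)) < ennreal r"
    unfolding X_dist_eq using assms(3)
    by (metis enn2real_less_iff ennreal_enn2real infinity_ennreal_def)
  then show ?thesis unfolding INF_less_iff .
qed

text \<open>On \<open>X\<close> the tree height is \<open>log n (Im z)\<close>, so control of the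
  projected path controls it too.\<close>

lemma short_X_path:
  assumes x: "(z, \<alpha>) \<in> X" and "\<delta> > 0"
  shows "\<exists>r>0. \<forall>y \<gamma>. \<gamma> \<in> X_paths (z, \<alpha>) y \<longrightarrow> hyp_length (fst \<circ> \<gamma>) < ennreal r \<longrightarrow>
    (\<forall>t\<in>{0..1}. norm (fst (\<gamma> t) - z) < \<delta> \<and> \<bar>theight E v0 (snd (\<gamma> t)) - theight E v0 \<alpha>\<bar> < \<delta>)"
proof -
  have y: "Im z > 0" using x by (simp add: X_space_def upper_half_def)
  have "isCont (\<lambda>w. log n (Im w)) z" using y n2 by (intro continuous_intros) auto
  then obtain d where d: "d > 0" "\<And>w. dist w z < d \<Longrightarrow> dist (log n (Im w)) (log n (Im z)) < \<delta>"
    unfolding continuous_at using assms(2) by (metis Lim_at continuous_at_eps_delta \<open>isCont (\<lambda>w. log n (Im w)) z\<close>)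
  define \<rho> where "\<rho> = min d \<delta>"
  have \<rho>: "\<rho> > 0" using d(1) assms(2) by (simp add: \<rho>_def)
  have "norm (fst (\<gamma> t) - z) < \<delta> \<and> \<bar>theight E v0 (snd (\<gamma> t)) - theight E v0 \<alpha>\<bar> < \<delta>"
    if \<gamma>: "\<gamma> \<in> X_paths (z, \<alpha>) y" and len: "hyp_length (fst \<circ> \<gamma>) < ennreal (\<rho> / (Im z + \<rho>))" and t: "t \<in> {0..1}" for y \<gamma> t
  proof -
    have 0: "(fst \<circ> \<gamma>) 0 = z" and v: "valid_path (fst \<circ> \<gamma>)" using \<gamma> by (auto simp: X_paths_def pathstart_def)
    have "norm ((fst \<circ> \<gamma>) t - (fst \<circ> \<gamma>) 0) < \<rho>"
      by (rule short_path_stays_close[OF v X_paths_fst_image[OF \<gamma>] \<rho> _ t]) (use len 0 in simp)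
    then have n: "norm (fst (\<gamma> t) - z) < \<rho>" using 0 by simp
    have "\<gamma> t \<in> X" using \<gamma> t by (auto simp: X_paths_def path_image_def)
    then have "theight E v0 (snd (\<gamma> t)) = log n (Im (fst (\<gamma> t)))" "theight E v0 \<alpha> = log n (Im z)"
      using x by (auto simp: X_space_def hheight_def)
    then show ?thesis using n d(2)[of "fst (\<gamma> t)"] by (simp add: \<rho>_def dist_norm)
  qed
  moreover have "\<rho> / (Im z + \<rho>) > 0" using \<rho> y by simp
  ultimately show ?thesis by blast
qed

text \<open>Where a coordinate \<open>\<alpha> v\<close> is nonzero it is determined by the height, so along a path whose
  height stays at distance less than \<open>1\<close> from \<open>ht v\<close> it cannot jump to \<open>0\<close>.\<close>

lemma coordinate_persists:
  assumes \<gamma>: "\<gamma> \<in> X_paths (z, \<alpha>) (w, \<beta>)" and v: "\<alpha> v \<noteq> 0" and "\<epsilon> > 0"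
    and h: "\<And>t. t \<in> {0..1} \<Longrightarrow> \<bar>theight E v0 (snd (\<gamma> t)) - of_int (ht v)\<bar> \<le> 1 - \<epsilon>"
  shows "\<beta> v \<noteq> 0"
proof
  assume "\<beta> v = 0"
  let ?f = "\<lambda>t. snd (\<gamma> t) v"
  have ends: "?f 0 = \<alpha> v" "?f 1 = \<beta> v" using \<gamma> by (auto simp: X_paths_def pathstart_def pathfinish_def)
  have T: "snd (\<gamma> t) \<in> tree_points E" if "t \<in> {0..1}" for t
    using \<gamma> that by (force simp: X_paths_def path_image_def X_space_def)
  have ge: "\<epsilon> \<le> ?f t" if "t \<in> {0..1}" "?f t \<noteq> 0" for t
    using coordinate_from_height(1)[OF T[OF that(1)] that(2)] h[OF that(1)] by simp
  have "continuous_on {0..1} ?f"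
  proof -
    have "continuous_on {0..1} \<gamma>" using \<gamma> by (simp add: X_paths_def path_def)
    then have "continuous_on {0..1} (\<lambda>t. snd (\<gamma> t))" by (rule continuous_on_snd)
    then show ?thesis by (rule continuous_on_product_then_coordinatewise)
  qed
  moreover have "\<epsilon> \<le> ?f 0" using ge[of 0] v ends by simp
  ultimately have "\<exists>t\<ge>0. t \<le> 1 \<and> ?f t = \<epsilon> / 2"
    using IVT2'[of ?f 1 "\<epsilon> / 2" 0] ends \<open>\<beta> v = 0\<close> assms(3) by simp
  then obtain t where "t \<in> {0..1}" "?f t = \<epsilon> / 2" by auto
  then show False using ge[of t] assms(3) by simp
qed

lemma coordinate_open:
  assumes x: "(z, \<alpha>) \<in> X" and v: "\<alpha> v \<noteq> 0"
  shows "\<exists>r>0. \<forall>y \<gamma>. \<gamma> \<in> X_paths (z, \<alpha>) y \<longrightarrow> hyp_length (fst \<circ> \<gamma>) < ennreal r \<longrightarrow> snd y v \<noteq> 0"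
proof -
  have T: "\<alpha> \<in> tree_points E" using x by (simp add: X_space_def)
  \<comment> \<open>The height of \<alpha> is at distance \<open>1 - 2 * \<epsilon>\<close> from
    \<open>ht v\<close>; a change of less than \<epsilon> leaves the margin required by
    \<open>coordinate_persists\<close>.\<close>
  define \<epsilon> where "\<epsilon> = \<alpha> v / 2"
  have \<epsilon>: "\<epsilon> > 0" using coordinate_from_height(2)[OF T v] by (simp add: \<epsilon>_def)
  have 0: "\<bar>theight E v0 \<alpha> - of_int (ht v)\<bar> = 1 - 2 * \<epsilon>" using coordinate_from_height(1)[OF T v] \<epsilon>_def by linarith
  obtain r where r: "r > 0" "\<And>y \<gamma> t. \<gamma> \<in> X_paths (z, \<alpha>) y \<Longrightarrow> hyp_length (fst \<circ> \<gamma>) < ennreal r \<Longrightarrow> t \<in> {0..1} \<Longrightarrow>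
    \<bar>theight E v0 (snd (\<gamma> t)) - theight E v0 \<alpha>\<bar> < \<epsilon>"
    using short_X_path[OF x \<epsilon>] by blast
  have "snd y v \<noteq> 0" if \<gamma>: "\<gamma> \<in> X_paths (z, \<alpha>) y" "hyp_length (fst \<circ> \<gamma>) < ennreal r" for y \<gamma>
  proof -
    have "\<gamma> \<in> X_paths (z, \<alpha>) (fst y, snd y)" using \<gamma>(1) by simp
    moreover have "\<bar>theight E v0 (snd (\<gamma> t)) - of_int (ht v)\<bar> \<le> 1 - \<epsilon>" if "t \<in> {0..1}" for t
      using r(2)[OF \<gamma> that] 0 by linarith
    ultimately show ?thesis using coordinate_persists[of \<gamma> z \<alpha> "fst y" "snd y" v \<epsilon>] v \<epsilon> by blast
  qed
  then show ?thesis using r(1) by blast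
qed

text \<open>Arbitrarily short paths give equal first components, hence equal heights. The nonzero
  coordinates of \<alpha> stay nonzero in \<beta> and are fixed by the height; as both families sum
  to 1, \<beta> has no others.\<close>

lemma X_dist_zeroD:
  assumes x: "x \<in> X" and y: "y \<in> X" and 0: "X_dist n E v0 x y = 0" shows "x = y"
proof -
  obtain z \<alpha> w \<beta> where xy: "x = (z, \<alpha>)" "y = (w, \<beta>)" by (cases x, cases y)
  have short: "\<exists>\<gamma>\<in>X_paths (z, \<alpha>) (w, \<beta>). hyp_length (fst \<circ> \<gamma>) < ennreal r" if "r > 0" for r
    using X_dist_less_iff[OF x y that] 0 that xy by simp
  have close: "norm (w - z) < \<delta>" if \<delta>: "\<delta> > 0" for \<delta>
  proof -
    obtain r where r: "r > 0" "\<And>\<gamma> t. \<gamma> \<in> X_paths (z, \<alpha>) (w, \<beta>) \<Longrightarrow> hyp_length (fst \<circ> \<gamma>) < ennreal r \<Longrightarrow> t \<in> {0..1} \<Longrightarrow>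
      norm (fst (\<gamma> t) - z) < \<delta>"
      using short_X_path[OF x[unfolded xy] \<delta>] by blast
    obtain \<gamma> where \<gamma>: "\<gamma> \<in> X_paths (z, \<alpha>) (w, \<beta>)" "hyp_length (fst \<circ> \<gamma>) < ennreal r" using short[OF r(1)] by blast
    then have "fst (\<gamma> 1) = w" by (simp add: X_paths_def pathfinish_def)
    then show ?thesis using r(2)[OF \<gamma>, of 1] by simp
  qed
  have zw: "z = w" using close[of "norm (w - z)"] by (cases "z = w") auto
  have T: "\<alpha> \<in> tree_points E" "\<beta> \<in> tree_points E" using x y xy by (auto simp: X_space_def)
  have h: "theight E v0 \<alpha> = theight E v0 \<beta>" using x y xy zw by (auto simp: X_space_def)
  have eq: "\<beta> v = \<alpha> v" if v: "\<alpha> v \<noteq> 0" for v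
  proof -
    obtain r where r: "r > 0" "\<And>y \<gamma>. \<gamma> \<in> X_paths (z, \<alpha>) y \<Longrightarrow> hyp_length (fst \<circ> \<gamma>) < ennreal r \<Longrightarrow> snd y v \<noteq> 0"
      using coordinate_open[OF x[unfolded xy] v] by blast
    then have "\<beta> v \<noteq> 0" using short[OF r(1)] by fastforce
    then show ?thesis using coordinate_from_height(1)[OF T(1) that] coordinate_from_height(1)[OF T(2)] h by simp
  qed
  obtain v t where t: "0 < t" "t \<le> 1" "\<alpha> = edge_point E v t" using tree_points_cases[OF T(1)] .
  have "\<beta> u = 0" if "\<alpha> u = 0" for u
  proof (rule ccontr)
    assume "\<beta> u \<noteq> 0"
    let ?S = "{x. \<beta> x \<noteq> 0}"
    have sub: "{x. \<alpha> x \<noteq> 0} \<subseteq> ?S" using eq by auto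
    have sum: "(\<Sum>x\<in>?S. \<beta> x) = 1" "(\<Sum>x | \<alpha> x \<noteq> 0. \<alpha> x) = 1" using T by (auto simp: tree_points_def)
    have fin: "finite ?S" using sum(1) by (metis sum.infinite zero_neq_one)
    have "(\<Sum>x | \<alpha> x \<noteq> 0. \<alpha> x) = (\<Sum>x | \<alpha> x \<noteq> 0. \<beta> x)" using eq by (intro sum.cong) auto
    also have "\<dots> < (\<Sum>x\<in>?S. \<beta> x)"
      by (rule sum_strict_mono2[OF fin sub, of u])
        (use \<open>\<beta> u \<noteq> 0\<close> that coordinate_from_height(2)[OF T(2)] T(2) in \<open>auto simp: tree_points_def\<close>)
    finally show False using sum by simp
  qed
  then have "\<alpha> = \<beta>" using eq by (metis ext)
  then show ?thesis using xy zw by simp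
qed

text \<open>The facts about \<open>mtopology\<close>, through which \<open>X_topology\<close> is
  defined, become available with the metric axioms.\<close>

lemma Metric_space_X: "Metric_space X (X_dist n E v0)"
proof
  show "0 \<le> X_dist n E v0 x y" for x y by (simp add: X_dist_eq)
  have le: "(INF \<gamma>\<in>X_paths x y. hyp_length (fst \<circ> \<gamma>)) \<le> (INF \<gamma>\<in>X_paths y x. hyp_length (fst \<circ> \<gamma>))" for x y
  proof (rule INF_mono)
    fix \<gamma> assume p: "\<gamma> \<in> X_paths y x"
    show "\<exists>\<gamma>'\<in>X_paths x y. hyp_length (fst \<circ> \<gamma>') \<le> hyp_length (fst \<circ> \<gamma>)"
      using X_paths_reverse[OF p] by (intro bexI[of _ "reversepath \<gamma>"]) simp_all
  qed
  show "X_dist n E v0 x y = X_dist n E v0 y x" for x y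
    unfolding X_dist_eq using le[of x y] le[of y x] by simp
  show "X_dist n E v0 x y = 0 \<longleftrightarrow> x = y" if "x \<in> X" "y \<in> X" for x y
  proof
    assume "x = y"
    have "(\<lambda>t. x) \<in> X_paths x x"
    proof -
      have "fst \<circ> (\<lambda>t. x) = linepath (fst x) (fst x)" by (auto simp: linepath_def)
      then have "valid_path (fst \<circ> (\<lambda>t. x))" by (simp only: valid_path_linepath)
      then show ?thesis using that(1) by (auto simp: X_paths_def path_def path_image_def pathstart_def pathfinish_def)
    qed
    moreover have "hyp_length (fst \<circ> (\<lambda>t. x)) = 0" by (simp add: hyp_length_def o_def)
    ultimately have "X_dist n E v0 x x < r" if "r > 0" for r
      using X_dist_less_iff[OF \<open>x \<in> X\<close> \<open>x \<in> X\<close> that] that by force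
    then have "X_dist n E v0 x x \<le> 0" by (meson not_le order_less_irrefl)
    moreover have "0 \<le> X_dist n E v0 x x" by (simp add: X_dist_eq)
    ultimately show "X_dist n E v0 x y = 0" using \<open>x = y\<close> by simp
  qed (rule X_dist_zeroD[OF that])
  show "X_dist n E v0 x z \<le> X_dist n E v0 x y + X_dist n E v0 y z" if xyz: "x \<in> X" "y \<in> X" "z \<in> X" for x y z
  proof (rule field_le_epsilon)
    fix e :: real assume "e > 0"
    let ?r1 = "X_dist n E v0 x y + e / 2" and ?r2 = "X_dist n E v0 y z + e / 2"
    have pos: "?r1 > 0" "?r2 > 0" using \<open>e > 0\<close> by (simp_all add: X_dist_eq add_nonneg_pos)
    obtain \<gamma>1 where 1: "\<gamma>1 \<in> X_paths x y" "hyp_length (fst \<circ> \<gamma>1) < ennreal ?r1"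
      using X_dist_less_iff[OF xyz(1,2) pos(1)] \<open>e > 0\<close> by auto
    obtain \<gamma>2 where 2: "\<gamma>2 \<in> X_paths y z" "hyp_length (fst \<circ> \<gamma>2) < ennreal ?r2"
      using X_dist_less_iff[OF xyz(2,3) pos(2)] \<open>e > 0\<close> by auto
    have "hyp_length (fst \<circ> \<gamma>1) + hyp_length (fst \<circ> \<gamma>2) < ennreal ?r1 + ennreal ?r2"
      using 1(2) 2(2) by (rule add_strict_mono)
    also have "\<dots> = ennreal (?r1 + ?r2)" by (rule ennreal_plus[symmetric]) (use pos in auto)
    finally have "\<exists>\<gamma>\<in>X_paths x z. hyp_length (fst \<circ> \<gamma>) < ennreal (?r1 + ?r2)"
      using X_paths_join[OF 1(1) 2(1)] by (intro bexI[of _ "\<gamma>1 +++ \<gamma>2"]) simp_all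
    then have "X_dist n E v0 x z < ?r1 + ?r2"
      using X_dist_less_iff[OF xyz(1,3), of "?r1 + ?r2"] pos by auto
    then show "X_dist n E v0 x z \<le> X_dist n E v0 x y + X_dist n E v0 y z + e" by simp
  qed
qed

lemma openin_X_iff:
  "openin (X_topology n E v0) U \<longleftrightarrow> U \<subseteq> X \<and> (\<forall>x\<in>U. \<exists>r>0. \<forall>y\<in>X. X_dist n E v0 x y < r \<longrightarrow> y \<in> U)"
  unfolding X_topology_def Metric_space.openin_mtopology[OF Metric_space_X]
proof (rule conj_cong[OF refl])
  assume U: "U \<subseteq> X"
  have "Metric_space.mball X (X_dist n E v0) x r \<subseteq> U \<longleftrightarrow> (\<forall>y\<in>X. X_dist n E v0 x y < r \<longrightarrow> y \<in> U)"
    if "x \<in> U" for x r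
    unfolding subset_iff Metric_space.in_mball[OF Metric_space_X] using that U by blast
  then have "(\<exists>r>0. Metric_space.mball X (X_dist n E v0) x r \<subseteq> U) \<longleftrightarrow>
    (\<exists>r>0. \<forall>y\<in>X. X_dist n E v0 x y < r \<longrightarrow> y \<in> U)" if "x \<in> U" for x
    using that by simp
  then show "(\<forall>x. x \<in> U \<longrightarrow> (\<exists>r>0. Metric_space.mball X (X_dist n E v0) x r \<subseteq> U)) \<longleftrightarrow>
    (\<forall>x\<in>U. \<exists>r>0. \<forall>y\<in>X. X_dist n E v0 x y < r \<longrightarrow> y \<in> U)"
    by blast
qed

lemma openin_X_I:
  assumes "U \<subseteq> X" "\<And>x. x \<in> U \<Longrightarrow> \<exists>r>0. \<forall>y \<gamma>. \<gamma> \<in> X_paths x y \<longrightarrow> hyp_length (fst \<circ> \<gamma>) < ennreal r \<longrightarrow> y \<in> X \<longrightarrow> y \<in> U"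
  shows "openin (X_topology n E v0) U"
  unfolding openin_X_iff
proof (intro conjI ballI)
  fix x assume x: "x \<in> U"
  then obtain r where r: "r > 0" "\<And>y \<gamma>. \<gamma> \<in> X_paths x y \<Longrightarrow> hyp_length (fst \<circ> \<gamma>) < ennreal r \<Longrightarrow> y \<in> X \<Longrightarrow> y \<in> U"
    using assms(2) by blast
  then show "\<exists>r>0. \<forall>y\<in>X. X_dist n E v0 x y < r \<longrightarrow> y \<in> U"
    using X_dist_less_iff x assms(1) by (intro exI[of _ r]) blast
qed (rule assms(1))

lemma openin_X_coordinate: "openin (X_topology n E v0) {x \<in> X. snd x v \<noteq> 0}"
proof (rule openin_X_I)
  fix x assume "x \<in> {x \<in> X. snd x v \<noteq> 0}"
  then show "\<exists>r>0. \<forall>y \<gamma>. \<gamma> \<in> X_paths x y \<longrightarrow> hyp_length (fst \<circ> \<gamma>) < ennreal r \<longrightarrow> y \<in> X \<longrightarrow> y \<in> {x \<in> X. snd x v \<noteq> 0}"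
    using coordinate_open[of "fst x" "snd x" v] by auto
qed auto

lemma openin_X_fst: assumes "open V" shows "openin (X_topology n E v0) {x \<in> X. fst x \<in> V}"
proof (rule openin_X_I)
  fix x assume x: "x \<in> {x \<in> X. fst x \<in> V}"
  then obtain d where d: "d > 0" "\<And>w. dist w (fst x) < d \<Longrightarrow> w \<in> V" using assms by (auto simp: open_dist)
  obtain r where r: "r > 0" "\<And>y \<gamma> t. \<gamma> \<in> X_paths x y \<Longrightarrow> hyp_length (fst \<circ> \<gamma>) < ennreal r \<Longrightarrow> t \<in> {0..1} \<Longrightarrow>
      norm (fst (\<gamma> t) - fst x) < d"
    using short_X_path[of "fst x" "snd x" d] x d(1) by auto
  have "fst y \<in> V" if "\<gamma> \<in> X_paths x y" "hyp_length (fst \<circ> \<gamma>) < ennreal r" for y \<gamma>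
  proof -
    have "\<gamma> 1 = y" using that(1) by (simp add: X_paths_def pathfinish_def)
    then show ?thesis using r(2)[OF that, of 1] d(2) by (simp add: dist_norm)
  qed
  then show "\<exists>r>0. \<forall>y \<gamma>. \<gamma> \<in> X_paths x y \<longrightarrow> hyp_length (fst \<circ> \<gamma>) < ennreal r \<longrightarrow> y \<in> X \<longrightarrow> y \<in> {x \<in> X. fst x \<in> V}"
    using r(1) by auto
qed auto

text \<open>A point is compact, so the set is subbasic. The open sets of the group used for
  measurability are all obtained from such sets.\<close>

lemma openin_G_evaluation:
  assumes "x \<in> X" "openin (X_topology n E v0) U"
  shows "openin (G_topology n E v0) {p \<in> carrier G. act_X p x \<in> U}"
proof -
  have "compactin (X_topology n E v0) {x}"
    using assms(1) Metric_space.topspace_mtopology[OF Metric_space_X] by (simp add: X_topology_def)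
  moreover have "{p \<in> carrier G. act_X p x \<in> U} = {p \<in> carrier G. act_X p ` {x} \<subseteq> U}" by auto
  ultimately show ?thesis unfolding G_topology_def using assms(2)
    by (intro topology_generated_by_Basis) blast
qed

text \<open>A test point over \<open>u\<close>: its image under \<open>elt t g\<close> shows
  \<open>t\<close> as a real part and \<open>g u\<close> in the tree.\<close>

definition vertex_base :: "'v \<Rightarrow> complex \<times> ('v \<Rightarrow> real)" where
  "vertex_base u = (Complex 0 (real n powr of_int (ht u)), vertex_point u)"

lemma vertex_base_in: "vertex_base u \<in> X"
  by (simp add: vertex_base_def X_iff vertex_point_in theight_vertex_point)

lemma vertex_base_v0: "vertex_base v0 = (\<i>, vertex_point v0)"
  using n2 by (simp add: vertex_base_def ht_v0 complex_eq_iff)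

lemma act_vertex_base:
  assumes g: "aut g"
  shows "act_X (elt t g) (vertex_base u) = (Complex t (real n powr of_int (ht (g u))), vertex_point (g u))"
proof -
  have "scale g = real n powr of_int (shift g)" using n2 by (intro powr_real_of_int'[symmetric]) auto
  then have "scale g * real n powr of_int (ht u) = real n powr of_int (ht (g u))"
    by (simp add: ht_shift[OF g] powr_add)
  moreover have "hyp_affine c t (Complex 0 y) = Complex t (c * y)" if "y > 0" for c y
    using that by (simp add: hyp_affine_def upper_half_def complex_eq_iff)
  ultimately show ?thesis
    using n2 by (simp add: act_X_def vertex_base_def elt_def act_tree_vertex_point aut_bij[OF g])
qed

lemma act_vertex_base_in: assumes "p \<in> carrier G" shows "act_X p (vertex_base u) \<in> X"
proof -
  obtain t g where p: "p = elt t g" "aut g" using assms by (rule carrierE)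
  show ?thesis
    unfolding p(1) act_vertex_base[OF p(2)] by (simp add: X_iff vertex_point_in theight_vertex_point)
qed

text \<open>Vertices go to vertices, so the image is \<open>v\<close> as soon as its coordinate at
  \<open>v\<close> is nonzero, which is an open condition.\<close>

lemma openin_G_vertex: "openin (G_topology n E v0) {p \<in> carrier G. snd p u = v}"
proof -
  have "snd (act_X p (vertex_base u)) v \<noteq> 0 \<longleftrightarrow> snd p u = v" if p: "p \<in> carrier G" for p
  proof -
    obtain t g where pg: "p = elt t g" "aut g" using p by (rule carrierE)
    have "snd (act_X p (vertex_base u)) = vertex_point (g u)"
      unfolding pg(1) act_vertex_base[OF pg(2)] by simp
    moreover have "snd p = g" by (simp add: pg(1) elt_def)
    ultimately show ?thesis by (simp add: vertex_point_def)
  qed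
  then have "{p \<in> carrier G. snd p u = v} = {p \<in> carrier G. act_X p (vertex_base u) \<in> {x \<in> X. snd x v \<noteq> 0}}"
    using act_vertex_base_in by blast
  then show ?thesis using openin_G_evaluation[OF vertex_base_in openin_X_coordinate[of v]] by simp
qed

lemma openin_G_fst:
  assumes "open V" shows "openin (G_topology n E v0) {p \<in> carrier G. fst p \<i> \<in> V}"
proof -
  have "fst (act_X p (vertex_base v0)) = fst p \<i>" for p :: "'v isom" by (simp add: act_X_def vertex_base_v0)
  then have "{p \<in> carrier G. fst p \<i> \<in> V} = {p \<in> carrier G. act_X p (vertex_base v0) \<in> {x \<in> X. fst x \<in> V}}"
    using act_vertex_base_in by auto
  then show ?thesis using openin_G_evaluation[OF vertex_base_in openin_X_fst[OF assms]] by simp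
qed

end

section \<open>Invariant measures on coset spaces\<close>

text \<open>The predicate is on representatives; under \<open>left_invariant\<close> it becomes a
  property of the coset, see \<open>coset_mem_iff\<close>.\<close>

definition cosets_where :: "('g, 'm) monoid_scheme \<Rightarrow> 'g set \<Rightarrow> ('g \<Rightarrow> bool) \<Rightarrow> 'g set set" where
  "cosets_where G H P = (\<lambda>g. H #>\<^bsub>G\<^esub> g) ` {g \<in> carrier G. P g}"

definition left_invariant :: "('g, 'm) monoid_scheme \<Rightarrow> 'g set \<Rightarrow> ('g \<Rightarrow> bool) \<Rightarrow> bool" where
  "left_invariant G H P \<longleftrightarrow> (\<forall>h\<in>H. \<forall>g\<in>carrier G. P (h \<otimes>\<^bsub>G\<^esub> g) \<longleftrightarrow> P g)"

locale invariant_quotient = group G for G :: "('g, 'm) monoid_scheme" (structure) +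
  fixes \<tau> :: "'g topology" and H :: "'g set" and \<mu> :: "'g set measure"
  assumes sub: "subgroup H G"
    and space_mu: "space \<mu> = rcosets H"
    and sets_mu: "sets \<mu> = sigma_sets (rcosets H) {\<U>. \<U> \<subseteq> rcosets H \<and> openin \<tau> (\<Union>\<U>)}"
    and nonzero: "emeasure \<mu> (space \<mu>) \<noteq> 0"
    and finite_mu: "emeasure \<mu> (space \<mu>) \<noteq> \<infinity>"
    and translate: "\<And>g A. g \<in> carrier G \<Longrightarrow> A \<in> sets \<mu> \<Longrightarrow> emeasure \<mu> ((\<lambda>C. C #> g) ` A) = emeasure \<mu> A"

lemma finite_covolumeE:
  assumes "group G" "subgroup H G" "finite_covolume G \<tau> H"
  obtains \<mu> where "invariant_quotient G \<tau> H \<mu>"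
  using assms unfolding finite_covolume_def invariant_quotient_def invariant_quotient_axioms_def by blast

context invariant_quotient
begin

abbreviation Q where "Q \<equiv> cosets_where G H"

lemma H_carrier: "h \<in> H \<Longrightarrow> h \<in> carrier G"
  by (rule subgroup.mem_carrier[OF sub])

lemma coset_mem_iff:
  assumes "left_invariant G H P" "g \<in> carrier G" shows "H #> g \<in> Q P \<longleftrightarrow> P g"
proof
  assume "H #> g \<in> Q P"
  then obtain g' where g': "g' \<in> carrier G" "P g'" "H #> g = H #> g'" by (auto simp: cosets_where_def)
  have "g \<in> H #> g'" using rcos_self[OF assms(2) sub] g'(3) by simp
  then obtain h where "h \<in> H" "g = h \<otimes> g'" by (auto simp: r_coset_def)
  then show "P g" using assms(1) g' by (simp add: left_invariant_def)
qed (use assms in \<open>auto simp: cosets_where_def\<close>)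

lemma Q_subset: "Q P \<subseteq> rcosets H"
  by (auto simp: cosets_where_def RCOSETS_def)

lemma rcosetE: assumes "C \<in> rcosets H" obtains g where "g \<in> carrier G" "C = H #> g"
  using assms by (auto simp: RCOSETS_def)

lemma Q_eqI:
  assumes "A \<subseteq> rcosets H" "left_invariant G H P" "\<And>g. g \<in> carrier G \<Longrightarrow> H #> g \<in> A \<longleftrightarrow> P g"
  shows "A = Q P"
proof (intro equalityI subsetI)
  fix C assume "C \<in> A"
  then obtain g where "g \<in> carrier G" "C = H #> g" using assms(1) rcosetE by blast
  then show "C \<in> Q P" using \<open>C \<in> A\<close> coset_mem_iff[OF assms(2)] assms(3) by simp
next
  fix C assume "C \<in> Q P"
  then obtain g where "g \<in> carrier G" "C = H #> g" using Q_subset rcosetE by blast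
  then show "C \<in> A" using \<open>C \<in> Q P\<close> coset_mem_iff[OF assms(2)] assms(3) by simp
qed

lemma Q_open: assumes "left_invariant G H P" "openin \<tau> {g \<in> carrier G. P g}" shows "Q P \<in> sets \<mu>"
proof -
  have "\<Union>(Q P) = {g \<in> carrier G. P g}"
  proof (intro equalityI subsetI)
    fix x assume "x \<in> \<Union>(Q P)"
    then obtain g h where "g \<in> carrier G" "P g" "h \<in> H" "x = h \<otimes> g" by (auto simp: cosets_where_def r_coset_def)
    then show "x \<in> {g \<in> carrier G. P g}" using assms(1) H_carrier by (auto simp: left_invariant_def)
  next
    fix x assume "x \<in> {g \<in> carrier G. P g}"
    then show "x \<in> \<Union>(Q P)" using rcos_self[OF _ sub] by (auto simp: cosets_where_def)
  qed
  then show ?thesis unfolding sets_mu using assms(2) Q_subset by (intro sigma_sets.Basic) auto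
qed

text \<open>Invariance of the measure in the form used below: in a condition on \<open>g\<close>,
  the argument may be multiplied on the right by any \<open>h\<close>.\<close>

lemma Q_translate:
  assumes P: "left_invariant G H P" and "Q P \<in> sets \<mu>" and h: "h \<in> carrier G"
  shows "emeasure \<mu> (Q (\<lambda>g. P (g \<otimes> h))) = emeasure \<mu> (Q P)"
proof -
  have "(\<lambda>C. C #> inv h) ` Q P = Q (\<lambda>g. P (g \<otimes> h))"
  proof (intro equalityI subsetI)
    fix C assume "C \<in> (\<lambda>C. C #> inv h) ` Q P"
    then obtain g where g: "g \<in> carrier G" "P g" "C = (H #> g) #> inv h" by (auto simp: cosets_where_def)
    have "C = H #> (g \<otimes> inv h)" using g h subgroup.subset[OF sub] by (simp add: coset_mult_assoc)
    moreover have "P (g \<otimes> inv h \<otimes> h)" using g h by (simp add: m_assoc)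
    ultimately show "C \<in> Q (\<lambda>g. P (g \<otimes> h))" using g h by (auto simp: cosets_where_def)
  next
    fix C assume "C \<in> Q (\<lambda>g. P (g \<otimes> h))"
    then obtain g where g: "g \<in> carrier G" "P (g \<otimes> h)" "C = H #> g" by (auto simp: cosets_where_def)
    have "(H #> (g \<otimes> h)) #> inv h = C" using g h subgroup.subset[OF sub] by (simp add: coset_mult_assoc m_assoc)
    then show "C \<in> (\<lambda>C. C #> inv h) ` Q P" using g h
      by (intro image_eqI[of _ _ "H #> (g \<otimes> h)"]) (auto simp: cosets_where_def)
  qed
  then show ?thesis using translate[OF inv_closed[OF h] assms(2)] by simp
qed

lemma finite_measure_mu: "finite_measure \<mu>"
  by (rule finite_measureI) (rule finite_mu)

text \<open>The level sets of \<open>\<phi>\<close> partition the coset space into pieces indexed by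
  the integers and shifted by right translation. They have equal measure, so finiteness forces
  measure 0 on each and on the whole space.\<close>

lemma no_integer_cocycle:
  fixes \<phi> :: "'g \<Rightarrow> int"
  assumes inv: "\<And>k g. k \<in> H \<Longrightarrow> g \<in> carrier G \<Longrightarrow> \<phi> (k \<otimes> g) = \<phi> g"
    and meas: "\<And>i. Q (\<lambda>g. \<phi> g = i) \<in> sets \<mu>"
    and h: "h \<in> carrier G" "\<And>g. g \<in> carrier G \<Longrightarrow> \<phi> (g \<otimes> h) = \<phi> g + 1"
  shows False
proof -
  have li: "left_invariant G H (\<lambda>g. \<phi> g = i)" for i using inv by (simp add: left_invariant_def)
  interpret finite_measure \<mu> by (rule finite_measure_mu)
  let ?A = "\<lambda>i. Q (\<lambda>g. \<phi> g = i)"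
  have shift: "measure \<mu> (?A (i + 1)) = measure \<mu> (?A i)" for i
  proof -
    have "Q (\<lambda>g. \<phi> (g \<otimes> h) = i + 1) = ?A i" by (auto simp: cosets_where_def h(2))
    then show ?thesis using Q_translate[OF li[of "i + 1"] meas h(1)] by (simp add: measure_def)
  qed
  have c: "measure \<mu> (?A i) = measure \<mu> (?A 0)" for i
  proof (induction i rule: int_induct[of _ 0])
    case (step1 i) then show ?case using shift[of i] by simp
  next
    case (step2 i) then show ?case using shift[of "i - 1"] by simp
  qed simp
  have disj: "disjoint_family ?A"
    unfolding disjoint_family_on_def
  proof (intro ballI impI)
    fix i j :: int assume "i \<noteq> j"
    show "?A i \<inter> ?A j = {}"
    proof (rule ccontr)
      assume "?A i \<inter> ?A j \<noteq> {}"
      then obtain C where C: "C \<in> ?A i" "C \<in> ?A j" by blast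
      then obtain g where "g \<in> carrier G" "C = H #> g" using Q_subset rcosetE by blast
      then show False using C coset_mem_iff[OF li] \<open>i \<noteq> j\<close> by simp
    qed
  qed
  have "real N * measure \<mu> (?A 0) \<le> measure \<mu> (space \<mu>)" for N
  proof -
    have "(\<Sum>i<N. measure \<mu> (?A (int i))) = measure \<mu> (\<Union>i<N. ?A (int i))"
      using disj meas by (intro finite_measure_finite_Union[symmetric]) (auto simp: disjoint_family_on_def)
    also have "\<dots> \<le> measure \<mu> (space \<mu>)"
      using meas sets.sets_into_space by (intro finite_measure_mono) auto
    finally show ?thesis by (simp add: c[of "int _"])
  qed
  then have "measure \<mu> (?A 0) = 0"
    by (metis measure_nonneg not_le order_le_less reals_Archimedean3 mult.commute)
  then have "measure \<mu> (?A i) = 0" for i using c[of i] by simp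
  then have "?A i \<in> null_sets \<mu>" for i using meas by (simp add: null_sets_def emeasure_eq_measure)
  then have "(\<Union>i. ?A i) \<in> null_sets \<mu>" by (intro null_sets_UN) auto
  moreover have "(\<Union>i. ?A i) = space \<mu>"
    unfolding space_mu by (auto simp: cosets_where_def RCOSETS_def)
  ultimately show False using nonzero by (simp add: null_sets_def)
qed

end

section \<open>Consequences of an invariant finite measure on the cosets in
  \<open>G_n\<close>\<close>

context standard_tree
begin

lemma shift_b: "shift b = 1"
proof -
  have "ht (par (b v0)) = ht (b v0) - 1" by (rule ht_par)
  then show ?thesis by (simp add: par_b_v0 ht_v0 shift_def)
qed

lemma elt_b: "elt 0 b \<in> carrier G"
  by (rule elt_carrier[OF aut_b])

lemma snd_mult_G: "p \<in> carrier G \<Longrightarrow> q \<in> carrier G \<Longrightarrow> snd (p \<otimes>\<^bsub>G\<^esub> q) = snd p \<circ> snd q"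
  by (elim carrierE) (simp add: mult_G, simp add: elt_def)

lemma snd_inv_G: "p \<in> carrier G \<Longrightarrow> snd (inv\<^bsub>G\<^esub> p) = inv_into UNIV (snd p)"
  by (elim carrierE) (simp add: inv_G, simp add: elt_def)

lemma aut_snd: "p \<in> carrier G \<Longrightarrow> aut (snd p)"
  by (elim carrierE) (simp add: elt_def)

lemma openin_G_vertices: "openin (G_topology n E v0) {p \<in> carrier G. snd p u \<in> W}"
proof -
  have "{p \<in> carrier G. snd p u \<in> W} = (\<Union>v\<in>W. {p \<in> carrier G. snd p u = v})" by auto
  then show ?thesis using openin_G_vertex by (metis (no_types, lifting) imageE openin_Union)
qed

context
  fixes \<Gamma> \<mu>
  assumes quot: "invariant_quotient G (G_topology n E v0) \<Gamma> \<mu>"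
begin

interpretation invariant_quotient G "G_topology n E v0" \<Gamma> \<mu> by (rule quot)

text \<open>If heights were preserved, the height of \<open>g v0\<close> would depend only on the
  coset of \<open>g\<close>, while right multiplication by the standard \<open>b\<close> raises it
  by 1.\<close>

lemma some_nonzero_shift: "\<exists>p\<in>\<Gamma>. shift (snd p) \<noteq> 0"
proof (rule ccontr)
  assume *: "\<not> ?thesis"
  have inv: "ht (snd (k \<otimes>\<^bsub>G\<^esub> g) v0) = ht (snd g v0)" if "k \<in> \<Gamma>" "g \<in> carrier G" for k g
    using that * H_carrier by (simp add: snd_mult_G ht_shift aut_snd)
  show False
  proof (rule no_integer_cocycle[of "\<lambda>p. ht (snd p v0)" "elt 0 b"])
    fix i
    have "left_invariant G \<Gamma> (\<lambda>g. ht (snd g v0) = i)" using inv by (simp add: left_invariant_def)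
    then show "Q (\<lambda>g. ht (snd g v0) = i) \<in> sets \<mu>"
      by (rule Q_open) (use openin_G_vertices[of v0 "{v. ht v = i}"] in simp)
  next
    fix g assume g: "g \<in> carrier G"
    then show "ht (snd (g \<otimes>\<^bsub>G\<^esub> elt 0 b) v0) = ht (snd g v0) + 1"
      using shift_b ht_v0 ht_shift[OF aut_snd[OF g]] ht_shift[OF aut_b, of v0]
      by (simp add: snd_mult_G elt_b) (simp add: elt_def)
  qed (use inv elt_b in auto)
qed

text \<open>Were all of \<open>\<Gamma>\<close> to fix a boundary point \<open>t0\<close>, the coset \<open>\<Gamma> g\<close> would determine the real number
  \<open>g\<^sup>-\<^sup>1 t0\<close>, on which translations act without finite invariant measure.\<close>

lemma no_boundary_fixed_point: "\<exists>t g. elt t g \<in> \<Gamma> \<and> aut g \<and> scale g * t0 + t \<noteq> t0"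
proof (rule ccontr)
  assume *: "\<not> ?thesis"
  \<comment> \<open>\<open>\<psi> p\<close> is the preimage of \<open>t0\<close> under the boundary
    action of \<open>p\<close>, read off from \<open>p \<i> = scale g * \<i> + t\<close>.\<close>
  define \<psi> where "\<psi> p = (t0 - Re (fst p \<i>)) / Im (fst p \<i>)" for p :: "'v isom"
  have \<psi>: "\<psi> (elt t g) = (t0 - t) / scale g" for t g
  proof -
    have "fst (elt t g) \<i> = of_real (scale g) * \<i> + of_real t" by (simp add: elt_def hyp_affine_def upper_half_def)
    moreover have "Re (of_real c * \<i> + of_real t) = t" "Im (of_real c * \<i> + of_real t) = c" for c by simp_all
    ultimately show ?thesis by (simp only: \<psi>_def)
  qed
  have inv: "\<psi> (k \<otimes>\<^bsub>G\<^esub> p) = \<psi> p" if k: "k \<in> \<Gamma>" and p: "p \<in> carrier G" for k p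
  proof -
    obtain t g where k': "k = elt t g" "aut g" using carrierE[OF H_carrier[OF k]] .
    obtain t' g' where p': "p = elt t' g'" "aut g'" using carrierE[OF p] .
    have "scale g * t0 + t = t0" using * k k' by blast
    then have 1: "t0 - (scale g * t' + t) = scale g * (t0 - t')" by (simp add: algebra_simps)
    have 2: "scale (g \<circ> g') = scale g * scale g'" using n2 by (simp add: shift_comp k' p' power_int_add)
    have "scale g \<noteq> 0" using scale_pos[of g] by linarith
    then show ?thesis
      unfolding k'(1) p'(1) mult_G[OF k'(2) p'(2)] \<psi> 1 2 by (rule mult_divide_mult_cancel_left)
  qed
  have less: "Q (\<lambda>p. \<psi> p < c) \<in> sets \<mu>" for c
  proof (rule Q_open)
    show "left_invariant G \<Gamma> (\<lambda>p. \<psi> p < c)" using inv by (simp add: left_invariant_def)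
    have "{p \<in> carrier G. \<psi> p < c} = {p \<in> carrier G. fst p \<i> \<in> {z. t0 - Re z < c * Im z}}"
    proof -
      have "\<psi> p < c \<longleftrightarrow> t0 - Re (fst p \<i>) < c * Im (fst p \<i>)" if p: "p \<in> carrier G" for p
      proof -
        obtain t g where "p = elt t g" using carrierE[OF p] by blast
        then have "Im (fst p \<i>) = scale g"
          using hyp_affine_Im[of \<i> "scale g" t] by (simp add: elt_def upper_half_def)
        then have "Im (fst p \<i>) > 0" using scale_pos[of g] by linarith
        then show ?thesis by (simp add: \<psi>_def field_simps)
      qed
      then show ?thesis by auto
    qed
    moreover have "open {z. t0 - Re z < c * Im z}" by (intro open_Collect_less continuous_intros)
    ultimately show "openin (G_topology n E v0) {p \<in> carrier G. \<psi> p < c}" by (simp only: openin_G_fst)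
  qed
  show False
  \<comment> \<open>Right multiplication by the translation by \<open>-1\<close> adds 1 to this
    preimage, so its integer part has the required behaviour.\<close>
  proof (rule no_integer_cocycle[of "\<lambda>p. \<lfloor>\<psi> p\<rfloor>" "elt (-1) id"])
    fix i
    have "Q (\<lambda>p. \<psi> p < of_int i + 1) - Q (\<lambda>p. \<psi> p < of_int i) = Q (\<lambda>p. \<lfloor>\<psi> p\<rfloor> = i)"
    proof (rule Q_eqI)
      show "left_invariant G \<Gamma> (\<lambda>p. \<lfloor>\<psi> p\<rfloor> = i)" using inv by (simp add: left_invariant_def)
      fix p assume p: "p \<in> carrier G"
      have "left_invariant G \<Gamma> (\<lambda>p. \<psi> p < c)" for c using inv by (simp add: left_invariant_def)
      then show "\<Gamma> #>\<^bsub>G\<^esub> p \<in> Q (\<lambda>p. \<psi> p < of_int i + 1) - Q (\<lambda>p. \<psi> p < of_int i) \<longleftrightarrow> \<lfloor>\<psi> p\<rfloor> = i"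
        using p by (simp add: coset_mem_iff) linarith
    qed (use Q_subset in blast)
    then show "Q (\<lambda>p. \<lfloor>\<psi> p\<rfloor> = i) \<in> sets \<mu>" using less by (metis sets.Diff)
  next
    fix p assume "p \<in> carrier G"
    then obtain t g where p: "p = elt t g" "aut g" by (rule carrierE)
    have "\<psi> (p \<otimes>\<^bsub>G\<^esub> elt (-1) id) = \<psi> p + 1"
    proof -
      have "(t0 - (c * -1 + t)) / c = (t0 - t) / c + 1" if "c > 0" for c using that by (simp add: field_simps)
      then show ?thesis unfolding p(1) mult_G[OF p(2) aut_id(1)] \<psi> comp_id using scale_pos by blast
    qed
    then show "\<lfloor>\<psi> (p \<otimes>\<^bsub>G\<^esub> elt (-1) id)\<rfloor> = \<lfloor>\<psi> p\<rfloor> + 1" by simp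
  qed (use inv elt_carrier aut_id in auto)
qed

text \<open>The measure on cosets induces a weight on stable sets of vertices. By
  \<open>vertex_weight_translate\<close>, replacing \<open>v0\<close> by an image of it under the
  group does not change the weight.\<close>

definition vertex_weight :: "'v set \<Rightarrow> real" where
  "vertex_weight W = measure \<mu> (Q (\<lambda>p. snd p v0 \<in> W))"

definition stable :: "'v set \<Rightarrow> bool" where
  "stable W \<longleftrightarrow> (\<forall>p\<in>\<Gamma>. \<forall>v. snd p v \<in> W \<longleftrightarrow> v \<in> W)"

lemma stable_left_invariant: "stable W \<Longrightarrow> left_invariant G \<Gamma> (\<lambda>p. snd p v \<in> W)"
  using H_carrier by (auto simp: stable_def left_invariant_def snd_mult_G)

lemma stable_sets: "stable W \<Longrightarrow> Q (\<lambda>p. snd p v \<in> W) \<in> sets \<mu>"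
  by (rule Q_open[OF stable_left_invariant openin_G_vertices])

lemma vertex_weight_translate:
  assumes "stable W" "h \<in> carrier G"
  shows "emeasure \<mu> (Q (\<lambda>p. snd p (snd h v0) \<in> W)) = emeasure \<mu> (Q (\<lambda>p. snd p v0 \<in> W))"
proof -
  have "Q (\<lambda>p. snd p (snd h v0) \<in> W) = Q (\<lambda>p. snd (p \<otimes>\<^bsub>G\<^esub> h) v0 \<in> W)"
    using assms(2) by (auto simp: cosets_where_def snd_mult_G)
  then show ?thesis using Q_translate[OF stable_left_invariant[OF assms(1)] stable_sets[OF assms(1)] assms(2)] by simp
qed

text \<open>Automorphisms commute with \<open>par\<close>, so taking the preimage of
  \<open>W\<close> under \<open>par\<close> means moving the base vertex to \<open>par v0\<close>,
  the image of \<open>v0\<close> under the inverse of \<open>b\<close>.\<close>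

lemma vertex_weight_par: assumes "stable W" shows "vertex_weight {v. (par ^^ k) v \<in> W} = vertex_weight W"
  using assms
proof (induction k arbitrary: W)
  case (Suc k)
  have st: "stable {v. par v \<in> W}"
    using Suc.prems H_carrier aut_par[OF aut_snd] by (simp add: stable_def flip: aut_par[OF aut_snd])
  have "inv_into UNIV b v0 = par v0"
    using aut_inv_cancel(2)[OF aut_b, of "par v0"] aut_par[OF aut_b, of v0] par_b_v0 by simp
  then have h: "snd (inv\<^bsub>G\<^esub> (elt 0 b)) v0 = par v0" using snd_inv_G[OF elt_b] by (simp add: elt_def)
  have "vertex_weight {v. (par ^^ k) v \<in> {v. par v \<in> W}} = vertex_weight {v. par v \<in> W}" by (rule Suc.IH[OF st])
  also have "\<dots> = measure \<mu> (Q (\<lambda>p. snd p (par v0) \<in> W))"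
  proof -
    have "Q (\<lambda>p. snd p v0 \<in> {v. par v \<in> W}) = Q (\<lambda>p. snd p (par v0) \<in> W)"
      using aut_par[OF aut_snd] by (auto simp: cosets_where_def)
    then show ?thesis by (simp add: vertex_weight_def)
  qed
  also have "\<dots> = vertex_weight W"
    using vertex_weight_translate[OF Suc.prems group.inv_closed[OF group_G elt_b]] h
    by (simp add: vertex_weight_def measure_def)
  finally show ?case by simp
qed simp

text \<open>By \<open>frame_coords\<close> the countably many elements \<open>b^-i a^p b^k\<close>
  carry \<open>v0\<close> to every vertex. Were the weight 0, countably many null sets would cover
  the coset space.\<close>

lemma vertex_weight_pos: assumes "stable W" "y \<in> W" shows "vertex_weight W > 0"
proof (rule ccontr)
  assume "\<not> vertex_weight W > 0"
  interpret finite_measure \<mu> by (rule finite_measure_mu)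
  have 0: "emeasure \<mu> (Q (\<lambda>p. snd p v0 \<in> W)) = 0"
    using \<open>\<not> vertex_weight W > 0\<close> measure_nonneg[of \<mu>] by (simp add: vertex_weight_def emeasure_eq_measure not_less antisym)
  define h where "h = (\<lambda>(i, p, k). elt 0 (inv_into UNIV (b ^^ i) \<circ> (a ^^ p) \<circ> (b ^^ k)))"
  have h: "h x \<in> carrier G" for x
    by (cases x) (auto simp: h_def intro!: elt_carrier aut_comp aut_inv aut_funpow aut_a aut_b)
  have "Q (\<lambda>p. snd p (snd (h x) v0) \<in> W) \<in> null_sets \<mu>" for x
  proof -
    have "Q (\<lambda>p. snd p (snd (h x) v0) \<in> W) \<in> sets \<mu>" by (rule stable_sets[OF assms(1)])
    then show ?thesis using vertex_weight_translate[OF assms(1) h[of x]] 0 by (simp add: null_sets_def)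
  qed
  then have "(\<Union>x. Q (\<lambda>p. snd p (snd (h x) v0) \<in> W)) \<in> null_sets \<mu>" by (intro null_sets_UN) auto
  moreover have "(\<Union>x. Q (\<lambda>p. snd p (snd (h x) v0) \<in> W)) = space \<mu>"
    unfolding space_mu
  proof (intro equalityI subsetI)
    fix C assume "C \<in> rcosets\<^bsub>G\<^esub> \<Gamma>"
    then obtain p where p: "p \<in> carrier G" "C = \<Gamma> #>\<^bsub>G\<^esub> p" by (rule rcosetE)
    define w where "w = inv_into UNIV (snd p) y"
    have w: "snd p w = y" using aut_inv_cancel(1)[OF aut_snd[OF p(1)]] by (simp add: w_def)
    obtain i q k where iqk: "(b ^^ i) w = (a ^^ q) ((axis_step 1 b ^^ k) v0)"
      using frame_coords[OF frame_standard] by blast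
    have "axis_step 1 b = b" by (auto simp: axis_step_def)
    then have e: "(a ^^ q) ((b ^^ k) v0) = (b ^^ i) w" using iqk by simp
    have "snd (h (i, q, k)) v0 = w"
      by (simp add: h_def elt_def e aut_inv_cancel(2)[OF aut_funpow[OF aut_b]])
    then have "C \<in> Q (\<lambda>p. snd p (snd (h (i, q, k)) v0) \<in> W)"
      using p w assms(2) by (auto simp: cosets_where_def)
    then show "C \<in> (\<Union>x. Q (\<lambda>p. snd p (snd (h x) v0) \<in> W))" by blast
  qed (use Q_subset in blast)
  ultimately show False using nonzero by (simp add: null_sets_def)
qed

definition orbit_of :: "'v \<Rightarrow> 'v set" where
  "orbit_of y = (\<lambda>p. snd p y) ` \<Gamma>"

lemma orbit_of_self: "y \<in> orbit_of y"
proof -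
  have "snd \<one>\<^bsub>G\<^esub> y = y" by (simp add: one_G elt_def)
  then show ?thesis unfolding orbit_of_def using subgroup.one_closed[OF sub] by (metis image_eqI)
qed

lemma orbit_of_closed: assumes "v \<in> orbit_of y" "p \<in> \<Gamma>" shows "snd p v \<in> orbit_of y"
proof -
  obtain q where q: "q \<in> \<Gamma>" "v = snd q y" using assms(1) by (auto simp: orbit_of_def)
  have "snd p v = snd (p \<otimes>\<^bsub>G\<^esub> q) y"
    unfolding q(2) snd_mult_G[OF H_carrier[OF assms(2)] H_carrier[OF q(1)]] by simp
  then show ?thesis unfolding orbit_of_def using subgroup.m_closed[OF sub assms(2) q(1)] by blast
qed

lemma orbit_of_stable: "stable (orbit_of y)"
  unfolding stable_def
proof (intro ballI allI iffI)
  fix p v assume p: "p \<in> \<Gamma>" and "snd p v \<in> orbit_of y"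
  then have "snd (inv\<^bsub>G\<^esub> p) (snd p v) \<in> orbit_of y" using subgroup.m_inv_closed[OF sub] orbit_of_closed by blast
  then show "v \<in> orbit_of y"
    using H_carrier[OF p] by (simp add: snd_inv_G aut_inv_cancel(2)[OF aut_snd])
qed (rule orbit_of_closed)

lemma orbit_of_subset: "stable W \<Longrightarrow> y \<in> W \<Longrightarrow> orbit_of y \<subseteq> W"
  by (auto simp: stable_def orbit_of_def)

lemma orbit_of_eq: assumes "orbit_of v \<inter> orbit_of w \<noteq> {}" shows "orbit_of v = orbit_of w"
proof -
  obtain p q where pq: "p \<in> \<Gamma>" "q \<in> \<Gamma>" "snd p v = snd q w" using assms by (auto simp: orbit_of_def)
  have "v \<in> orbit_of w" "w \<in> orbit_of v"
    using orbit_of_stable pq orbit_of_closed[OF orbit_of_self] unfolding stable_def by metis+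
  then show ?thesis using orbit_of_subset orbit_of_stable by blast
qed

lemma vertex_weight_mono_disjoint:
  assumes "stable V" "stable W" "stable C" "V \<subseteq> C" "W \<subseteq> C" "V \<inter> W = {}"
  shows "vertex_weight V + vertex_weight W \<le> vertex_weight C"
proof -
  interpret finite_measure \<mu> by (rule finite_measure_mu)
  let ?A = "\<lambda>W. Q (\<lambda>p. snd p v0 \<in> W)"
  have "?A V \<inter> ?A W = {}"
  proof (rule ccontr)
    assume "?A V \<inter> ?A W \<noteq> {}"
    then obtain D where D: "D \<in> ?A V" "D \<in> ?A W" by blast
    then obtain g where "g \<in> carrier G" "D = \<Gamma> #>\<^bsub>G\<^esub> g" using Q_subset rcosetE by blast
    then show False using D coset_mem_iff[OF stable_left_invariant] assms by blast
  qed
  then have "vertex_weight V + vertex_weight W = measure \<mu> (?A V \<union> ?A W)"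
    unfolding vertex_weight_def using stable_sets assms by (intro finite_measure_Union[symmetric]) auto
  also have "\<dots> \<le> vertex_weight C"
    unfolding vertex_weight_def
    using stable_sets[OF assms(3)] assms(4,5) by (intro finite_measure_mono) (auto simp: cosets_where_def)
  finally show ?thesis .
qed

text \<open>The orbits of the ancestors \<open>par\<^sup>j\<^sup>l y\<close> lie in the height class \<open>C\<close> of \<open>y\<close> modulo \<open>l\<close>, and their
  weights tend to that of \<open>C\<close>, because any two vertices have a common ancestor. As every orbit in \<open>C\<close>
  has positive weight, it contains such an ancestor for all large \<open>j\<close>, so \<open>C\<close> is a single orbit.\<close>

lemma transitive_on_heights:
  assumes B: "B \<in> \<Gamma>" "shift (snd B) = int l" and sh: "\<And>p. p \<in> \<Gamma> \<Longrightarrow> int l dvd shift (snd p)" and l: "l \<ge> 1"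
    and hyw: "ht y = ht w"
  shows "\<exists>p\<in>\<Gamma>. snd p y = w"
proof -
  interpret finite_measure \<mu> by (rule finite_measure_mu)
  define C where "C = {v. int l dvd ht v - ht y}"
  have C: "stable C" unfolding stable_def
  proof (intro ballI allI)
    fix p v assume p: "p \<in> \<Gamma>"
    have e: "ht (snd p v) - ht y = (ht v - ht y) + shift (snd p)" by (simp add: ht_shift[OF aut_snd[OF H_carrier[OF p]]])
    show "snd p v \<in> C \<longleftrightarrow> v \<in> C" unfolding C_def mem_Collect_eq e by (rule dvd_add_left_iff[OF sh[OF p]])
  qed
  have shifts: "\<exists>p\<in>\<Gamma>. shift (snd p) = int l * e" for e
  proof -
    have nat: "\<exists>p\<in>\<Gamma>. shift (snd p) = int l * int k" for k
    proof (induction k)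
      case 0
      have "shift (snd \<one>\<^bsub>G\<^esub>) = 0" unfolding one_G elt_def snd_conv by (rule shift_id)
      then show ?case using subgroup.one_closed[OF sub] by (intro bexI[of _ "\<one>\<^bsub>G\<^esub>"]) simp_all
    next
      case (Suc k)
      then obtain p where p: "p \<in> \<Gamma>" "shift (snd p) = int l * int k" by blast
      then have "shift (snd (B \<otimes>\<^bsub>G\<^esub> p)) = int l * int (Suc k)"
        using B H_carrier by (simp add: snd_mult_G shift_comp aut_snd distrib_left)
      then show ?case using subgroup.m_closed[OF sub B(1) p(1)] by blast
    qed
    show ?thesis
    proof (cases "e \<ge> 0")
      case True then show ?thesis using nat[of "nat e"] by simp
    next
      case False
      obtain p where p: "p \<in> \<Gamma>" "shift (snd p) = int l * int (nat (- e))" using nat by blast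
      then have "shift (snd (inv\<^bsub>G\<^esub> p)) = int l * e"
        using False H_carrier by (simp add: snd_inv_G shift_inv aut_snd)
      then show ?thesis using subgroup.m_inv_closed[OF sub p(1)] by blast
    qed
  qed
  define orb where "orb j = orbit_of ((par ^^ (j * l)) y)" for j
  \<comment> \<open>\<open>D j\<close> has the weight of \<open>orb j\<close> by
    \<open>vertex_weight_par\<close>, and unlike these orbits the sets \<open>D j\<close> increase,
    with union \<open>C\<close>.\<close>
  define D where "D j = {v. (par ^^ (j * l)) v \<in> orb j}" for j
  have oC: "orb j \<subseteq> C" for j
    unfolding orb_def by (rule orbit_of_subset[OF C]) (simp add: C_def ht_par_pow)
  have Dst: "stable (D j)" for j
    using orbit_of_stable[of "(par ^^ (j * l)) y"] H_carrier
    by (auto simp: stable_def D_def orb_def aut_par_pow[OF aut_snd, symmetric])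
  have Dinc: "incseq D"
  proof (rule incseq_SucI, rule subsetI)
    fix j v assume "v \<in> D j"
    then obtain p where p: "p \<in> \<Gamma>" "(par ^^ (j * l)) v = snd p ((par ^^ (j * l)) y)" by (auto simp: D_def orb_def orbit_of_def)
    then have "(par ^^ (Suc j * l)) v = snd p ((par ^^ (Suc j * l)) y)"
      by (simp add: funpow_add_apply aut_par_pow[OF aut_snd[OF H_carrier[OF p(1)]]])
    then show "v \<in> D (Suc j)" using p(1) unfolding D_def orb_def orbit_of_def by blast
  qed
  have Dunion: "(\<Union>j. D j) = C"
  proof (intro equalityI subsetI)
    fix v assume "v \<in> (\<Union>j. D j)"
    then obtain j where "(par ^^ (j * l)) v \<in> C" using oC by (auto simp: D_def)
    then have "int l dvd (ht v - ht y) - int j * int l" by (simp add: C_def ht_par_pow algebra_simps)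
    from dvd_add[OF this, of "int j * int l"] show "v \<in> C" by (simp add: C_def)
  next
    fix v assume "v \<in> C"
    then obtain e where e: "ht v - ht y = int l * e" by (auto simp: C_def dvd_def)
    \<comment> \<open>Once \<open>v\<close> is moved to the height of \<open>y\<close>, the two have
      the same ancestor \<open>k\<close> steps down, hence also \<open>k * l\<close> steps
      down.\<close>
    obtain p where p: "p \<in> \<Gamma>" "shift (snd p) = int l * (- e)" using shifts by blast
    have "ht (snd p v) = ht y" using e p(2) by (simp add: ht_shift[OF aut_snd[OF H_carrier[OF p(1)]]])
    then obtain k where "(par ^^ k) (snd p v) = (par ^^ k) y" by (rule common_ancestor_same)
    moreover have "k \<le> k * l" using l by simp
    ultimately have "(par ^^ (k * l)) (snd p v) = (par ^^ (k * l)) y" by (rule par_pow_mono)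
    then have "snd p ((par ^^ (k * l)) v) = (par ^^ (k * l)) y"
      by (simp add: aut_par_pow[OF aut_snd[OF H_carrier[OF p(1)]]])
    then have "snd p ((par ^^ (k * l)) v) \<in> orb k" using orbit_of_self by (simp add: orb_def)
    then have "(par ^^ (k * l)) v \<in> orb k" using orbit_of_stable p(1) unfolding orb_def stable_def by blast
    then show "v \<in> (\<Union>j. D j)" by (auto simp: D_def)
  qed
  have "(\<lambda>j. measure \<mu> (Q (\<lambda>p. snd p v0 \<in> D j))) \<longlonglongrightarrow> measure \<mu> (\<Union>j. Q (\<lambda>p. snd p v0 \<in> D j))"
  proof (rule finite_Lim_measure_incseq)
    show "range (\<lambda>j. Q (\<lambda>p. snd p v0 \<in> D j)) \<subseteq> sets \<mu>" using stable_sets[OF Dst] by auto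
    show "incseq (\<lambda>j. Q (\<lambda>p. snd p v0 \<in> D j))" using Dinc by (auto simp: incseq_def cosets_where_def)
  qed
  moreover have "(\<Union>j. Q (\<lambda>p. snd p v0 \<in> D j)) = Q (\<lambda>p. snd p v0 \<in> C)"
    unfolding Dunion[symmetric] by (auto simp: cosets_where_def)
  moreover have "vertex_weight (D j) = vertex_weight (orb j)" for j
    unfolding D_def orb_def by (rule vertex_weight_par[OF orbit_of_stable])
  ultimately have lim: "(\<lambda>j. vertex_weight (orb j)) \<longlonglongrightarrow> vertex_weight C"
    by (simp add: vertex_weight_def)
  have "\<forall>\<^sub>F j in sequentially. orb j = orbit_of v" if v: "v \<in> C" for v
  proof -
    \<comment> \<open>An orbit \<open>orb j\<close> disjoint from that of \<open>v\<close> could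
      have at most this weight.\<close>
    have "vertex_weight C - vertex_weight (orbit_of v) < vertex_weight C"
      using vertex_weight_pos[OF orbit_of_stable orbit_of_self] by simp
    from order_tendstoD(1)[OF lim this] show ?thesis
    proof eventually_elim
      case (elim j)
      have "orb j \<inter> orbit_of v \<noteq> {}"
        using vertex_weight_mono_disjoint[OF _ orbit_of_stable C oC orbit_of_subset[OF C v], of j] orbit_of_stable elim
        by (auto simp: orb_def)
      then show ?case unfolding orb_def by (rule orbit_of_eq)
    qed
  qed
  moreover have "y \<in> C" "w \<in> C" using hyw by (auto simp: C_def)
  ultimately have "\<forall>\<^sub>F j in sequentially. orb j = orbit_of y \<and> orb j = orbit_of w" by (simp add: eventually_conj_iff)
  then obtain j where "orb j = orbit_of y" "orb j = orbit_of w" by (auto simp: eventually_sequentially)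
  then have "w \<in> orbit_of y" by (metis orbit_of_self)
  then show ?thesis by (auto simp: orbit_of_def)
qed

end

end

section \<open>Homomorphisms from BS\<close>

lemma hom_presented_word_eval:
  assumes G: "group G" and \<psi>: "\<psi> \<in> hom (presented_group R) G"
  shows "\<psi> (pres_class R w) = word_eval G (\<lambda>x. \<psi> (pres_class R [(x, True)])) w"
proof -
  interpret P: group "presented_group R" by (rule group_presented_group)
  interpret group_hom "presented_group R" G \<psi>
    using G \<psi> P.is_group by (simp add: group_hom_def group_hom_axioms_def)
  have one: "\<one>\<^bsub>presented_group R\<^esub> = pres_class R []" by (simp add: presented_group_def)
  have carr: "pres_class R u \<in> carrier (presented_group R)" for u by (simp add: presented_group_def)
  have inv: "pres_class R [(x, False)] = inv\<^bsub>presented_group R\<^esub> (pres_class R [(x, True)])" for x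
  proof (rule P.inv_equality[symmetric])
    show "pres_class R [(x, False)] \<otimes>\<^bsub>presented_group R\<^esub> pres_class R [(x, True)] = \<one>\<^bsub>presented_group R\<^esub>"
      using pres_cancel[of R x False] by (simp add: presented_mult one pres_class_eq_iff)
  qed (rule carr)+
  show ?thesis
  proof (induction w)
    case Nil
    then show ?case using hom_one by (simp add: word_eval_def one)
  next
    case (Cons l w)
    obtain x e where l: "l = (x, e)" by (cases l)
    have "pres_class R (l # w) = pres_class R [l] \<otimes>\<^bsub>presented_group R\<^esub> pres_class R w"
      by (simp add: presented_mult)
    then have "\<psi> (pres_class R (l # w)) = \<psi> (pres_class R [l]) \<otimes>\<^bsub>G\<^esub> \<psi> (pres_class R w)"
      by (simp add: carr)
    moreover have "\<psi> (pres_class R [l]) = (if e then \<psi> (pres_class R [(x, True)]) else inv\<^bsub>G\<^esub> \<psi> (pres_class R [(x, True)]))"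
      by (simp add: l inv carr)
    ultimately show ?case using Cons by (simp add: word_eval_def l)
  qed
qed

lemma (in group) word_eval_replicate_inverse:
  assumes "c x \<in> carrier G"
  shows "word_eval G c (replicate k (x, False)) = inv (c x [^] k)"
proof (induction k)
  case 0 show ?case by (simp add: word_eval_def)
next
  case (Suc k)
  have "word_eval G c (replicate (Suc k) (x, False)) = inv (c x) \<otimes> word_eval G c (replicate k (x, False))"
    by (simp add: word_eval_def)
  then show ?case using Suc assms by (simp add: inv_mult_group)
qed

abbreviation BS_relator :: "nat \<Rightarrow> bs_gen word" where
  "BS_relator q \<equiv> [(GenB, True), (GenA, True), (GenB, False)] @ replicate q (GenA, False)"

text \<open>The inverse-free form of the relation translates directly into an identity between
  compositions of tree maps.\<close>

lemma (in group) word_eval_BS_relator: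
  assumes c: "\<And>x. c x \<in> carrier G"
  shows "word_eval G c (BS_relator q) = \<one> \<longleftrightarrow> c GenB \<otimes> c GenA = c GenA [^] q \<otimes> c GenB"
proof -
  have "word_eval G c (BS_relator q) = c GenB \<otimes> (c GenA \<otimes> (inv (c GenB) \<otimes> word_eval G c (replicate q (GenA, False))))"
    by (simp add: word_eval_def)
  also have "\<dots> = (c GenB \<otimes> c GenA) \<otimes> inv (c GenA [^] q \<otimes> c GenB)"
    using c by (simp add: word_eval_replicate_inverse inv_mult_group m_assoc)
  finally have e: "word_eval G c (BS_relator q) = (c GenB \<otimes> c GenA) \<otimes> inv (c GenA [^] q \<otimes> c GenB)" .
  have "x \<otimes> inv y = \<one> \<longleftrightarrow> x = y" if "x \<in> carrier G" "y \<in> carrier G" for x y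
    using that by (metis inv_closed inv_inv inv_unique' r_inv inv_equality)
  then show ?thesis unfolding e using c by simp
qed

definition BS_gen :: "nat \<Rightarrow> bs_gen \<Rightarrow> bs_gen word set" where
  "BS_gen q x = pres_class {BS_relator q} [(x, True)]"

lemma BS_gen_carrier: "BS_gen q x \<in> carrier (BS q)"
  by (simp add: BS_gen_def BS_def presented_group_def)

lemma BS_hom_word_eval:
  assumes "group G" "\<psi> \<in> hom (BS q) G"
  shows "\<psi> (pres_class {BS_relator q} w) = word_eval G (\<lambda>x. \<psi> (BS_gen q x)) w"
  unfolding BS_gen_def using hom_presented_word_eval[OF assms(1), of \<psi> "{BS_relator q}" w] assms(2) by (simp add: BS_def)

lemma BS_hom_image:
  assumes "group G" "\<psi> \<in> hom (BS q) G"
  shows "\<psi> ` carrier (BS q) = range (word_eval G (\<lambda>x. \<psi> (BS_gen q x)))"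
proof -
  have "carrier (BS q) = range (pres_class {BS_relator q})" by (simp add: BS_def presented_group_def)
  then show ?thesis using BS_hom_word_eval[OF assms] by (simp add: image_image)
qed

lemma BS_hom_relation:
  assumes G: "group G" and \<psi>: "\<psi> \<in> hom (BS q) G"
  shows "\<psi> (BS_gen q GenB) \<otimes>\<^bsub>G\<^esub> \<psi> (BS_gen q GenA) = \<psi> (BS_gen q GenA) [^]\<^bsub>G\<^esub> q \<otimes>\<^bsub>G\<^esub> \<psi> (BS_gen q GenB)"
proof -
  have c: "\<psi> (BS_gen q x) \<in> carrier G" for x using hom_in_carrier[OF \<psi> BS_gen_carrier] .
  have "pres_class {BS_relator q} (BS_relator q) = pres_class {BS_relator q} []"
    unfolding pres_class_eq_iff by (rule pres_relator) simp
  then have "word_eval G (\<lambda>x. \<psi> (BS_gen q x)) (BS_relator q) = word_eval G (\<lambda>x. \<psi> (BS_gen q x)) []"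
    using BS_hom_word_eval[OF assms] by metis
  then show ?thesis using group.word_eval_BS_relator[OF G, of "\<lambda>x. \<psi> (BS_gen q x)" q, OF c]
    by (simp add: word_eval_def)
qed

lemma BS_lift:
  assumes G: "group G" and c: "\<And>x. c x \<in> carrier G"
    and rel: "c GenB \<otimes>\<^bsub>G\<^esub> c GenA = c GenA [^]\<^bsub>G\<^esub> q \<otimes>\<^bsub>G\<^esub> c GenB"
  shows "presentation_lift G c \<in> hom (BS q) G" "presentation_lift G c (BS_gen q x) = c x"
proof -
  have r: "word_eval G c r = \<one>\<^bsub>G\<^esub>" if "r \<in> {BS_relator q}" for r
    using that group.word_eval_BS_relator[OF G, of c q, OF c] rel by simp
  show "presentation_lift G c \<in> hom (BS q) G"
    using group.presentation_lift_hom(1)[OF G, of c "{BS_relator q}", OF c r] by (simp add: BS_def)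
  show "presentation_lift G c (BS_gen q x) = c x"
    unfolding BS_gen_def by (rule group.presentation_lift_hom(2)[OF G, of c "{BS_relator q}", OF c r])
qed

text \<open>Conjugation by \<open>g\<close> yields another homomorphism, and homomorphisms agreeing
  on the generators agree.\<close>

lemma (in group) BS_conjugate_iff:
  assumes \<psi>: "\<psi> \<in> hom (BS q) G" and \<phi>: "\<phi> \<in> hom (BS q) G"
  shows "conjugate_homs (BS q) G \<psi> \<phi> \<longleftrightarrow>
    (\<exists>g\<in>carrier G. \<forall>x. g \<otimes>\<^bsub>G\<^esub> \<psi> (BS_gen q x) = \<phi> (BS_gen q x) \<otimes>\<^bsub>G\<^esub> g)"
proof -
  have \<psi>c: "\<psi> x \<in> carrier G" and \<phi>c: "\<phi> x \<in> carrier G" if "x \<in> carrier (BS q)" for x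
    using hom_in_carrier[OF \<psi> that] hom_in_carrier[OF \<phi> that] by auto
  have iff: "g \<otimes> x \<otimes> inv g = y \<longleftrightarrow> g \<otimes> x = y \<otimes> g" if "g \<in> carrier G" "x \<in> carrier G" "y \<in> carrier G" for g x y
    using that by (metis inv_solve_right m_closed)
  have main: "g \<otimes> \<psi> x \<otimes> inv g = \<phi> x"
    if g: "g \<in> carrier G" and gen: "\<And>x. g \<otimes> \<psi> (BS_gen q x) = \<phi> (BS_gen q x) \<otimes> g" and x: "x \<in> carrier (BS q)" for g x
  proof -
    let ?\<theta> = "\<lambda>x. g \<otimes> \<psi> x \<otimes> inv g"
    have "?\<theta> \<in> hom (BS q) G"
    proof (rule homI)
      fix x y assume xy: "x \<in> carrier (BS q)" "y \<in> carrier (BS q)"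
      have "inv g \<otimes> (g \<otimes> z) = z" if "z \<in> carrier G" for z
        using g that by (simp flip: m_assoc)
      then show "?\<theta> (x \<otimes>\<^bsub>BS q\<^esub> y) = ?\<theta> x \<otimes> ?\<theta> y"
        using g \<psi>c xy hom_mult[OF \<psi> xy] by (simp add: m_assoc)
    qed (use g \<psi>c in simp)
    moreover have "?\<theta> (BS_gen q x) = \<phi> (BS_gen q x)" for x
      using iff[OF g \<psi>c \<phi>c] BS_gen_carrier gen by blast
    moreover obtain w where "x = pres_class {BS_relator q} w"
      using x by (auto simp: BS_def presented_group_def)
    ultimately show ?thesis
      using BS_hom_word_eval[OF is_group, of ?\<theta> q w] BS_hom_word_eval[OF is_group \<phi>, of w] by simp
  qed
  show ?thesis
    unfolding conjugate_homs_def
  proof (intro bex_cong refl iffI allI ballI)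
    fix g x assume "g \<in> carrier G" "\<forall>x\<in>carrier (BS q). g \<otimes> \<psi> x \<otimes> inv g = \<phi> x"
    then show "g \<otimes> \<psi> (BS_gen q x) = \<phi> (BS_gen q x) \<otimes> g"
      using iff[OF _ \<psi>c[OF BS_gen_carrier] \<phi>c[OF BS_gen_carrier]] BS_gen_carrier by blast
  qed (rule main, blast+)
qed

lemma (in group) conjugate_homs_sym:
  assumes "\<psi> \<in> hom B G" "conjugate_homs B G \<psi> \<phi>" shows "conjugate_homs B G \<phi> \<psi>"
proof -
  obtain g where g: "g \<in> carrier G" "\<And>x. x \<in> carrier B \<Longrightarrow> g \<otimes> \<psi> x \<otimes> inv g = \<phi> x"
    using assms(2) unfolding conjugate_homs_def by blast
  have "inv g \<otimes> \<phi> x \<otimes> inv (inv g) = \<psi> x" if x: "x \<in> carrier B" for x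
  proof -
    have "\<psi> x \<in> carrier G" using hom_in_carrier[OF assms(1) x] .
    then have "inv g \<otimes> (g \<otimes> \<psi> x \<otimes> inv g) \<otimes> g = (inv g \<otimes> g) \<otimes> \<psi> x \<otimes> (inv g \<otimes> g)"
      using g(1) by (simp only: m_assoc m_closed inv_closed)
    then have "inv g \<otimes> (g \<otimes> \<psi> x \<otimes> inv g) \<otimes> g = \<psi> x"
      using g(1) \<open>\<psi> x \<in> carrier G\<close> by simp
    then show ?thesis using g x by simp
  qed
  then show ?thesis unfolding conjugate_homs_def using g(1) by (intro bexI[of _ "inv g"]) auto
qed

lemma (in group) conjugate_homs_trans:
  assumes "\<psi> \<in> hom B G" "conjugate_homs B G \<psi> \<phi>" "conjugate_homs B G \<phi> \<theta>"
  shows "conjugate_homs B G \<psi> \<theta>"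
proof -
  obtain g where g: "g \<in> carrier G" "\<And>x. x \<in> carrier B \<Longrightarrow> g \<otimes> \<psi> x \<otimes> inv g = \<phi> x"
    using assms(2) unfolding conjugate_homs_def by blast
  obtain h where h: "h \<in> carrier G" "\<And>x. x \<in> carrier B \<Longrightarrow> h \<otimes> \<phi> x \<otimes> inv h = \<theta> x"
    using assms(3) unfolding conjugate_homs_def by blast
  have "(h \<otimes> g) \<otimes> \<psi> x \<otimes> inv (h \<otimes> g) = \<theta> x" if x: "x \<in> carrier B" for x
  proof -
    have "\<psi> x \<in> carrier G" using hom_in_carrier[OF assms(1) x] .
    then have "(h \<otimes> g) \<otimes> \<psi> x \<otimes> inv (h \<otimes> g) = h \<otimes> (g \<otimes> \<psi> x \<otimes> inv g) \<otimes> inv h"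
      using g(1) h(1) by (simp add: m_assoc inv_mult_group)
    then show ?thesis using g h x by simp
  qed
  then show ?thesis unfolding conjugate_homs_def using g(1) h(1) by (intro bexI[of _ "h \<otimes> g"]) auto
qed

section \<open>Lattice embeddings\<close>

context standard_tree
begin

lemma shift_a: "shift a = 0"
  using frame_ht(1)[OF frame_standard, of 1 v0] by (simp add: shift_def ht_v0)

lemma a_isom_eq: "a_isom n E v0 lab b s = elt s a"
  by (simp add: a_isom_def elt_def shift_a hyp_affine_def)

lemma b_isom_eq: "b_isom n b = elt 0 b"
  by (simp add: b_isom_def elt_def shift_b hyp_affine_def)

lemma shift_b_pow: "shift (b ^^ l) = int l"
  using shift_funpow[OF aut_b] by (simp add: shift_b)

lemma shift_a_pow: "shift (a ^^ m) = 0"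
  using shift_funpow[OF aut_a] by (simp add: shift_a)

lemma phi_props:
  shows "phi n l E v0 lab b s m \<in> hom (BS (n ^ l)) G"
    and "phi n l E v0 lab b s m (BS_gen (n ^ l) GenA) = elt (m * s) (a ^^ m)"
    and "phi n l E v0 lab b s m (BS_gen (n ^ l) GenB) = elt 0 (b ^^ l)"
proof -
  let ?c = "\<lambda>x. case x of GenA \<Rightarrow> a_isom n E v0 lab b s [^]\<^bsub>G\<^esub> m | GenB \<Rightarrow> b_isom n b [^]\<^bsub>G\<^esub> l"
  have A: "?c GenA = elt (m * s) (a ^^ m)" using pow_G[OF aut_a, of s m] by (simp add: a_isom_eq shift_a)
  have B: "?c GenB = elt 0 (b ^^ l)" using pow_G[OF aut_b, of 0 l] by (simp add: b_isom_eq)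
  have c: "?c x \<in> carrier G" for x
    using A B by (cases x) (simp_all add: elt_carrier aut_funpow aut_a aut_b)
  have "elt 0 (b ^^ l) \<otimes>\<^bsub>G\<^esub> elt (m * s) (a ^^ m) = elt (m * s) (a ^^ m) [^]\<^bsub>G\<^esub> (n ^ l) \<otimes>\<^bsub>G\<^esub> elt 0 (b ^^ l)"
  proof -
    have "(b ^^ l) ((a ^^ m) x) = ((a ^^ m) ^^ (n ^ l)) ((b ^^ l) x)" for x
      using twisted_commute[of b a n l m x, OF b_a] by (simp add: funpow_mult mult.commute)
    then have "b ^^ l \<circ> a ^^ m = (a ^^ m) ^^ (n ^ l) \<circ> b ^^ l" by (simp add: fun_eq_iff)
    then show ?thesis
      by (simp add: pow_G shift_a_pow aut_funpow aut_a aut_b mult_G shift_b_pow)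
  qed
  then have rel: "?c GenB \<otimes>\<^bsub>G\<^esub> ?c GenA = ?c GenA [^]\<^bsub>G\<^esub> (n ^ l) \<otimes>\<^bsub>G\<^esub> ?c GenB" unfolding A B .
  show "phi n l E v0 lab b s m \<in> hom (BS (n ^ l)) G"
    unfolding phi_def by (rule BS_lift(1)[OF group_G c rel])
  show "phi n l E v0 lab b s m (BS_gen (n ^ l) GenA) = elt (m * s) (a ^^ m)"
    unfolding phi_def BS_lift(2)[OF group_G c rel] by (rule A)
  show "phi n l E v0 lab b s m (BS_gen (n ^ l) GenB) = elt 0 (b ^^ l)"
    unfolding phi_def BS_lift(2)[OF group_G c rel] by (rule B)
qed

text \<open>The tree part of a conjugator forces \<open>m = m'\<close> and preserves heights. It
  therefore does not rescale the half plane, and comparing translations gives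
  \<open>s = s'\<close>.\<close>

lemma phi_conjugate_unique:
  assumes m: "reduced_multiplier n m" "reduced_multiplier n m'"
    and conj: "conjugate_homs (BS (n ^ l)) G (phi n l E v0 lab b s m) (phi n l E v0 lab b s' m')"
  shows "(s, m) = (s', m')"
proof -
  obtain g where g: "g \<in> carrier G"
    and eq: "g \<otimes>\<^bsub>G\<^esub> elt (m * s) (a ^^ m) = elt (m' * s') (a ^^ m') \<otimes>\<^bsub>G\<^esub> g"
    using conj unfolding group.BS_conjugate_iff[OF group_G phi_props(1) phi_props(1)] by (metis phi_props(2))
  obtain t \<gamma> where g: "g = elt t \<gamma>" "aut \<gamma>" using carrierE[OF g] .
  have e: "scale \<gamma> * (m * s) + t = t + m' * s'" "\<gamma> \<circ> a ^^ m = a ^^ m' \<circ> \<gamma>"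
    using eq unfolding g(1) mult_G[OF g(2) aut_funpow[OF aut_a]] mult_G[OF aut_funpow[OF aut_a] g(2)] elt_eq_iff
    by (simp_all add: shift_a_pow)
  have "\<gamma> ((a ^^ m) x) = (a ^^ m') (\<gamma> x)" for x using e(2) by (metis comp_apply)
  note * = frame_conjugate_multipliers[OF frame_standard g(2) this]
  have "m = m'" by (rule *(1)) (use m in \<open>simp_all add: reduced_multiplier_def\<close>)
  moreover have "ht (\<gamma> v0) = ht v0" by (rule *(2)) (use m in \<open>simp_all add: reduced_multiplier_def\<close>)
  then have "shift \<gamma> = 0" by (simp add: shift_def ht_v0)
  ultimately show ?thesis using e(1) m(1) by (simp add: reduced_multiplier_def)
qed

lemma snd_pow_G: "p \<in> carrier G \<Longrightarrow> snd (p [^]\<^bsub>G\<^esub> (k::nat)) = snd p ^^ k"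
proof (induction k)
  case 0
  then show ?case by (simp add: one_G elt_def id_def)
next
  case (Suc k)
  then show ?case
    using snd_mult_G[OF monoid.nat_pow_closed[OF group.is_monoid[OF group_G], of p k] Suc.prems]
    by (simp only: nat_pow_Suc funpow_Suc_right)
qed

lemma shift_mult_G: "p \<in> carrier G \<Longrightarrow> p' \<in> carrier G \<Longrightarrow> shift (snd (p \<otimes>\<^bsub>G\<^esub> p')) = shift (snd p) + shift (snd p')"
  by (simp only: snd_mult_G shift_comp aut_snd)

lemma shift_inv_G: "p \<in> carrier G \<Longrightarrow> shift (snd (inv\<^bsub>G\<^esub> p)) = - shift (snd p)"
  by (simp only: snd_inv_G shift_inv aut_snd)

lemma subgroup_induct_generators:
  assumes c: "\<And>x. c x \<in> carrier G" and one: "P \<one>\<^bsub>G\<^esub>"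
    and step: "\<And>x p. p \<in> carrier G \<Longrightarrow> P p \<Longrightarrow> P (c x \<otimes>\<^bsub>G\<^esub> p)" "\<And>x p. p \<in> carrier G \<Longrightarrow> P p \<Longrightarrow> P (inv\<^bsub>G\<^esub> (c x) \<otimes>\<^bsub>G\<^esub> p)"
  shows "P (word_eval G c w)"
proof (induction w)
  case Nil then show ?case using one by (simp add: word_eval_def)
next
  case (Cons l w)
  obtain x e where l: "l = (x, e)" by (cases l)
  have "word_eval G c (l # w) = (if e then c x else inv\<^bsub>G\<^esub> (c x)) \<otimes>\<^bsub>G\<^esub> word_eval G c w"
    by (simp add: word_eval_def l)
  then show ?case using Cons step group.word_eval_closed[OF group_G, of c w, OF c] by simp
qed

lemma lattice_embedding_conjugate:
  assumes l: "l \<ge> 1" and lat: "lattice_embedding (BS (n ^ l)) G (G_topology n E v0) \<psi>"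
  shows "\<exists>s m. s \<noteq> 0 \<and> reduced_multiplier n m \<and> conjugate_homs (BS (n ^ l)) G \<psi> (phi n l E v0 lab b s m)"
proof -
  define q where "q = n ^ l"
  have q: "q \<ge> 2" using n2 l by (metis q_def self_le_power one_le_numeral order_trans less_eq_Suc_le One_nat_def)
  have \<psi>: "\<psi> \<in> hom (BS q) G" using lat by (simp add: lattice_embedding_def q_def)
  define \<Gamma> where "\<Gamma> = \<psi> ` carrier (BS q)"
  define c where "c x = \<psi> (BS_gen q x)" for x
  have c: "c x \<in> carrier G" for x unfolding c_def using hom_in_carrier[OF \<psi> BS_gen_carrier] .
  have \<Gamma>: "\<Gamma> = range (word_eval G c)" unfolding \<Gamma>_def c_def by (rule BS_hom_image[OF group_G \<psi>])
  have sub: "subgroup \<Gamma> G" and cov: "finite_covolume G (G_topology n E v0) \<Gamma>"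
    using lat by (simp_all add: lattice_embedding_def lattice_subgroup_def \<Gamma>_def q_def)
  obtain \<mu> where quot: "invariant_quotient G (G_topology n E v0) \<Gamma> \<mu>"
    using finite_covolumeE[OF group_G sub cov] .
  obtain \<sigma> A where A: "c GenA = elt \<sigma> A" "aut A" using carrierE[OF c] .
  obtain \<tau> B where B: "c GenB = elt \<tau> B" "aut B" using carrierE[OF c] .
  have rel: "c GenB \<otimes>\<^bsub>G\<^esub> c GenA = c GenA [^]\<^bsub>G\<^esub> q \<otimes>\<^bsub>G\<^esub> c GenB"
    unfolding c_def by (rule BS_hom_relation[OF group_G \<psi>])
  have relT: "B \<circ> A = A ^^ q \<circ> B"
  proof -
    have "snd (c GenB \<otimes>\<^bsub>G\<^esub> c GenA) = B \<circ> A" by (simp add: snd_mult_G c) (simp add: A B elt_def)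
    moreover have "snd (c GenA [^]\<^bsub>G\<^esub> q \<otimes>\<^bsub>G\<^esub> c GenB) = A ^^ q \<circ> B"
      using snd_mult_G[OF monoid.nat_pow_closed[OF group.is_monoid[OF group_G] c[of GenA], of q] c[of GenB]] snd_pow_G[OF c, of GenA q]
      by (simp add: A B elt_def)
    ultimately show ?thesis using rel by simp
  qed
  have sA: "shift A = 0"
  proof -
    have "shift B + shift A = int q * shift A + shift B"
      using arg_cong[OF relT, of shift] A(2) B(2) by (simp add: shift_comp aut_funpow shift_funpow)
    then have "(int q - 1) * shift A = 0" by (simp add: algebra_simps)
    then show ?thesis using q by simp
  qed
  have relR: "scale B * \<sigma> = q * \<sigma>"
  proof -
    have "elt (scale B * \<sigma> + \<tau>) (B \<circ> A) = elt (scale (A ^^ q) * \<tau> + q * \<sigma>) (A ^^ q \<circ> B)"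
      using rel unfolding A(1) B(1) by (simp add: mult_G A(2) B(2) pow_G sA aut_funpow)
    then show ?thesis using A(2) by (simp add: elt_eq_iff shift_funpow sA)
  qed
  have gen_cases: "P (c x)" if "P (elt \<sigma> A)" "P (elt \<tau> B)" for P x using that A(1) B(1) by (cases x) auto
  have shB: "shift B dvd shift (snd p)" if "p \<in> \<Gamma>" for p
  proof -
    have gen: "shift B dvd shift (snd (c x))" for x
      by (rule gen_cases) (simp_all add: elt_def sA)
    have "shift B dvd shift (snd (word_eval G c w))" for w
    proof (rule subgroup_induct_generators[OF c])
      show "shift B dvd shift (snd \<one>\<^bsub>G\<^esub>)" unfolding one_G elt_def snd_conv shift_id by simp
    qed (simp_all add: shift_mult_G shift_inv_G c group.inv_closed[OF group_G] gen)
    then show ?thesis using that \<Gamma> by auto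
  qed
  have sB0: "shift B \<noteq> 0"
    using some_nonzero_shift[OF quot] shB by (metis dvd_0_left_iff)
  have inj_scale: "j = k" if "real n powi j = real n powi k" for j k :: int
  proof -
    have "real n powr of_int j = real n powr of_int k" using that n2 by (simp add: powr_real_of_int')
    then show ?thesis using n2 by (simp add: powr_inj)
  qed
  have \<sigma>: "\<sigma> \<noteq> 0"
  proof
    assume "\<sigma> = 0"
    have "scale B \<noteq> 1" using inj_scale[of "shift B" 0] sB0 by auto
    \<comment> \<open>The finite boundary point fixed by the half-plane part of
      \<open>c GenB\<close>. For \<open>\<sigma> = 0\<close> the other generator is the identity on
      the half plane, so all of \<Gamma> would fix it.\<close>
    define t0 where "t0 = \<tau> / (1 - scale B)"
    have fixB: "scale B * t0 + \<tau> = t0" using \<open>scale B \<noteq> 1\<close> by (simp add: t0_def field_simps)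
    let ?P = "\<lambda>p. \<exists>t g. p = elt t g \<and> aut g \<and> scale g * t0 + t = t0"
    have mult: "?P (p \<otimes>\<^bsub>G\<^esub> p')" if p: "?P p" "?P p'" for p p'
    proof -
      obtain t g where 1: "p = elt t g" "aut g" "scale g * t0 + t = t0" using p by blast
      obtain t' g' where 2: "p' = elt t' g'" "aut g'" "scale g' * t0 + t' = t0" using p by blast
      have "scale (g \<circ> g') = scale g * scale g'" using n2 by (simp add: shift_comp 1 2 power_int_add)
      then have "scale (g \<circ> g') * t0 + (scale g * t' + t) = scale g * (scale g' * t0 + t') + t"
        by (simp only:) (simp add: algebra_simps)
      then show ?thesis unfolding 1(1) 2(1) mult_G[OF 1(2) 2(2)] using 1 2 aut_comp by metis
    qed
    have gen: "?P (c x)" for x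
      by (rule gen_cases) (use A B sA \<open>\<sigma> = 0\<close> fixB in \<open>auto simp: elt_eq_iff\<close>)
    have inv: "?P (inv\<^bsub>G\<^esub> p)" if p: "?P p" for p
    proof -
      obtain t g where 1: "p = elt t g" "aut g" "scale g * t0 + t = t0" using p by blast
      have "scale (inv_into UNIV g) = 1 / scale g" by (simp add: shift_inv 1 power_int_minus divide_inverse)
      moreover have "1 / k * t0 + - t / k = t0" if "k > 0" "k * t0 + t = t0" for k using that by (simp add: field_simps)
      ultimately have "scale (inv_into UNIV g) * t0 + - t / scale g = t0" using scale_pos[of g] 1(3) by simp
      then show ?thesis unfolding 1(1) inv_G[OF 1(2)] using 1(2) aut_inv by blast
    qed
    have "?P (word_eval G c w)" for w
    proof (rule subgroup_induct_generators[OF c])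
      show "?P \<one>\<^bsub>G\<^esub>" unfolding one_G using aut_id(1) shift_id by (intro exI[of _ 0] exI[of _ id]) simp
    qed (blast intro: mult gen inv)+
    then have "?P p" if "p \<in> \<Gamma>" for p using that \<Gamma> by blast
    moreover obtain t g where "elt t g \<in> \<Gamma>" "scale g * t0 + t \<noteq> t0" using no_boundary_fixed_point[OF quot] by blast
    ultimately show False by (metis elt_eq_iff)
  qed
  \<comment> \<open>Cancelling \<sigma> in \<open>relR\<close> fixes the translation length of
    \<open>B\<close>.\<close>
  then have "scale B = real n powi int l" using relR by (simp add: q_def)
  then have sB: "shift B = int l" by (rule inj_scale)
  have cB: "c GenB \<in> \<Gamma>" unfolding \<Gamma>_def c_def using BS_gen_carrier by blast
  have tw: "B (A x) = (A ^^ (n ^ l)) (B x)" for x using relT by (metis comp_apply q_def)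
  have htA: "ht (A v) = ht v" and htB: "ht (B v) = ht v + int l" for v
    using ht_shift[OF A(2)] ht_shift[OF B(2)] sA sB by auto
  have twc: "(B ^^ i) ((A ^^ p) x) = (A ^^ (q ^ i * p)) ((B ^^ i) x)" for i p x
    unfolding q_def by (rule twisted_commute[of B A "n ^ l", OF tw])
  \<comment> \<open>Every element has the form \<open>B^-i A^p B^k\<close>. Asking for this only at
    one vertex allows a natural number \<open>p\<close>, because \<open>A\<close> is periodic at
    each vertex.\<close>
  have normal: "\<exists>i p k. (B ^^ i) (snd g y) = (A ^^ p) ((B ^^ k) y)" if g: "g \<in> \<Gamma>" for g y
  proof -
    have "\<exists>i p k. (B ^^ i) (snd (word_eval G c w) y) = (A ^^ p) ((B ^^ k) y)" for w
    proof (rule subgroup_induct_generators[OF c])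
      show "\<exists>i p k. (B ^^ i) (snd \<one>\<^bsub>G\<^esub> y) = (A ^^ p) ((B ^^ k) y)"
        by (rule exI[of _ 0], rule exI[of _ 0], rule exI[of _ 0]) (simp add: one_G elt_def)
    next
      fix x g assume g: "g \<in> carrier G" and "\<exists>i p k. (B ^^ i) (snd g y) = (A ^^ p) ((B ^^ k) y)"
      then obtain i p k where ipk: "(B ^^ i) (snd g y) = (A ^^ p) ((B ^^ k) y)" by blast
      have s: "snd (c x \<otimes>\<^bsub>G\<^esub> g) y = snd (c x) (snd g y)" by (simp add: snd_mult_G c g)
      show "\<exists>i p k. (B ^^ i) (snd (c x \<otimes>\<^bsub>G\<^esub> g) y) = (A ^^ p) ((B ^^ k) y)"
        unfolding s
      proof (cases x)
        case GenA
        have "(B ^^ i) (A (snd g y)) = (A ^^ (q ^ i + p)) ((B ^^ k) y)"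
          using twc[of i 1 "snd g y"] ipk by (simp add: funpow_add_apply)
        then show "\<exists>i p k. (B ^^ i) (snd (c x) (snd g y)) = (A ^^ p) ((B ^^ k) y)"
          unfolding GenA A(1) elt_def snd_conv by blast
      next
        case GenB
        have "(B ^^ i) (B (snd g y)) = (A ^^ (q * p)) ((B ^^ Suc k) y)"
          using twc[of 1 p "(B ^^ k) y"] ipk by (simp add: funpow_swap1[symmetric])
        then show "\<exists>i p k. (B ^^ i) (snd (c x) (snd g y)) = (A ^^ p) ((B ^^ k) y)"
          unfolding GenB B(1) elt_def snd_conv by blast
      qed
    next
      fix x g assume g: "g \<in> carrier G" and "\<exists>i p k. (B ^^ i) (snd g y) = (A ^^ p) ((B ^^ k) y)"
      then obtain i p k where ipk: "(B ^^ i) (snd g y) = (A ^^ p) ((B ^^ k) y)" by blast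
      have s: "snd (inv\<^bsub>G\<^esub> (c x) \<otimes>\<^bsub>G\<^esub> g) y = inv_into UNIV (snd (c x)) (snd g y)"
        by (simp add: snd_mult_G snd_inv_G c g group.inv_closed[OF group_G])
      show "\<exists>i p k. (B ^^ i) (snd (inv\<^bsub>G\<^esub> (c x) \<otimes>\<^bsub>G\<^esub> g) y) = (A ^^ p) ((B ^^ k) y)"
        unfolding s
      proof (cases x)
        case GenA
        let ?w = "inv_into UNIV A (snd g y)"
        obtain N where N: "N > 0" "(A ^^ N) ?w = ?w" using elliptic_periodic[OF A(2) htA] by blast
        have Aw: "A ?w = snd g y" by (rule aut_inv_cancel(1)[OF A(2)])
        then have "?w = (A ^^ (N - 1)) (snd g y)"
          using N funpow_add_apply[of "N - 1" 1 A ?w] by simp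
        then have "(B ^^ i) ?w = (A ^^ (q ^ i * (N - 1) + p)) ((B ^^ k) y)"
          using twc[of i "N - 1" "snd g y"] ipk by (simp add: funpow_add_apply)
        then show "\<exists>i p k. (B ^^ i) (inv_into UNIV (snd (c x)) (snd g y)) = (A ^^ p) ((B ^^ k) y)"
          unfolding GenA A(1) elt_def snd_conv by blast
      next
        case GenB
        have "(B ^^ Suc i) (inv_into UNIV B (snd g y)) = (A ^^ p) ((B ^^ k) y)"
          using ipk by (simp add: funpow_swap1 aut_inv_cancel(1)[OF B(2)])
        then show "\<exists>i p k. (B ^^ i) (inv_into UNIV (snd (c x)) (snd g y)) = (A ^^ p) ((B ^^ k) y)"
          unfolding GenB B(1) elt_def snd_conv by blast
      qed
    qed
    then show ?thesis using g \<Gamma> by blast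
  qed
  \<comment> \<open>Only \<open>B\<close> changes heights, so between vertices of equal height the
    normal form has \<open>i = k\<close>.\<close>
  have trans: "\<exists>i p. (B ^^ i) w = (A ^^ p) ((B ^^ i) y)" if yw: "ht y = ht w" for y w
  proof -
    have "shift (snd (c GenB)) = int l" by (simp add: B(1) elt_def sB)
    moreover have "int l dvd shift (snd p)" if "p \<in> \<Gamma>" for p using shB[OF that] sB by simp
    ultimately obtain g where g: "g \<in> \<Gamma>" "snd g y = w" using transitive_on_heights[OF quot cB _ _ l yw] by blast
    then obtain i p k where ipk: "(B ^^ i) w = (A ^^ p) ((B ^^ k) y)" using normal by metis
    have "ht ((B ^^ j) v) = ht v + int j * int l" for j v using ht_funpow[OF B(2), of j v v0] htB[of v0] by simp
    moreover have "ht ((A ^^ p) v) = ht v" for v using ht_funpow[OF A(2), of p v v0] htA[of v0] by simp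
    ultimately have "ht w + int i * int l = ht y + int k * int l" using ipk by metis
    then have "i = k" using yw l by simp
    then show ?thesis using ipk by blast
  qed
  obtain \<alpha> u m where F: "frame l \<alpha> B u" and m: "A = \<alpha> ^^ m" "m > 0"
    "\<forall>p. prime p \<longrightarrow> p dvd m \<longrightarrow> p dvd n" "\<not> n dvd m"
    using frame_of_transitive[OF A(2) htA B(2) htB l tw trans] by blast
  obtain \<gamma> where \<gamma>: "aut \<gamma>" "\<And>x. \<gamma> (\<alpha> x) = a (\<gamma> x)" "\<And>x. \<gamma> (B x) = (b ^^ l) (\<gamma> x)"
    using frame_conjugate[OF F frame_power[OF frame_standard l]] by blast
  have red: "reduced_multiplier n m" using m by (simp add: reduced_multiplier_def)
  \<comment> \<open>\<open>t\<close> makes \<open>elt t \<gamma>\<close> carry the boundary fixed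
    point \<open>\<tau> / (1 - n ^ l)\<close> of \<open>c GenB\<close> to 0, the one of the standard
    \<open>b^l\<close>. Then \<open>s\<close> is the translation \<sigma>, rescaled by \<gamma> and
    distributed over \<open>m\<close> factors.\<close>
  define s where "s = scale \<gamma> * \<sigma> / m"
  define t where "t = scale \<gamma> * \<tau> / (real n ^ l - 1)"
  have "real n ^ l > 1" using q by (simp add: q_def flip: of_nat_power)
  then have t: "scale \<gamma> * \<tau> + t = real n ^ l * t" by (simp add: t_def field_simps)
  have "\<gamma> (((\<alpha> ^^ j)) x) = (a ^^ j) (\<gamma> x)" for j x
    by (induction j) (simp_all add: \<gamma>(2))
  then have "\<gamma> \<circ> A = a ^^ m \<circ> \<gamma>" by (simp add: m(1) fun_eq_iff)
  moreover have "scale \<gamma> * \<sigma> + t = t + m * s" using m(2) by (simp add: s_def)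
  ultimately have 1: "elt t \<gamma> \<otimes>\<^bsub>G\<^esub> c GenA = elt (m * s) (a ^^ m) \<otimes>\<^bsub>G\<^esub> elt t \<gamma>"
    unfolding A(1) mult_G[OF \<gamma>(1) A(2)] mult_G[OF aut_funpow[OF aut_a] \<gamma>(1)] elt_eq_iff by (simp add: shift_a_pow)
  have "\<gamma> \<circ> B = b ^^ l \<circ> \<gamma>" using \<gamma>(3) by (simp add: fun_eq_iff)
  then have 2: "elt t \<gamma> \<otimes>\<^bsub>G\<^esub> c GenB = elt 0 (b ^^ l) \<otimes>\<^bsub>G\<^esub> elt t \<gamma>"
    unfolding B(1) mult_G[OF \<gamma>(1) B(2)] mult_G[OF aut_funpow[OF aut_b] \<gamma>(1)] elt_eq_iff using t by (simp add: shift_b_pow)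
  have "elt t \<gamma> \<otimes>\<^bsub>G\<^esub> \<psi> (BS_gen (n ^ l) x) = phi n l E v0 lab b s m (BS_gen (n ^ l) x) \<otimes>\<^bsub>G\<^esub> elt t \<gamma>" for x
    using 1 2 by (cases x) (simp_all add: phi_props c_def q_def)
  then have "conjugate_homs (BS (n ^ l)) G \<psi> (phi n l E v0 lab b s m)"
    unfolding group.BS_conjugate_iff[OF group_G \<psi>[unfolded q_def] phi_props(1)] using elt_carrier[OF \<gamma>(1)] by blast
  moreover have "s \<noteq> 0" using \<sigma> m(2) n2 by (simp add: s_def)
  ultimately show ?thesis using red by blast
qed

end

theorem theorem2:
  fixes n l :: nat and E :: "('v \<times> 'v) set" and v0 :: 'v
    and lab :: "'v \<Rightarrow> nat" and b :: "'v \<Rightarrow> 'v"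
  assumes "n \<ge> 2" and "l \<ge> 1"
    and "tree_1n n E"
    and "compatible_labels n E v0 lab"
    and "b_extension n E v0 lab b"
  shows
    "(\<forall>\<psi>. lattice_embedding (BS (n ^ l)) (G_group n E v0) (G_topology n E v0) \<psi> \<longrightarrow>
        (\<exists>s m. s \<noteq> 0 \<and> reduced_multiplier n m \<and>
           conjugate_homs (BS (n ^ l)) (G_group n E v0) \<psi> (phi n l E v0 lab b s m)))
     \<and>
     (\<forall>\<psi> \<psi>' s s' m m'.
        lattice_embedding (BS (n ^ l)) (G_group n E v0) (G_topology n E v0) \<psi> \<longrightarrow>
        lattice_embedding (BS (n ^ l)) (G_group n E v0) (G_topology n E v0) \<psi>' \<longrightarrow>
        s \<noteq> 0 \<longrightarrow> s' \<noteq> 0 \<longrightarrow> reduced_multiplier n m \<longrightarrow> reduced_multiplier n m' \<longrightarrow>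
        conjugate_homs (BS (n ^ l)) (G_group n E v0) \<psi> (phi n l E v0 lab b s m) \<longrightarrow>
        conjugate_homs (BS (n ^ l)) (G_group n E v0) \<psi>' (phi n l E v0 lab b s' m') \<longrightarrow>
        (conjugate_homs (BS (n ^ l)) (G_group n E v0) \<psi> \<psi>' \<longleftrightarrow> (s, m) = (s', m')))
     \<and>
     (\<forall>s s' m m'.
        s \<noteq> 0 \<longrightarrow> s' \<noteq> 0 \<longrightarrow> reduced_multiplier n m \<longrightarrow> reduced_multiplier n m' \<longrightarrow>
        (s, m) \<noteq> (s', m') \<longrightarrow>
        \<not> conjugate_homs (BS (n ^ l)) (G_group n E v0)
            (phi n l E v0 lab b s m) (phi n l E v0 lab b s' m'))"
proof -
  interpret standard_tree n E v0 lab b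
    using assms by unfold_locales
  let ?conj = "conjugate_homs (BS (n ^ l)) G" and ?phi = "phi n l E v0 lab b"
  note sym = group.conjugate_homs_sym[OF group_G, where B = "BS (n ^ l)"]
  note trans = group.conjugate_homs_trans[OF group_G, where B = "BS (n ^ l)"]
  have "?conj \<psi> \<psi>' \<longleftrightarrow> (s, m) = (s', m')"
    if lat: "lattice_embedding (BS (n ^ l)) G (G_topology n E v0) \<psi>" "lattice_embedding (BS (n ^ l)) G (G_topology n E v0) \<psi>'"
      and m: "reduced_multiplier n m" "reduced_multiplier n m'"
      and conj: "?conj \<psi> (?phi s m)" "?conj \<psi>' (?phi s' m')" for \<psi> \<psi>' s s' m m'
  proof
    have h: "\<psi> \<in> hom (BS (n ^ l)) G" "\<psi>' \<in> hom (BS (n ^ l)) G" using lat by (simp_all add: lattice_embedding_def)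
    {
      assume "?conj \<psi> \<psi>'"
      then have "?conj (?phi s m) (?phi s' m')"
        using trans[OF phi_props(1) sym[OF h(1) conj(1)] trans[OF h(1) _ conj(2)]] by blast
      then show "(s, m) = (s', m')" by (rule phi_conjugate_unique[OF m])
    next
      assume "(s, m) = (s', m')"
      then show "?conj \<psi> \<psi>'" using trans[OF h(1) conj(1)] sym[OF h(2) conj(2)] by simp
    }
  qed
  then show ?thesis
    using lattice_embedding_conjugate[OF assms(2)] phi_conjugate_unique by blast
qed

end
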